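(* Let $(K_i,f_{ij})_{i,j\in I}$ be a directed system of differential fields (of characteristic $0$, in $m$ commuting derivations) and differential embeddings with the following properties. (a) All $K_i$ are large as fields. (b) All embeddings $f_{ij}:K_i\to K_j$ are isomorphisms onto a subfield of $K_j$ that is existentially closed in $K_j$ as a field. (c) For every $i\in I$ there is some $j\ge i$ such that there exists a differential homomorphism $K_i[[\mathbf t]]\to K_j$ extending $f_{ij}$. Then the direct limit $L$ of the directed system is a differentially large field.
   Context: All fields have characteristic $0$; a differential field is a field with $m\ge1$ commuting derivations $\delta_1,\dots,\delta_m$. For a differential field $K$ and $\mathbf t=(t_1,\dots,t_m)$, $K[[\mathbf t]]$ carries the natural derivations $\delta_i+\frac{\mathrm d}{\mathrm dt_i}$, where $\delta_i$ acts on coefficients. For a (differential) field extension $L/K$, $K$ is existentially closed (e.c.) in $L$ as a field (as a differential field) if every finite system of polynomial (differential polynomial) equations over $K$ with a solution in $L$ has a solution in $K$. A field $K$ is large if every irreducible affine algebraic variety over $K$ with a smooth $K$-point has a Zariski-dense set of $K$-points. A differential field $K$ is differentially large if it is large as a field and for every differential field extension $L/K$, if $K$ is e.c. in $L$ as a field then $K$ is e.c. in $L$ as a differential field. *)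

theory Defs
  imports "HOL-Algebra.Algebra" "HOL-Algebra.Indexed_Polynomials" "HOL-Library.Extended_Nat"
begin

section \<open>Polynomials and power series\<close>

text \<open>As in \<^theory>\<open>HOL-Algebra.Indexed_Polynomials\<close>, a monomial is the multiset of its variables,
  and a polynomial or a formal power series maps each monomial to its coefficient.
  The set \<^term>\<open>ring.indexed_pset R V F\<close> consists of the polynomials in the variables \<open>V\<close> with
  coefficients in \<open>F\<close>.\<close>

definition series_mult ::
    "('a, 'b) ring_scheme \<Rightarrow> ('v multiset \<Rightarrow> 'a) \<Rightarrow> ('v multiset \<Rightarrow> 'a) \<Rightarrow> 'v multiset \<Rightarrow> 'a"
  where "series_mult R p q = (\<lambda>m. \<Oplus>\<^bsub>R\<^esub>k\<in>{k. k \<subseteq># m}. p k \<otimes>\<^bsub>R\<^esub> q (m - k))"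

definition formal_deriv ::
    "('a, 'b) ring_scheme \<Rightarrow> 'v \<Rightarrow> ('v multiset \<Rightarrow> 'a) \<Rightarrow> 'v multiset \<Rightarrow> 'a"
  where "formal_deriv R v p = (\<lambda>m. [Suc (count m v)] \<cdot>\<^bsub>R\<^esub> p (add_mset v m))"

definition mpoly_eval :: "('a, 'b) ring_scheme \<Rightarrow> ('v \<Rightarrow> 'a) \<Rightarrow> ('v multiset \<Rightarrow> 'a) \<Rightarrow> 'a"
  where "mpoly_eval R a p =
    (\<Oplus>\<^bsub>R\<^esub>m\<in>{m. p m \<noteq> \<zero>\<^bsub>R\<^esub>}. p m \<otimes>\<^bsub>R\<^esub> (\<Otimes>\<^bsub>R\<^esub>v\<in>set_mset m. a v [^]\<^bsub>R\<^esub> count m v))"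

definition mpoly_ring :: "('a, 'b) ring_scheme \<Rightarrow> 'v set \<Rightarrow> ('v multiset \<Rightarrow> 'a) ring"
  where "mpoly_ring R V =
    \<lparr>carrier = ring.indexed_pset R V (carrier R), monoid.mult = series_mult R,
     monoid.one = ring.indexed_const R \<one>\<^bsub>R\<^esub>, ring.zero = ring.indexed_const R \<zero>\<^bsub>R\<^esub>,
     ring.add = ring.indexed_padd R\<rparr>"


section \<open>Large fields\<close>

text \<open>The supremum of the lengths \<open>d\<close> of strict chains \<open>C 0 \<subset> \<dots> \<subset> C d\<close> of prime ideals.\<close>

definition krull_dim :: "('a, 'b) ring_scheme \<Rightarrow> enat"
  where "krull_dim R =
    Sup {enat d | d. \<exists>C. (\<forall>i\<le>d. primeideal (C i) R) \<and> (\<forall>i<d. C i \<subset> C (Suc i))}"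

text \<open>An irreducible affine variety over \<open>K\<close> in affine \<open>n\<close>-space is given by its vanishing ideal,
  a prime ideal \<open>P\<close> of \<open>K[x\<^sub>0, \<dots>, x\<^bsub>n-1\<^esub>]\<close>; its coordinate ring is \<open>K[x\<^sub>0, \<dots>, x\<^bsub>n-1\<^esub>]/P\<close>.\<close>

definition irreducible_affine_variety ::
    "('a, 'b) ring_scheme \<Rightarrow> nat \<Rightarrow> (nat multiset \<Rightarrow> 'a) set \<Rightarrow> bool"
  where "irreducible_affine_variety K n P \<longleftrightarrow> primeideal P (mpoly_ring K {..<n})"

definition variety_dim :: "('a, 'b) ring_scheme \<Rightarrow> nat \<Rightarrow> (nat multiset \<Rightarrow> 'a) set \<Rightarrow> enat"
  where "variety_dim K n P = krull_dim (mpoly_ring K {..<n} Quot P)"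

definition rational_points ::
    "('a, 'b) ring_scheme \<Rightarrow> nat \<Rightarrow> (nat multiset \<Rightarrow> 'a) set \<Rightarrow> (nat \<Rightarrow> 'a) set"
  where "rational_points K n P =
    {a \<in> {..<n} \<rightarrow>\<^sub>E carrier K. \<forall>p\<in>P. mpoly_eval K a p = \<zero>\<^bsub>K\<^esub>}"

text \<open>The kernel of the Jacobian matrix at \<open>a\<close>.\<close>

definition tangent_space ::
    "('a, 'b) ring_scheme \<Rightarrow> nat \<Rightarrow> (nat multiset \<Rightarrow> 'a) set \<Rightarrow> (nat \<Rightarrow> 'a) \<Rightarrow> (nat \<Rightarrow> 'a) set"
  where "tangent_space K n P a =
    {v \<in> {..<n} \<rightarrow>\<^sub>E carrier K. \<forall>p\<in>P.
       (\<Oplus>\<^bsub>K\<^esub>j\<in>{..<n}. mpoly_eval K a (formal_deriv K j p) \<otimes>\<^bsub>K\<^esub> v j) = \<zero>\<^bsub>K\<^esub>}"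

text \<open>The subspace \<open>T\<close> of \<open>K\<^sup>n\<close> has a basis \<open>b 0, \<dots>, b (d - 1)\<close>.\<close>

definition has_vector_dim :: "('a, 'b) ring_scheme \<Rightarrow> nat \<Rightarrow> (nat \<Rightarrow> 'a) set \<Rightarrow> nat \<Rightarrow> bool"
  where "has_vector_dim K n T d \<longleftrightarrow>
    (\<exists>b\<in>{..<d} \<rightarrow> T. \<forall>v\<in>T. \<exists>!c. c \<in> {..<d} \<rightarrow>\<^sub>E carrier K \<and>
       (\<forall>j<n. v j = (\<Oplus>\<^bsub>K\<^esub>k\<in>{..<d}. c k \<otimes>\<^bsub>K\<^esub> b k j)))"

definition smooth_rational_point ::
    "('a, 'b) ring_scheme \<Rightarrow> nat \<Rightarrow> (nat multiset \<Rightarrow> 'a) set \<Rightarrow> (nat \<Rightarrow> 'a) \<Rightarrow> bool"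
  where "smooth_rational_point K n P a \<longleftrightarrow> a \<in> rational_points K n P \<and>
    (\<exists>d. has_vector_dim K n (tangent_space K n P a) d \<and> variety_dim K n P = enat d)"

text \<open>The sets \<open>g \<noteq> 0\<close> with \<open>g \<notin> P\<close> are the nonempty basic Zariski-open subsets of the variety.\<close>

definition rational_points_dense ::
    "('a, 'b) ring_scheme \<Rightarrow> nat \<Rightarrow> (nat multiset \<Rightarrow> 'a) set \<Rightarrow> bool"
  where "rational_points_dense K n P \<longleftrightarrow>
    (\<forall>g\<in>carrier (mpoly_ring K {..<n}) - P.
       \<exists>a\<in>rational_points K n P. mpoly_eval K a g \<noteq> \<zero>\<^bsub>K\<^esub>)"

definition large_field :: "('a, 'b) ring_scheme \<Rightarrow> bool"
  where "large_field K \<longleftrightarrow> field K \<and>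
    (\<forall>n P. irreducible_affine_variety K n P \<and> (\<exists>a. smooth_rational_point K n P a) \<longrightarrow>
       rational_points_dense K n P)"


section \<open>Differential rings and fields\<close>

text \<open>The \<open>m \<ge> 1\<close> derivations are indexed by a finite type \<open>'m\<close>.\<close>

record ('a, 'm) diff_ring = "'a ring" +
  der :: "'m \<Rightarrow> 'a \<Rightarrow> 'a"

locale differential_field = field K
  for K :: "('a, 'm::finite, 'z) diff_ring_scheme" (structure) +
  assumes char_zero: "\<And>n::nat. n > 0 \<Longrightarrow> [n] \<cdot> \<one> \<noteq> \<zero>"
    and der_closed: "\<And>d x. x \<in> carrier K \<Longrightarrow> der K d x \<in> carrier K"
    and der_add: "\<And>d x y. \<lbrakk>x \<in> carrier K; y \<in> carrier K\<rbrakk> \<Longrightarrow>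
      der K d (x \<oplus> y) = der K d x \<oplus> der K d y"
    and der_mult: "\<And>d x y. \<lbrakk>x \<in> carrier K; y \<in> carrier K\<rbrakk> \<Longrightarrow>
      der K d (x \<otimes> y) = der K d x \<otimes> y \<oplus> x \<otimes> der K d y"
    and der_commute: "\<And>d e x. x \<in> carrier K \<Longrightarrow> der K d (der K e x) = der K e (der K d x)"

definition differential_hom ::
    "('a \<Rightarrow> 'b) \<Rightarrow> ('a, 'm, 'y) diff_ring_scheme \<Rightarrow> ('b, 'm, 'z) diff_ring_scheme \<Rightarrow> bool"
  where "differential_hom h R S \<longleftrightarrow> h \<in> ring_hom R S \<and>
    (\<forall>d. \<forall>x\<in>carrier R. h (der R d x) = der S d (h x))"

definition differential_embedding ::
    "('a \<Rightarrow> 'b) \<Rightarrow> ('a, 'm, 'y) diff_ring_scheme \<Rightarrow> ('b, 'm, 'z) diff_ring_scheme \<Rightarrow> bool"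
  where "differential_embedding h R S \<longleftrightarrow> differential_hom h R S \<and> inj_on h (carrier R)"

text \<open>The ring \<open>K[[t]]\<close> with one variable per derivation and derivations \<open>\<delta>\<^sub>d + d/dt\<^sub>d\<close>.\<close>

definition power_series_ring ::
    "('a, 'm, 'z) diff_ring_scheme \<Rightarrow> ('m multiset \<Rightarrow> 'a, 'm) diff_ring"
  where "power_series_ring K =
    \<lparr>carrier = UNIV \<rightarrow> carrier K, monoid.mult = series_mult K,
     monoid.one = ring.indexed_const K \<one>\<^bsub>K\<^esub>, ring.zero = ring.indexed_const K \<zero>\<^bsub>K\<^esub>,
     ring.add = ring.indexed_padd K,
     der = (\<lambda>d p \<alpha>. der K d (p \<alpha>) \<oplus>\<^bsub>K\<^esub> formal_deriv K d p \<alpha>)\<rparr>"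

text \<open>The operator \<open>\<delta>\<^sup>\<alpha>\<close>, where the multiset \<open>\<alpha>\<close> contains each \<open>d\<close> as often as \<open>\<delta>\<^sub>d\<close> is to be applied.
  Commutativity of the derivations makes the value on \<open>carrier K\<close> independent of the enumeration
  of \<open>\<alpha>\<close> that is chosen.\<close>

definition higher_der :: "('a, 'm, 'z) diff_ring_scheme \<Rightarrow> 'm multiset \<Rightarrow> 'a \<Rightarrow> 'a"
  where "higher_der K \<alpha> x = foldr (der K) (SOME ds. mset ds = \<alpha>) x"


section \<open>Existential closedness and differential largeness\<close>

definition ec_as_field :: "'a set \<Rightarrow> ('a, 'b) ring_scheme \<Rightarrow> bool"
  where "ec_as_field F L \<longleftrightarrow> subfield F L \<and>
    (\<forall>n S. finite S \<and> S \<subseteq> ring.indexed_pset L {..<n} F \<and>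
       (\<exists>a\<in>{..<n} \<rightarrow> carrier L. \<forall>p\<in>S. mpoly_eval L a p = \<zero>\<^bsub>L\<^esub>) \<longrightarrow>
       (\<exists>a\<in>{..<n::nat} \<rightarrow> F. \<forall>p\<in>S. mpoly_eval L a p = \<zero>\<^bsub>L\<^esub>))"

text \<open>Differential polynomials in the indeterminates \<open>x\<^sub>0, \<dots>, x\<^bsub>n-1\<^esub>\<close> are polynomials in the
  variables \<open>(j, \<alpha>)\<close> with \<open>j < n\<close>, where \<open>(j, \<alpha>)\<close> stands for \<open>\<delta>\<^sup>\<alpha> x\<^sub>j\<close>.\<close>

definition diff_poly_eval ::
    "('a, 'm, 'z) diff_ring_scheme \<Rightarrow> (nat \<Rightarrow> 'a) \<Rightarrow> ((nat \<times> 'm multiset) multiset \<Rightarrow> 'a) \<Rightarrow> 'a"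
  where "diff_poly_eval L a p = mpoly_eval L (\<lambda>(j, \<alpha>). higher_der L \<alpha> (a j)) p"

definition ec_as_differential_field :: "'a set \<Rightarrow> ('a, 'm, 'z) diff_ring_scheme \<Rightarrow> bool"
  where "ec_as_differential_field F L \<longleftrightarrow>
    subfield F L \<and> (\<forall>d. \<forall>x\<in>F. der L d x \<in> F) \<and>
    (\<forall>n S. finite S \<and> S \<subseteq> ring.indexed_pset L ({..<n} \<times> UNIV) F \<and>
       (\<exists>a\<in>{..<n} \<rightarrow> carrier L. \<forall>p\<in>S. diff_poly_eval L a p = \<zero>\<^bsub>L\<^esub>) \<longrightarrow>
       (\<exists>a\<in>{..<n} \<rightarrow> F. \<forall>p\<in>S. diff_poly_eval L a p = \<zero>\<^bsub>L\<^esub>))"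

text \<open>HOL cannot quantify over types inside a formula, so the type \<open>'b\<close> in which the extensions
  \<open>L/K\<close> live is a parameter. Differential largeness is this property for every \<open>'b\<close>; a theorem that
  concludes it with \<open>'b\<close> a free type variable therefore covers all differential field extensions.
  An extension is an embedding \<open>h\<close>, with \<open>K\<close> identified with its image.\<close>

definition differentially_large :: "'b itself \<Rightarrow> ('a, 'm::finite, 'z) diff_ring_scheme \<Rightarrow> bool"
  where "differentially_large (_ :: 'b itself) K \<longleftrightarrow>
    differential_field K \<and> large_field K \<and>
    (\<forall>(L :: ('b, 'm) diff_ring) h.
       differential_field L \<and> differential_embedding h K L \<and> ec_as_field (h ` carrier K) L \<longrightarrow>
       ec_as_differential_field (h ` carrier K) L)"


section \<open>Directed systems and direct limits\<close>

locale differential_directed_system =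
  fixes I :: "'i set"
    and prec :: "'i \<Rightarrow> 'i \<Rightarrow> bool"  (infix \<open>\<preceq>\<close> 50)
    and K :: "'i \<Rightarrow> ('a, 'm::finite) diff_ring"
    and f :: "'i \<Rightarrow> 'i \<Rightarrow> 'a \<Rightarrow> 'a"
  assumes index_nonempty: "I \<noteq> {}"
    and le_refl: "\<And>i. i \<in> I \<Longrightarrow> i \<preceq> i"
    and le_trans: "\<And>i j k. \<lbrakk>i \<in> I; j \<in> I; k \<in> I; i \<preceq> j; j \<preceq> k\<rbrakk> \<Longrightarrow> i \<preceq> k"
    and directed: "\<And>i j. \<lbrakk>i \<in> I; j \<in> I\<rbrakk> \<Longrightarrow> \<exists>k\<in>I. i \<preceq> k \<and> j \<preceq> k"
    and diff_field: "\<And>i. i \<in> I \<Longrightarrow> differential_field (K i)"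
    and embedding: "\<And>i j. \<lbrakk>i \<in> I; j \<in> I; i \<preceq> j\<rbrakk> \<Longrightarrow> differential_embedding (f i j) (K i) (K j)"
    and map_id: "\<And>i x. \<lbrakk>i \<in> I; x \<in> carrier (K i)\<rbrakk> \<Longrightarrow> f i i x = x"
    and map_comp: "\<And>i j k x. \<lbrakk>i \<in> I; j \<in> I; k \<in> I; i \<preceq> j; j \<preceq> k; x \<in> carrier (K i)\<rbrakk> \<Longrightarrow>
      f j k (f i j x) = f i k x"

definition limit_rel ::
    "'i set \<Rightarrow> ('i \<Rightarrow> 'i \<Rightarrow> bool) \<Rightarrow> ('i \<Rightarrow> ('a, 'm) diff_ring) \<Rightarrow> ('i \<Rightarrow> 'i \<Rightarrow> 'a \<Rightarrow> 'a) \<Rightarrow>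
      (('i \<times> 'a) \<times> ('i \<times> 'a)) set"
  where "limit_rel I prec K f =
    {((i, x), (j, y)). i \<in> I \<and> x \<in> carrier (K i) \<and> j \<in> I \<and> y \<in> carrier (K j) \<and>
       (\<exists>k\<in>I. prec i k \<and> prec j k \<and> f i k x = f j k y)}"

text \<open>The disjoint union of the \<open>K i\<close> modulo \<^const>\<open>limit_rel\<close>. The operations are computed on
  representatives at a common index; as the result does not depend on these, each union below is
  over copies of one and the same class.\<close>

definition direct_limit ::
    "'i set \<Rightarrow> ('i \<Rightarrow> 'i \<Rightarrow> bool) \<Rightarrow> ('i \<Rightarrow> ('a, 'm) diff_ring) \<Rightarrow> ('i \<Rightarrow> 'i \<Rightarrow> 'a \<Rightarrow> 'a) \<Rightarrow>
      (('i \<times> 'a) set, 'm) diff_ring"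
  where "direct_limit I prec K f =
    (let cls = (\<lambda>i x. limit_rel I prec K f `` {(i, x)}) in
    \<lparr>carrier = (SIGMA i:I. carrier (K i)) // limit_rel I prec K f,
     monoid.mult = (\<lambda>A B. \<Union>{cls k (x \<otimes>\<^bsub>K k\<^esub> y) | k x y. (k, x) \<in> A \<and> (k, y) \<in> B}),
     monoid.one = (\<Union>k\<in>I. cls k \<one>\<^bsub>K k\<^esub>),
     ring.zero = (\<Union>k\<in>I. cls k \<zero>\<^bsub>K k\<^esub>),
     ring.add = (\<lambda>A B. \<Union>{cls k (x \<oplus>\<^bsub>K k\<^esub> y) | k x y. (k, x) \<in> A \<and> (k, y) \<in> B}),
     der = (\<lambda>d A. \<Union>{cls k (der (K k) d x) | k x. (k, x) \<in> A})\<rparr>)"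

end

theory Submission
  imports Defs "HOL-Library.Multiset_Order"
begin

text \<open>Let \<open>F\<close> be a differential field extending the limit \<open>L\<close> in which \<open>L\<close> is existentially closed as a
  field. A system over \<open>L\<close> is defined over some \<open>K\<^sub>i\<close>, which is existentially closed in \<open>F\<close> as a field.
  From a solution \<open>a\<close> in \<open>F\<close> one obtains a \<open>K\<^sub>i\<close>-algebra homomorphism \<open>K\<^sub>i{a} \<rightarrow> K\<^sub>i\<close>: a derivative of \<open>a\<close>
  that is algebraic over the lower ones has derivatives rational over the lower ones, with its separant as
  denominator, so by Dickson's lemma only a finitely generated subalgebra matters, and this one has a
  point by existential closedness. The twisted Taylor morphism turns the point into a differential
  homomorphism \<open>K\<^sub>i{a} \<rightarrow> K\<^sub>i[[t]]\<close>, and composing with \<open>K\<^sub>i[[t]] \<rightarrow> K\<^sub>j\<close> solves the system in \<open>K\<^sub>j\<close>.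
  Largeness passes to the limit because existential closedness makes extension of scalars preserve
  prime ideals, so that a variety over \<open>L\<close> and its descent to \<open>K\<^sub>i\<close> have the same dimension.\<close>

section \<open>Polynomials\<close>

text \<open>Existential closedness speaks of finite systems, whereas a homomorphism must respect all
  relations. By Hilbert's basis theorem the relations among finitely many elements follow from
  finitely many of them, so a solution of these is an algebra homomorphism onto the small field, a
  \<open>retraction\<close>. Both halves of the proof push finite data of the big field down along
  such maps. In the differential half the point so obtained ignores the derivations, and as these
  may act nontrivially on K_i, its ordinary Taylor series would not be compatible with \<delta> +
  d/dt; twisting repairs this. In the half on largeness, non-membership in an ideal is nothing a
  homomorphism preserves by itself; it is secured by a shortest expression modulo the ideal, with
  the inverse of one coefficient put among the data. Dimension is defined by chains of primes, so
  chains have to be compared: a longest chain over L stays strict after contraction if polynomials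
  witnessing its strictness have coefficients in K_i. Such witnesses belong to the finite data that
  select i.\<close>

lemma finite_subseteq_mset: "finite {k. k \<subseteq># m}"
proof (induction m)
  case empty
  then show ?case by simp
next
  case (add x m)
  have "{k. k \<subseteq># add_mset x m} \<subseteq> {k. k \<subseteq># m} \<union> add_mset x ` {k. k \<subseteq># m}"
  proof
    fix k assume k: "k \<in> {k. k \<subseteq># add_mset x m}"
    show "k \<in> {k. k \<subseteq># m} \<union> add_mset x ` {k. k \<subseteq># m}"
    proof (cases "x \<in># k")
      case True
      then obtain k' where "k = add_mset x k'" by (metis insert_DiffM)
      with k show ?thesis by simp
    next
      case False
      with k have "k \<subseteq># m"
        by (metis diff_single_trivial mem_Collect_eq subset_eq_diff_conv add_mset_add_single)
      then show ?thesis by simp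
    qed
  qed
  then show ?case using add finite_subset by blast
qed

definition monom_eval :: "('a, 'b) ring_scheme \<Rightarrow> ('v \<Rightarrow> 'a) \<Rightarrow> 'v multiset \<Rightarrow> 'a"
  where "monom_eval R a m = (\<Otimes>\<^bsub>R\<^esub>v\<in>set_mset m. a v [^]\<^bsub>R\<^esub> count m v)"

context ring
begin

lemma indexed_pset_coeff:
  assumes "p \<in> indexed_pset V F" "F \<subseteq> carrier R"
  shows "p m \<in> carrier R"
  using indexed_pset_in_carrier[OF assms(2,1)] by (rule carrier_coeffE)

lemma indexed_pset_mono:
  assumes "F \<subseteq> F'" "V \<subseteq> V'"
  shows "indexed_pset V F \<subseteq> indexed_pset V' F'"
proof
  fix p assume "p \<in> indexed_pset V F"
  then show "p \<in> indexed_pset V' F'"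
    by induction (use assms in \<open>auto intro: indexed_pset.intros\<close>)
qed

lemma indexed_pset_finite_support:
  assumes "p \<in> indexed_pset V F"
  shows "finite {m. p m \<noteq> \<zero>}"
  using assms
proof induction
  case (indexed_const k)
  have "{m. indexed_const k m \<noteq> \<zero>} \<subseteq> {{#}}" by (auto simp: indexed_const_def)
  then show ?case by (rule finite_subset) simp
next
  case (indexed_padd P Q)
  have "{m. indexed_padd P Q m \<noteq> \<zero>} \<subseteq> {m. P m \<noteq> \<zero>} \<union> {m. Q m \<noteq> \<zero>}"
    by (auto simp: indexed_padd_def)
  then show ?case by (rule finite_subset) (use indexed_padd.IH in simp)
next
  case (indexed_pmult P i)
  have "{m. indexed_pmult P i m \<noteq> \<zero>} \<subseteq> add_mset i ` {m. P m \<noteq> \<zero>}"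
  proof
    fix m assume "m \<in> {m. indexed_pmult P i m \<noteq> \<zero>}"
    then have "i \<in># m" "P (m - {#i#}) \<noteq> \<zero>" by (auto simp: indexed_pmult_def split: if_splits)
    then show "m \<in> add_mset i ` {m. P m \<noteq> \<zero>}" by (intro image_eqI[of _ _ "m - {#i#}"]) auto
  qed
  then show ?case by (rule finite_subset) (use indexed_pmult.IH in simp)
qed

lemma indexed_pset_vars:
  assumes "p \<in> indexed_pset V F" "p m \<noteq> \<zero>"
  shows "set_mset m \<subseteq> V"
  using assms
proof (induction arbitrary: m)
  case (indexed_const k)
  then show ?case by (auto simp: indexed_const_def split: if_splits)
next
  case (indexed_padd P Q)
  then have "P m \<noteq> \<zero> \<or> Q m \<noteq> \<zero>" by (auto simp: indexed_padd_def)
  then show ?case using indexed_padd.IH by blast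
next
  case (indexed_pmult P i)
  then have "i \<in># m" "P (m - {#i#}) \<noteq> \<zero>" by (auto simp: indexed_pmult_def split: if_splits)
  with indexed_pmult.IH[of "m - {#i#}"] indexed_pmult.hyps show ?case
    by (metis insert_DiffM insert_subset set_mset_add_mset_insert)
qed

end

section \<open>Evaluation of polynomials\<close>

context cring
begin

lemma monom_eval_empty [simp]: "monom_eval R a {#} = \<one>"
  by (simp add: monom_eval_def)

lemma monom_eval_closed:
  assumes "a \<in> V \<rightarrow> carrier R" "set_mset m \<subseteq> V"
  shows "monom_eval R a m \<in> carrier R"
  unfolding monom_eval_def using assms by (intro finprod_closed) auto

lemma monom_eval_add_mset:
  assumes "a \<in> V \<rightarrow> carrier R" "set_mset m \<subseteq> V" "i \<in> V"
  shows "monom_eval R a (add_mset i m) = a i \<otimes> monom_eval R a m"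
proof -
  let ?g = "\<lambda>v. a v [^] count m v"
  \<comment> \<open>\<open>i\<close> may or may not occur in \<open>m\<close>. With \<open>i\<close>
    split off, both products run over \<open>insert i ?A\<close>; if \<open>i\<close> is absent from
    \<open>m\<close>, its factor in the second one is a zeroth power.\<close>
  let ?A = "set_mset m - {i}"
  have ai: "a i \<in> carrier R" using assms by auto
  have av: "a v \<in> carrier R" if "v \<in> ?A" for v using assms that by auto
  have 1: "monom_eval R a (add_mset i m) = (\<Otimes>v\<in>insert i ?A. a v [^] count (add_mset i m) v)"
    unfolding monom_eval_def by (rule finprod_cong') (use ai av in auto)
  also have "\<dots> = a i [^] Suc (count m i) \<otimes> (\<Otimes>v\<in>?A. a v [^] count (add_mset i m) v)"
    by (subst finprod_insert) (use ai av in auto)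
  also have "(\<Otimes>v\<in>?A. a v [^] count (add_mset i m) v) = (\<Otimes>v\<in>?A. ?g v)"
    by (rule finprod_cong') (use av in auto)
  also have "a i [^] Suc (count m i) \<otimes> (\<Otimes>v\<in>?A. ?g v) = a i \<otimes> (?g i \<otimes> (\<Otimes>v\<in>?A. ?g v))"
  proof -
    have "(\<Otimes>v\<in>?A. ?g v) \<in> carrier R" using av by (intro finprod_closed) auto
    with ai show ?thesis by (simp add: m_ac)
  qed
  also have "?g i \<otimes> (\<Otimes>v\<in>?A. ?g v) = (\<Otimes>v\<in>insert i ?A. ?g v)"
    by (subst finprod_insert) (use ai av in auto)
  also have "\<dots> = monom_eval R a m"
    unfolding monom_eval_def
  proof (rule finprod_mono_neutral_cong_right)
    show "?g v = \<one>" if "v \<in> insert i ?A - set_mset m" for v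
      using that by (auto simp: not_in_iff)
  qed (use ai av in auto)
  finally show ?thesis .
qed

text \<open>Evaluations of polynomials with different supports can be compared term by term once
  their sums run over a common index set; the extra monomials contribute zero.\<close>

lemma mpoly_eval_superset:
  assumes "p \<in> indexed_pset V F" "F \<subseteq> carrier R" "a \<in> V \<rightarrow> carrier R"
    and "finite S" "{m. p m \<noteq> \<zero>} \<subseteq> S" "\<And>m. m \<in> S \<Longrightarrow> set_mset m \<subseteq> V"
  shows "mpoly_eval R a p = (\<Oplus>m\<in>S. p m \<otimes> monom_eval R a m)"
  unfolding mpoly_eval_def monom_eval_def[symmetric]
proof (rule add.finprod_mono_neutral_cong_left)
  show "(\<lambda>m. p m \<otimes> monom_eval R a m) \<in> S \<rightarrow> carrier R"
    using assms(6) monom_eval_closed[OF assms(3)] indexed_pset_coeff[OF assms(1,2)] by auto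
  show "p m \<otimes> monom_eval R a m = \<zero>" if "m \<in> S - {m. p m \<noteq> \<zero>}" for m
    using that assms(6) monom_eval_closed[OF assms(3)] by auto
qed (use assms in auto)

lemma mpoly_eval_const [simp]:
  assumes "k \<in> carrier R"
  shows "mpoly_eval R a (indexed_const k) = k"
proof -
  have "mpoly_eval R a (indexed_const k) =
    (\<Oplus>m\<in>{{#}}. indexed_const k m \<otimes> monom_eval R a m)"
    unfolding mpoly_eval_def monom_eval_def[symmetric]
  proof (rule add.finprod_mono_neutral_cong_left)
    show "(\<lambda>m. indexed_const k m \<otimes> monom_eval R a m) \<in> {{#}} \<rightarrow> carrier R"
      using assms by (auto simp: indexed_const_def)
  qed (use assms in \<open>auto simp: indexed_const_def split: if_splits\<close>)
  also have "\<dots> = k" using assms by (simp add: indexed_const_def)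
  finally show ?thesis .
qed

lemma mpoly_eval_padd:
  assumes "p \<in> indexed_pset V F" "q \<in> indexed_pset V F" "F \<subseteq> carrier R" "a \<in> V \<rightarrow> carrier R"
  shows "mpoly_eval R a (indexed_padd p q) = mpoly_eval R a p \<oplus> mpoly_eval R a q"
proof -
  let ?S = "{m. p m \<noteq> \<zero>} \<union> {m. q m \<noteq> \<zero>}"
  have S: "finite ?S" using indexed_pset_finite_support assms by blast
  have V: "set_mset m \<subseteq> V" if "m \<in> ?S" for m
    using that indexed_pset_vars assms(1,2) by blast
  have cp: "p m \<in> carrier R" and cq: "q m \<in> carrier R" for m
    using indexed_pset_coeff assms by blast+
  have "mpoly_eval R a (indexed_padd p q) =
      (\<Oplus>m\<in>?S. indexed_padd p q m \<otimes> monom_eval R a m)"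
    by (rule mpoly_eval_superset[OF indexed_pset.indexed_padd[OF assms(1,2)] assms(3,4) S])
      (use V in \<open>auto simp: indexed_padd_def\<close>)
  also have "\<dots> = (\<Oplus>m\<in>?S. p m \<otimes> monom_eval R a m \<oplus> q m \<otimes> monom_eval R a m)"
    by (rule add.finprod_cong')
      (use V monom_eval_closed[OF assms(4)] cp cq in \<open>auto simp: indexed_padd_def l_distr\<close>)
  also have "\<dots> = (\<Oplus>m\<in>?S. p m \<otimes> monom_eval R a m) \<oplus> (\<Oplus>m\<in>?S. q m \<otimes> monom_eval R a m)"
    by (rule add.finprod_multf) (use V monom_eval_closed[OF assms(4)] cp cq in auto)
  also have "(\<Oplus>m\<in>?S. p m \<otimes> monom_eval R a m) = mpoly_eval R a p"
    by (rule mpoly_eval_superset[OF assms(1,3,4) S, symmetric]) (use V in auto)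
  also have "(\<Oplus>m\<in>?S. q m \<otimes> monom_eval R a m) = mpoly_eval R a q"
    by (rule mpoly_eval_superset[OF assms(2,3,4) S, symmetric]) (use V in auto)
  finally show ?thesis .
qed

lemma mpoly_eval_closed:
  assumes "p \<in> indexed_pset V F" "F \<subseteq> carrier R" "a \<in> V \<rightarrow> carrier R"
  shows "mpoly_eval R a p \<in> carrier R"
  unfolding mpoly_eval_def monom_eval_def[symmetric]
  using indexed_pset_coeff[OF assms(1,2)] monom_eval_closed[OF assms(3)] indexed_pset_vars[OF assms(1)]
  by (intro finsum_closed) auto

lemma mpoly_eval_pmult:
  assumes "p \<in> indexed_pset V F" "F \<subseteq> carrier R" "a \<in> V \<rightarrow> carrier R" "i \<in> V"
  shows "mpoly_eval R a (indexed_pmult p i) = mpoly_eval R a p \<otimes> a i"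
proof -
  let ?S = "{m. p m \<noteq> \<zero>}"
  have S: "finite ?S" using indexed_pset_finite_support assms by blast
  have V: "set_mset m \<subseteq> V" if "m \<in> ?S" for m
    using that indexed_pset_vars assms(1) by blast
  have cp: "p m \<in> carrier R" for m using indexed_pset_coeff assms by blast
  have ai: "a i \<in> carrier R" using assms by auto
  have "mpoly_eval R a (indexed_pmult p i) =
      (\<Oplus>m\<in>add_mset i ` ?S. indexed_pmult p i m \<otimes> monom_eval R a m)"
  proof (rule mpoly_eval_superset[OF indexed_pset.indexed_pmult[OF assms(1,4)] assms(2,3)])
    show "{m. indexed_pmult p i m \<noteq> \<zero>} \<subseteq> add_mset i ` ?S"
    proof
      fix m assume "m \<in> {m. indexed_pmult p i m \<noteq> \<zero>}"
      then have "i \<in># m" "p (m - {#i#}) \<noteq> \<zero>" by (auto simp: indexed_pmult_def split: if_splits)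
      then show "m \<in> add_mset i ` ?S" by (intro image_eqI[of _ _ "m - {#i#}"]) auto
    qed
    show "set_mset m \<subseteq> V" if "m \<in> add_mset i ` ?S" for m using V assms(4) that by (auto dest!: V)
  qed (use S in auto)
  also have "\<dots> = (\<Oplus>m\<in>?S. indexed_pmult p i (add_mset i m) \<otimes> monom_eval R a (add_mset i m))"
    by (rule add.finprod_reindex)
      (use V assms(4) cp monom_eval_closed[OF assms(3)] in
        \<open>auto simp: indexed_pmult_def inj_on_def\<close>)
  also have "\<dots> = (\<Oplus>m\<in>?S. (p m \<otimes> monom_eval R a m) \<otimes> a i)"
    by (rule add.finprod_cong')
      (use V assms cp ai monom_eval_closed[OF assms(3)] in
        \<open>auto simp: indexed_pmult_def monom_eval_add_mset[OF assms(3)] m_ac\<close>)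
  also have "\<dots> = (\<Oplus>m\<in>?S. p m \<otimes> monom_eval R a m) \<otimes> a i"
    by (rule finsum_ldistr[symmetric]) (use S ai cp V monom_eval_closed[OF assms(3)] in auto)
  also have "(\<Oplus>m\<in>?S. p m \<otimes> monom_eval R a m) = mpoly_eval R a p"
    by (rule mpoly_eval_superset[OF assms(1,2,3) S, symmetric]) (use V in auto)
  finally show ?thesis .
qed

lemma mpoly_eval_in_subring:
  assumes "p \<in> indexed_pset V F" "subring S R" "F \<subseteq> S" "a \<in> V \<rightarrow> S"
  shows "mpoly_eval R a p \<in> S"
proof -
  have S: "S \<subseteq> carrier R" using subringE(1)[OF assms(2)] .
  have F: "F \<subseteq> carrier R" "a \<in> V \<rightarrow> carrier R" using assms S by auto
  show ?thesis using assms(1)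
  proof induction
    case (indexed_const k)
    then have "k \<in> carrier R" "k \<in> S" using assms F by auto
    then show ?case by simp
  next
    case (indexed_padd P Q)
    then show ?case using mpoly_eval_padd[OF _ _ F] subringE(7)[OF assms(2)] by auto
  next
    case (indexed_pmult P i)
    then have "a i \<in> S" using assms(4) by auto
    with indexed_pmult show ?case
      using mpoly_eval_pmult[OF indexed_pmult.hyps(1) F] subringE(6)[OF assms(2)] by simp
  qed
qed

lemma series_mult_closed:
  assumes "\<And>m. p m \<in> carrier R" "\<And>m. q m \<in> carrier R"
  shows "series_mult R p q m \<in> carrier R"
  unfolding series_mult_def using assms by (intro finsum_closed) auto

lemma series_mult_const:
  assumes "\<And>m. p m \<in> carrier R" "k \<in> carrier R"
  shows "series_mult R p (indexed_const k) = (\<lambda>m. p m \<otimes> k)"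
proof
  fix m
  have "(\<Oplus>l\<in>{m}. p l \<otimes> indexed_const k (m - l)) = series_mult R p (indexed_const k) m"
    unfolding series_mult_def
  proof (rule add.finprod_mono_neutral_cong_left)
    show "p l \<otimes> indexed_const k (m - l) = \<zero>" if "l \<in> {k. k \<subseteq># m} - {m}" for l
      using that assms by (auto simp: indexed_const_def Diff_eq_empty_iff_mset)
  qed (use assms finite_subseteq_mset in \<open>auto simp: indexed_const_def\<close>)
  then show "series_mult R p (indexed_const k) m = p m \<otimes> k"
    using assms by (simp add: indexed_const_def)
qed

lemma series_mult_padd:
  assumes "\<And>m. p m \<in> carrier R" "\<And>m. q m \<in> carrier R" "\<And>m. r m \<in> carrier R"
  shows "series_mult R p (indexed_padd q r) =
    indexed_padd (series_mult R p q) (series_mult R p r)"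
proof
  fix m
  have "series_mult R p (indexed_padd q r) m =
      (\<Oplus>k\<in>{k. k \<subseteq># m}. p k \<otimes> q (m - k) \<oplus> p k \<otimes> r (m - k))"
    unfolding series_mult_def indexed_padd_def
    by (rule add.finprod_cong') (use assms in \<open>auto simp: r_distr\<close>)
  also have "\<dots> = indexed_padd (series_mult R p q) (series_mult R p r) m"
    unfolding series_mult_def indexed_padd_def
    by (rule add.finprod_multf) (use assms in auto)
  finally show "series_mult R p (indexed_padd q r) m =
    indexed_padd (series_mult R p q) (series_mult R p r) m" .
qed

lemma series_mult_pmult:
  assumes "\<And>m. p m \<in> carrier R" "\<And>m. q m \<in> carrier R"
  shows "series_mult R p (indexed_pmult q i) = indexed_pmult (series_mult R p q) i"
proof
  fix m
  show "series_mult R p (indexed_pmult q i) m = indexed_pmult (series_mult R p q) i m"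
  proof (cases "i \<in># m")
    case False
    then have "i \<notin># m - k" for k by (meson in_diffD)
    then have "series_mult R p (indexed_pmult q i) m = (\<Oplus>k\<in>{k. k \<subseteq># m}. \<zero>)"
      unfolding series_mult_def indexed_pmult_def
      by (intro add.finprod_cong') (use assms in auto)
    then show ?thesis using False by (simp add: indexed_pmult_def)
  next
    case True
    then obtain m' where m: "m = add_mset i m'" by (metis insert_DiffM)
    have "series_mult R p q m' = series_mult R p (indexed_pmult q i) m"
      unfolding series_mult_def
    proof (rule add.finprod_mono_neutral_cong_left)
      show "{k. k \<subseteq># m'} \<subseteq> {k. k \<subseteq># m}"
        unfolding m by (auto intro: subset_mset.order_trans)
      \<comment> \<open>A divisor \<open>k\<close> of \<open>m\<close> that does not divide
        \<open>m'\<close> uses up every copy of \<open>i\<close>, so \<open>i\<close> is missing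
        from \<open>m - k\<close> and the shifted series vanishes there.\<close>
      show "p k \<otimes> indexed_pmult q i (m - k) = \<zero>" if "k \<in> {k. k \<subseteq># m} - {k. k \<subseteq># m'}" for k
      proof -
        have "i \<notin># m - k"
        proof
          assume i: "i \<in># m - k"
          have k: "k \<subseteq># m" using that by simp
          have "add_mset i k \<subseteq># m"
            by (metis i k add_mset_add_single mset_subset_eq_single subset_mset.le_diff_conv2 union_commute)
          then have "k \<subseteq># m'" unfolding m by simp
          then show False using that by simp
        qed
        then show ?thesis using assms by (simp add: indexed_pmult_def)
      qed
      show "p k \<otimes> q (m' - k) = p k \<otimes> indexed_pmult q i (m - k)" if "k \<in> {k. k \<subseteq># m'}" for k
      proof -
        have "m - k = add_mset i (m' - k)"
          unfolding m using that by (auto simp: mset_subset_eq_exists_conv)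
        then show ?thesis by (simp add: indexed_pmult_def)
      qed
    qed (use assms finite_subseteq_mset in \<open>auto simp: indexed_pmult_def\<close>)
    then show ?thesis unfolding m by (simp add: indexed_pmult_def)
  qed
qed

text \<open>Sending \<open>k\<close> to \<open>m - k\<close> is an involution on the divisors of
  \<open>m\<close>; reindexing the convolution along it exchanges the factors.\<close>

lemma series_mult_comm:
  fixes p q :: "'v multiset \<Rightarrow> 'a"
  assumes "\<And>m. p m \<in> carrier R" "\<And>m. q m \<in> carrier R"
  shows "series_mult R p q = series_mult R q p"
proof
  fix m :: "'v multiset"
  have im: "(\<lambda>k. m - k) ` {k. k \<subseteq># m} = {k. k \<subseteq># m}"
  proof
    show "{k. k \<subseteq># m} \<subseteq> (\<lambda>k. m - k) ` {k. k \<subseteq># m}"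
    proof
      fix k assume "k \<in> {k. k \<subseteq># m}"
      then show "k \<in> (\<lambda>k. m - k) ` {k. k \<subseteq># m}"
        by (intro image_eqI[of _ _ "m - k"]) (auto simp: mset_subset_eq_exists_conv)
    qed
  qed auto
  have inj: "inj_on (\<lambda>k. m - k) {k. k \<subseteq># m}"
    by (rule inj_onI) (metis mem_Collect_eq subset_mset.diff_diff_right subset_mset.add_diff_inverse
        add_diff_cancel_right' subset_mset.diff_add)
  have "series_mult R p q m = (\<Oplus>k\<in>(\<lambda>k. m - k) ` {k. k \<subseteq># m}. p k \<otimes> q (m - k))"
    unfolding series_mult_def im ..
  also have "\<dots> = (\<Oplus>k\<in>{k. k \<subseteq># m}. p (m - k) \<otimes> q (m - (m - k)))"
    by (rule add.finprod_reindex) (use assms inj in auto)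
  also have "\<dots> = series_mult R q p m"
    unfolding series_mult_def
  proof (rule add.finprod_cong')
    fix k assume k: "k \<in> {k. k \<subseteq># m}"
    then have "m - (m - k) = k" by (auto simp: mset_subset_eq_exists_conv)
    then show "p (m - k) \<otimes> q (m - (m - k)) = q k \<otimes> p (m - k)"
      using assms by (simp add: m_comm)
  qed (use assms in auto)
  finally show "series_mult R p q m = series_mult R q p m" .
qed


lemma series_mult_indexed_pset:
  fixes p q :: "'v multiset \<Rightarrow> 'a"
  assumes "p \<in> indexed_pset V F" "q \<in> indexed_pset V F" "subring F R"
  shows "series_mult R p q \<in> indexed_pset V F"
proof -
  have F: "F \<subseteq> carrier R" using subringE(1)[OF assms(3)] .
  have cp: "p m \<in> carrier R" for m using indexed_pset_coeff assms(1) F by blast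
  have const: "(\<lambda>m. p m \<otimes> k) \<in> indexed_pset V F" if "k \<in> F" for k
    using assms(1)
  proof induction
    case (indexed_const l)
    have "(\<lambda>m :: 'v multiset. indexed_const l m \<otimes> k) = indexed_const (l \<otimes> k)"
      using subsetD[OF F that] by (auto simp: indexed_const_def)
    then show ?case using indexed_const that subringE(6)[OF assms(3)]
      by (simp add: indexed_pset.indexed_const)
  next
    case (indexed_padd P Q)
    have "(\<lambda>m. indexed_padd P Q m \<otimes> k) = indexed_padd (\<lambda>m. P m \<otimes> k) (\<lambda>m. Q m \<otimes> k)"
      using that F indexed_pset_coeff[OF indexed_padd.hyps(1) F]
        indexed_pset_coeff[OF indexed_padd.hyps(2) F]
      by (auto simp: indexed_padd_def l_distr)
    then show ?case using indexed_padd.IH by (simp add: indexed_pset.indexed_padd)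
  next
    case (indexed_pmult P i)
    have "(\<lambda>m. indexed_pmult P i m \<otimes> k) = indexed_pmult (\<lambda>m. P m \<otimes> k) i"
      using subsetD[OF F that] by (auto simp: indexed_pmult_def)
    then show ?case using indexed_pmult by (simp add: indexed_pset.indexed_pmult)
  qed
  show ?thesis using assms(2)
  proof induction
    case (indexed_const k)
    then show ?case using series_mult_const[of p k] cp const F by auto
  next
    case (indexed_padd P Q)
    have "P m \<in> carrier R" "Q m \<in> carrier R" for m
      using indexed_padd.hyps F indexed_pset_coeff by blast+
    then show ?case using indexed_padd.IH series_mult_padd[of p P Q] cp
      by (simp add: indexed_pset.indexed_padd)
  next
    case (indexed_pmult P i)
    have "P m \<in> carrier R" for m
      using indexed_pmult.hyps F indexed_pset_coeff by blast
    then show ?case using indexed_pmult series_mult_pmult[of p P i] cp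
      by (simp add: indexed_pset.indexed_pmult)
  qed
qed

text \<open>Induction on the construction of the polynomial \<open>r\<close> avoids rearranging a
  triple sum; \<open>p\<close> and \<open>q\<close> may be arbitrary series.\<close>

lemma series_mult_assoc:
  assumes "\<And>m. p m \<in> carrier R" "\<And>m. q m \<in> carrier R" "r \<in> indexed_pset V (carrier R)"
  shows "series_mult R (series_mult R p q) r = series_mult R p (series_mult R q r)"
proof -
  have pq: "series_mult R p q m \<in> carrier R" for m using series_mult_closed assms by blast
  show ?thesis using assms(3)
  proof induction
    case (indexed_const k)
    have "series_mult R p (\<lambda>m. q m \<otimes> k) = (\<lambda>m. series_mult R p q m \<otimes> k)"
    proof
      fix m
      have "series_mult R p (\<lambda>m. q m \<otimes> k) m = (\<Oplus>l\<in>{l. l \<subseteq># m}. (p l \<otimes> q (m - l)) \<otimes> k)"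
        unfolding series_mult_def
        by (rule add.finprod_cong') (use assms(1,2) indexed_const in \<open>auto simp: m_assoc\<close>)
      also have "\<dots> = series_mult R p q m \<otimes> k"
        unfolding series_mult_def
        by (rule finsum_ldistr[symmetric])
          (use assms(1,2) indexed_const finite_subseteq_mset in auto)
      finally show "series_mult R p (\<lambda>m. q m \<otimes> k) m = series_mult R p q m \<otimes> k" .
    qed
    then show ?case
      using series_mult_const[of q k] series_mult_const[of "series_mult R p q" k]
        indexed_const assms(2) pq by simp
  next
    case (indexed_padd P Q)
    have c: "P m \<in> carrier R" "Q m \<in> carrier R" for m
      using indexed_padd.hyps indexed_pset_coeff by blast+
    have "series_mult R q P m \<in> carrier R" "series_mult R q Q m \<in> carrier R" for m
      using series_mult_closed c assms(2) by blast+
    then show ?case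
      using indexed_padd.IH c assms(1,2) pq by (simp add: series_mult_padd)
  next
    case (indexed_pmult P i)
    have c: "P m \<in> carrier R" for m
      using indexed_pmult.hyps indexed_pset_coeff by blast+
    have "series_mult R q P m \<in> carrier R" for m
      using series_mult_closed c assms(2) by blast+
    then show ?case
      using indexed_pmult.IH c assms(1,2) pq by (simp add: series_mult_pmult)
  qed
qed

lemma mpoly_ring_simps:
  "carrier (mpoly_ring R V) = indexed_pset V (carrier R)"
  "monoid.mult (mpoly_ring R V) = series_mult R"
  "monoid.one (mpoly_ring R V) = indexed_const \<one>"
  "ring.zero (mpoly_ring R V) = indexed_const \<zero>"
  "ring.add (mpoly_ring R V) = indexed_padd"
  by (simp_all add: mpoly_ring_def)

lemma mpoly_ring_cring: "cring (mpoly_ring R V)"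
proof (rule cringI)
  have c: "x m \<in> carrier R" if "x \<in> indexed_pset V (carrier R)" for x m
    using indexed_pset_coeff that by blast
  have sub: "subring (carrier R) R" using carrier_is_subring .
  show "abelian_group (mpoly_ring R V)"
  proof (rule abelian_groupI; unfold mpoly_ring_simps)
    fix x y z
    assume x: "x \<in> indexed_pset V (carrier R)"
    show "indexed_padd (indexed_const \<zero>) x = x"
      using c[OF x] by (auto simp: indexed_padd_def indexed_const_def)
    show "\<exists>y\<in>indexed_pset V (carrier R). indexed_padd y x = indexed_const \<zero>"
    proof (rule bexI)
      show "series_mult R x (indexed_const (\<ominus> \<one>)) \<in> indexed_pset V (carrier R)"
        by (rule series_mult_indexed_pset[OF x _ sub]) (simp add: indexed_pset.indexed_const)
      show "indexed_padd (series_mult R x (indexed_const (\<ominus> \<one>))) x = indexed_const \<zero>"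
        using c[OF x] series_mult_const[of x "\<ominus> \<one>"]
        by (auto simp: indexed_padd_def indexed_const_def r_minus l_neg)
    qed
    assume y: "y \<in> indexed_pset V (carrier R)"
    show "indexed_padd x y \<in> indexed_pset V (carrier R)"
      using x y by (rule indexed_pset.indexed_padd)
    show "indexed_padd x y = indexed_padd y x"
      using c[OF x] c[OF y] by (auto simp: indexed_padd_def a_comm)
    assume z: "z \<in> indexed_pset V (carrier R)"
    show "indexed_padd (indexed_padd x y) z = indexed_padd x (indexed_padd y z)"
      using c[OF x] c[OF y] c[OF z] by (auto simp: indexed_padd_def a_assoc)
  qed (simp add: indexed_pset.indexed_const)
  show "comm_monoid (mpoly_ring R V)"
  proof (rule comm_monoidI; unfold mpoly_ring_simps)
    fix x y z
    assume x: "x \<in> indexed_pset V (carrier R)"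
    show "series_mult R (indexed_const \<one>) x = x"
      using c[OF x] series_mult_comm[of x "indexed_const \<one>"] series_mult_const[of x \<one>]
      by (auto simp: indexed_const_def)
    assume y: "y \<in> indexed_pset V (carrier R)"
    show "series_mult R x y \<in> indexed_pset V (carrier R)"
      using x y sub by (rule series_mult_indexed_pset)
    show "series_mult R x y = series_mult R y x"
      using c[OF x] c[OF y] series_mult_comm[of x y] by auto
    assume z: "z \<in> indexed_pset V (carrier R)"
    show "series_mult R (series_mult R x y) z = series_mult R x (series_mult R y z)"
      using c[OF x] c[OF y] z series_mult_assoc[of x y z] by auto
  qed (simp add: indexed_pset.indexed_const)
  fix x y z
  assume x: "x \<in> carrier (mpoly_ring R V)" and y: "y \<in> carrier (mpoly_ring R V)"
    and z: "z \<in> carrier (mpoly_ring R V)"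
  have c': "x m \<in> carrier R" "y m \<in> carrier R" "z m \<in> carrier R" for m
    using x y z c by (simp_all add: mpoly_ring_simps)
  have xy: "indexed_padd x y m \<in> carrier R" for m using c' by (simp add: indexed_padd_def)
  show "(x \<oplus>\<^bsub>mpoly_ring R V\<^esub> y) \<otimes>\<^bsub>mpoly_ring R V\<^esub> z =
      x \<otimes>\<^bsub>mpoly_ring R V\<^esub> z \<oplus>\<^bsub>mpoly_ring R V\<^esub> y \<otimes>\<^bsub>mpoly_ring R V\<^esub> z"
    unfolding mpoly_ring_simps
    using series_mult_padd[of z x y] series_mult_comm[of z "indexed_padd x y"]
      series_mult_comm[of z x] series_mult_comm[of z y] c' xy by simp
qed

lemma mpoly_eval_mult:
  fixes p q :: "'v multiset \<Rightarrow> 'a"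
  assumes "p \<in> indexed_pset V (carrier R)" "q \<in> indexed_pset V (carrier R)" "a \<in> V \<rightarrow> carrier R"
  shows "mpoly_eval R a (series_mult R p q) = mpoly_eval R a p \<otimes> mpoly_eval R a q"
proof -
  note sub = carrier_is_subring
  note cl = mpoly_eval_closed[OF _ subset_refl assms(3)]
  have cp: "p m \<in> carrier R" for m using indexed_pset_coeff assms(1) by blast
  show ?thesis using assms(2)
  proof induction
    case (indexed_const k)
    have "mpoly_eval R a (\<lambda>m. p m \<otimes> k) = mpoly_eval R a p \<otimes> k"
      using assms(1)
    proof induction
      case (indexed_const l)
      have "(\<lambda>m :: 'v multiset. indexed_const l m \<otimes> k) = indexed_const (l \<otimes> k)"
        using \<open>k \<in> carrier R\<close> by (auto simp: indexed_const_def)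
      then show ?case using indexed_const \<open>k \<in> carrier R\<close> by simp
    next
      case (indexed_padd P Q)
      have c: "P m \<in> carrier R" "Q m \<in> carrier R" for m
        using indexed_padd.hyps indexed_pset_coeff by blast+
      have s: "(\<lambda>m. P m \<otimes> k) \<in> indexed_pset V (carrier R)"
        "(\<lambda>m. Q m \<otimes> k) \<in> indexed_pset V (carrier R)"
        using series_mult_indexed_pset[OF indexed_padd.hyps(1) _ sub, of "indexed_const k"]
          series_mult_indexed_pset[OF indexed_padd.hyps(2) _ sub, of "indexed_const k"]
          \<open>k \<in> carrier R\<close> c by (simp_all add: series_mult_const indexed_pset.indexed_const)
      have "(\<lambda>m. indexed_padd P Q m \<otimes> k) = indexed_padd (\<lambda>m. P m \<otimes> k) (\<lambda>m. Q m \<otimes> k)"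
        using \<open>k \<in> carrier R\<close> c by (auto simp: indexed_padd_def l_distr)
      then show ?case
        using indexed_padd cl \<open>k \<in> carrier R\<close>
          mpoly_eval_padd[OF indexed_padd.hyps subset_refl assms(3)]
          mpoly_eval_padd[OF s subset_refl assms(3)]
        by (simp add: l_distr)
    next
      case (indexed_pmult P i)
      have c: "P m \<in> carrier R" for m
        using indexed_pmult.hyps indexed_pset_coeff by blast
      have s: "(\<lambda>m. P m \<otimes> k) \<in> indexed_pset V (carrier R)"
        using series_mult_indexed_pset[OF indexed_pmult.hyps(1) _ sub, of "indexed_const k"]
          \<open>k \<in> carrier R\<close> c by (simp_all add: series_mult_const indexed_pset.indexed_const)
      have "(\<lambda>m. indexed_pmult P i m \<otimes> k) = indexed_pmult (\<lambda>m. P m \<otimes> k) i"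
        using \<open>k \<in> carrier R\<close> by (auto simp: indexed_pmult_def)
      moreover have "a i \<in> carrier R" using indexed_pmult assms(3) by auto
      ultimately show ?case
        using indexed_pmult cl \<open>k \<in> carrier R\<close>
          mpoly_eval_pmult[OF indexed_pmult.hyps(1) subset_refl assms(3)]
          mpoly_eval_pmult[OF s subset_refl assms(3)]
        by (simp add: m_ac)
    qed
    then show ?case using indexed_const cp by (simp add: series_mult_const)
  next
    case (indexed_padd P Q)
    have c: "P m \<in> carrier R" "Q m \<in> carrier R" for m
      using indexed_padd.hyps indexed_pset_coeff by blast+
    have s: "series_mult R p P \<in> indexed_pset V (carrier R)"
      "series_mult R p Q \<in> indexed_pset V (carrier R)"
      using series_mult_indexed_pset[OF assms(1) _ sub] indexed_padd.hyps by blast+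
    show ?case
      using indexed_padd c cp cl assms(1) s
          mpoly_eval_padd[OF indexed_padd.hyps subset_refl assms(3)]
          mpoly_eval_padd[OF s subset_refl assms(3)]
      by (simp add: series_mult_padd r_distr)
  next
    case (indexed_pmult P i)
    have c: "P m \<in> carrier R" for m
      using indexed_pmult.hyps indexed_pset_coeff by blast+
    have s: "series_mult R p P \<in> indexed_pset V (carrier R)"
      using series_mult_indexed_pset[OF assms(1) _ sub] indexed_pmult.hyps by blast
    moreover have "a i \<in> carrier R" using indexed_pmult assms(3) by auto
    ultimately show ?case
      using indexed_pmult c cp cl assms(1)
          mpoly_eval_pmult[OF indexed_pmult.hyps(1) subset_refl assms(3)]
          mpoly_eval_pmult[OF s subset_refl assms(3)]
      by (simp add: series_mult_pmult m_assoc)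
  qed
qed

section \<open>Formal partial derivatives\<close>

lemma formal_deriv_const: "formal_deriv R j (indexed_const k) = indexed_const \<zero>"
  by (auto simp: formal_deriv_def indexed_const_def add.nat_pow_one)

lemma formal_deriv_padd:
  assumes "\<And>m. p m \<in> carrier R" "\<And>m. q m \<in> carrier R"
  shows "formal_deriv R j (indexed_padd p q) =
    indexed_padd (formal_deriv R j p) (formal_deriv R j q)"
  using assms by (auto simp: formal_deriv_def indexed_padd_def add.nat_pow_distrib a_ac)

text \<open>The product rule with a variable as one factor. For \<open>i = j\<close> the integer
  factor at a monomial containing \<open>i\<close> is one larger than the factor after removing a
  copy of \<open>i\<close>; the surplus is the summand \<open>p\<close>.\<close>

lemma formal_deriv_pmult:
  assumes "\<And>m. p m \<in> carrier R"
  shows "formal_deriv R j (indexed_pmult p i) =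
    indexed_padd (indexed_pmult (formal_deriv R j p) i)
      (if i = j then p else indexed_const \<zero>)"
proof
  fix m
  show "formal_deriv R j (indexed_pmult p i) m = indexed_padd (indexed_pmult (formal_deriv R j p) i)
      (if i = j then p else indexed_const \<zero>) m"
  proof (cases "i \<in># m")
    case False
    then have "count m i = 0" by (simp add: not_in_iff)
    with False show ?thesis
      using assms by (auto simp: formal_deriv_def indexed_pmult_def indexed_padd_def indexed_const_def)
  next
    case True
    then obtain m' where m: "m = add_mset i m'" by (metis insert_DiffM)
    show ?thesis
      using assms
      by (auto simp: m formal_deriv_def indexed_pmult_def indexed_padd_def indexed_const_def
          add_mset_commute)
  qed
qed

lemma formal_deriv_indexed_pset:
  assumes "p \<in> indexed_pset V (carrier R)"
  shows "formal_deriv R j p \<in> indexed_pset V (carrier R)"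
  using assms
proof induction
  case (indexed_const k)
  then show ?case by (simp add: formal_deriv_const indexed_pset.indexed_const)
next
  case (indexed_padd P Q)
  have c: "P m \<in> carrier R" "Q m \<in> carrier R" for m
    using indexed_padd.hyps indexed_pset_coeff by blast+
  then show ?case using indexed_padd by (simp add: formal_deriv_padd indexed_pset.indexed_padd)
next
  case (indexed_pmult P i)
  have c: "P m \<in> carrier R" for m
    using indexed_pmult.hyps indexed_pset_coeff by blast
  then show ?case using indexed_pmult
    by (auto simp: formal_deriv_pmult intro!: indexed_pset.intros)
qed

end

section \<open>Polynomials under a homomorphism of the coefficients\<close>

context ring_hom_cring
begin

lemma map_indexed_const: "h \<circ> R.indexed_const k = S.indexed_const (h k)"
  by (auto simp: R.indexed_const_def S.indexed_const_def)

lemma map_indexed_padd: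
  assumes "\<And>m. p m \<in> carrier R" "\<And>m. q m \<in> carrier R"
  shows "h \<circ> R.indexed_padd p q = S.indexed_padd (h \<circ> p) (h \<circ> q)"
  using assms by (auto simp: R.indexed_padd_def S.indexed_padd_def)

lemma map_indexed_pmult: "h \<circ> R.indexed_pmult p i = S.indexed_pmult (h \<circ> p) i"
  by (auto simp: R.indexed_pmult_def S.indexed_pmult_def)

lemma map_indexed_pset:
  assumes "p \<in> R.indexed_pset V F" "F \<subseteq> carrier R"
  shows "h \<circ> p \<in> S.indexed_pset V (h ` F)"
  using assms(1)
proof induction
  case (indexed_const k)
  then show ?case by (simp add: map_indexed_const S.indexed_pset.indexed_const)
next
  case (indexed_padd P Q)
  have c: "P m \<in> carrier R" "Q m \<in> carrier R" for m
    using R.indexed_pset_coeff indexed_padd.hyps assms(2) by blast+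
  from indexed_padd.IH show ?case
    unfolding map_indexed_padd[of P Q, OF c] by (intro S.indexed_pset.indexed_padd)
next
  case (indexed_pmult P i)
  then show ?case unfolding map_indexed_pmult by (intro S.indexed_pset.indexed_pmult)
qed

lemma map_indexed_pset_carrier:
  assumes "p \<in> R.indexed_pset V (carrier R)"
  shows "h \<circ> p \<in> S.indexed_pset V (carrier S)"
proof -
  have "h ` carrier R \<subseteq> carrier S" by auto
  from S.indexed_pset_mono[OF this subset_refl] map_indexed_pset[OF assms subset_refl]
  show ?thesis by blast
qed

text \<open>Serves to read polynomials over the image of a member of the directed system as
  polynomials over that member.\<close>

lemma indexed_pset_image_obtain:
  assumes "q \<in> S.indexed_pset V (h ` F)" "F \<subseteq> carrier R"
  obtains p where "p \<in> R.indexed_pset V F" "q = h \<circ> p"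
proof -
  from assms(1) have "\<exists>p\<in>R.indexed_pset V F. q = h \<circ> p"
  proof induction
    case (indexed_const k)
    then obtain l where "l \<in> F" "k = h l" by blast
    then show ?case
      by (intro bexI[of _ "R.indexed_const l"])
        (simp_all add: map_indexed_const R.indexed_pset.indexed_const)
  next
    case (indexed_padd P Q)
    then obtain p q where p: "p \<in> R.indexed_pset V F" "q \<in> R.indexed_pset V F"
      "P = h \<circ> p" "Q = h \<circ> q" by blast
    then show ?case
      using R.indexed_pset_coeff[OF p(1) assms(2)] R.indexed_pset_coeff[OF p(2) assms(2)]
      by (intro bexI[of _ "R.indexed_padd p q"])
        (simp_all add: map_indexed_padd R.indexed_pset.indexed_padd)
  next
    case (indexed_pmult P i)
    then obtain p where p: "p \<in> R.indexed_pset V F" "P = h \<circ> p" by blast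
    then show ?case using indexed_pmult
      by (intro bexI[of _ "R.indexed_pmult p i"])
        (simp_all add: map_indexed_pmult R.indexed_pset.indexed_pmult)
  qed
  with that show thesis by blast
qed

lemma mpoly_eval_map:
  assumes "p \<in> R.indexed_pset V F" "F \<subseteq> carrier R" "a \<in> V \<rightarrow> carrier R"
    and "\<And>v. v \<in> V \<Longrightarrow> b v = h (a v)"
  shows "mpoly_eval S b (h \<circ> p) = h (mpoly_eval R a p)"
proof -
  have F: "h ` F \<subseteq> carrier S" using assms(2) by auto
  have b: "b \<in> V \<rightarrow> carrier S" using assms(3,4) by (auto simp: Pi_iff)
  show ?thesis using assms(1)
  proof induction
    case (indexed_const k)
    then have "k \<in> carrier R" using assms(2) by auto
    then show ?case by (simp add: map_indexed_const)
  next
    case (indexed_padd P Q)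
    show ?case
      using indexed_padd R.indexed_pset_coeff[OF indexed_padd.hyps(1) assms(2)]
        R.indexed_pset_coeff[OF indexed_padd.hyps(2) assms(2)]
        R.mpoly_eval_padd[OF indexed_padd.hyps assms(2,3)]
        R.mpoly_eval_closed[OF indexed_padd.hyps(1) assms(2,3)]
        R.mpoly_eval_closed[OF indexed_padd.hyps(2) assms(2,3)]
        S.mpoly_eval_padd[OF map_indexed_pset[OF indexed_padd.hyps(1) assms(2)]
          map_indexed_pset[OF indexed_padd.hyps(2) assms(2)] F b]
      by (simp only: map_indexed_padd hom_add)
  next
    case (indexed_pmult P i)
    have "a i \<in> carrier R" using indexed_pmult assms(3) by auto
    then show ?case
      using indexed_pmult assms(4)[of i]
        R.mpoly_eval_pmult[OF indexed_pmult.hyps(1) assms(2,3) indexed_pmult.hyps(2)]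
        R.mpoly_eval_closed[OF indexed_pmult.hyps(1) assms(2,3)]
        S.mpoly_eval_pmult[OF map_indexed_pset[OF indexed_pmult.hyps(1) assms(2)] F b
          indexed_pmult.hyps(2)]
      by (simp only: map_indexed_pmult hom_mult)
  qed
qed

lemma map_series_mult:
  assumes "\<And>m. p m \<in> carrier R" "\<And>m. q m \<in> carrier R"
  shows "h \<circ> series_mult R p q = series_mult S (h \<circ> p) (h \<circ> q)"
proof
  fix m
  have "h (\<Oplus>\<^bsub>R\<^esub>k\<in>{k. k \<subseteq># m}. p k \<otimes>\<^bsub>R\<^esub> q (m - k)) =
      (\<Oplus>\<^bsub>S\<^esub>k\<in>{k. k \<subseteq># m}. h (p k \<otimes>\<^bsub>R\<^esub> q (m - k)))"
    using assms by (subst hom_finsum) (auto simp: comp_def)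
  also have "\<dots> = (\<Oplus>\<^bsub>S\<^esub>k\<in>{k. k \<subseteq># m}. h (p k) \<otimes>\<^bsub>S\<^esub> h (q (m - k)))"
    using assms by (intro S.add.finprod_cong') auto
  finally show "(h \<circ> series_mult R p q) m = series_mult S (h \<circ> p) (h \<circ> q) m"
    by (simp add: series_mult_def)
qed

lemma map_mpoly_ring_hom: "(\<circ>) h \<in> ring_hom (mpoly_ring R V) (mpoly_ring S V)"
proof (rule ring_hom_memI)
  fix p q
  assume "p \<in> carrier (mpoly_ring R V)" "q \<in> carrier (mpoly_ring R V)"
  then have p: "p \<in> R.indexed_pset V (carrier R)" "q \<in> R.indexed_pset V (carrier R)"
    by (simp_all add: R.mpoly_ring_simps)
  have c: "p m \<in> carrier R" "q m \<in> carrier R" for m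
    using p R.indexed_pset_coeff by blast+
  show "h \<circ> p \<in> carrier (mpoly_ring S V)"
    using map_indexed_pset_carrier[OF p(1)] by (simp add: S.mpoly_ring_simps)
  show "h \<circ> (p \<otimes>\<^bsub>mpoly_ring R V\<^esub> q) = (h \<circ> p) \<otimes>\<^bsub>mpoly_ring S V\<^esub> (h \<circ> q)"
    using map_series_mult[of p q] c by (simp add: R.mpoly_ring_simps S.mpoly_ring_simps)
  show "h \<circ> (p \<oplus>\<^bsub>mpoly_ring R V\<^esub> q) = (h \<circ> p) \<oplus>\<^bsub>mpoly_ring S V\<^esub> (h \<circ> q)"
    using map_indexed_padd[of p q] c by (simp add: R.mpoly_ring_simps S.mpoly_ring_simps)
next
  show "h \<circ> \<one>\<^bsub>mpoly_ring R V\<^esub> = \<one>\<^bsub>mpoly_ring S V\<^esub>"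
    by (simp add: R.mpoly_ring_simps S.mpoly_ring_simps map_indexed_const)
qed

lemma hom_add_pow_nat:
  assumes "x \<in> carrier R"
  shows "h (add_pow R (n::nat) x) = add_pow S n (h x)"
  using assms by (induction n) auto

lemma map_formal_deriv:
  assumes "\<And>m. p m \<in> carrier R"
  shows "h \<circ> formal_deriv R j p = formal_deriv S j (h \<circ> p)"
  unfolding formal_deriv_def using assms by (auto simp: hom_add_pow_nat simp del: add_pow_def)

end

section \<open>Dickson's lemma and Hilbert's basis theorem\<close>

text \<open>Induction on the number of variables. With \<open>v\<close> projected away, a finite
  basis of the projections takes care of all monomials with a large exponent of \<open>v\<close>,
  and each of the finitely many small exponents receives a basis of its own.\<close>

lemma dickson:
  assumes "finite V" "\<And>m. m \<in> M \<Longrightarrow> set_mset m \<subseteq> V"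
  shows "\<exists>B\<subseteq>M. finite B \<and> (\<forall>m\<in>M. \<exists>b\<in>B. b \<subseteq># m)"
  using assms
proof (induction V arbitrary: M)
  case empty
  then have "M \<subseteq> {{#}}" by auto
  then show ?case by (intro exI[of _ M]) (auto intro: finite_subset)
next
  case (insert v W)
  define pr where "pr m = filter_mset (\<lambda>x. x \<noteq> v) m" for m
  have basis: "\<exists>C\<subseteq>Y. finite C \<and> (\<forall>m\<in>Y. \<exists>c\<in>C. pr c \<subseteq># pr m)" if "Y \<subseteq> M" for Y
  proof -
    have "set_mset m \<subseteq> W" if "m \<in> pr ` Y" for m
      using that insert.prems \<open>Y \<subseteq> M\<close> by (fastforce simp: pr_def)
    then obtain B where B: "B \<subseteq> pr ` Y" "finite B" "\<forall>m\<in>pr ` Y. \<exists>b\<in>B. b \<subseteq># m"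
      using insert.IH[of "pr ` Y"] by blast
    then obtain C where "C \<subseteq> Y" "finite C" "B = pr ` C" using finite_subset_image by metis
    with B show ?thesis by (intro exI[of _ C]) auto
  qed
  have le: "c \<subseteq># m" if "pr c \<subseteq># pr m" "count c v \<le> count m v" for c m
    unfolding subseteq_mset_def
  proof
    fix x
    show "count c x \<le> count m x"
      using that mset_subset_eq_count[OF that(1), of x] by (cases "x = v") (auto simp: pr_def)
  qed
  obtain C0 where C0: "C0 \<subseteq> M" "finite C0" "\<forall>m\<in>M. \<exists>c\<in>C0. pr c \<subseteq># pr m"
    using basis[of M] by blast
  \<comment> \<open>A crude bound for the exponents of \<open>v\<close> in \<open>C0\<close>: if
    \<open>v\<close> has exponent at least \<open>N\<close> in \<open>m\<close>, divisibility of the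
    projections already gives divisibility by a member of \<open>C0\<close>.\<close>
  define N where "N = (\<Sum>c\<in>C0. count c v)"
  have N: "count c v \<le> N" if "c \<in> C0" for c
    unfolding N_def using C0(2) that by (intro member_le_sum) auto
  have "\<forall>k. \<exists>C\<subseteq>{m\<in>M. count m v = k}. finite C \<and>
      (\<forall>m\<in>{m\<in>M. count m v = k}. \<exists>c\<in>C. pr c \<subseteq># pr m)"
    by (intro allI basis) auto
  from choice[OF this] obtain C where C': "\<forall>k. C k \<subseteq> {m\<in>M. count m v = k} \<and> finite (C k) \<and>
      (\<forall>m\<in>{m\<in>M. count m v = k}. \<exists>c\<in>C k. pr c \<subseteq># pr m)" ..
  then have C: "C k \<subseteq> {m\<in>M. count m v = k}" "finite (C k)"
      "m \<in> M \<Longrightarrow> count m v = k \<Longrightarrow> \<exists>c\<in>C k. pr c \<subseteq># pr m" for k m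
    by auto
  show ?case
  proof (intro exI[of _ "C0 \<union> (\<Union>k<N. C k)"] conjI ballI)
    show "C0 \<union> (\<Union>k<N. C k) \<subseteq> M" using C0(1) C(1) by blast
    show "finite (C0 \<union> (\<Union>k<N. C k))" using C0(2) C(2) by simp
    fix m assume m: "m \<in> M"
    show "\<exists>b\<in>C0 \<union> (\<Union>k<N. C k). b \<subseteq># m"
    proof (cases "N \<le> count m v")
      case True
      obtain c where "c \<in> C0" "pr c \<subseteq># pr m" using C0(3) m by auto
      moreover have "count c v \<le> count m v" using N[OF \<open>c \<in> C0\<close>] True by simp
      ultimately show ?thesis using le by blast
    next
      case False
      obtain c where c: "c \<in> C (count m v)" "pr c \<subseteq># pr m" using C(3) m by blast
      then have "count c v = count m v" using C(1) by blast
      with c False show ?thesis using le[of c m] by force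
    qed
  qed
qed

text \<open>Ideals of the polynomials over a subset \<open>F\<close> of the ambient ring, so that
  \<open>F\<close> needs no ring structure of its own. Closure under constants and single variables,
  instead of arbitrary multipliers, fits the induction rule of \<open>indexed_pset\<close>.\<close>

definition (in ring) poly_ideal :: "'v set \<Rightarrow> 'a set \<Rightarrow> ('v multiset \<Rightarrow> 'a) set \<Rightarrow> bool"
  where "poly_ideal V F J \<longleftrightarrow> J \<subseteq> indexed_pset V F \<and> indexed_const \<zero> \<in> J \<and>
    (\<forall>p\<in>J. \<forall>q\<in>J. indexed_padd p q \<in> J) \<and> (\<forall>c\<in>F. \<forall>p\<in>J. (\<lambda>m. c \<otimes> p m) \<in> J) \<and>
    (\<forall>p\<in>J. \<forall>i\<in>V. indexed_pmult p i \<in> J)"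

lemma (in ring) poly_idealD:
  assumes "poly_ideal V F J"
  shows "J \<subseteq> indexed_pset V F" "indexed_const \<zero> \<in> J"
    "\<And>p q. p \<in> J \<Longrightarrow> q \<in> J \<Longrightarrow> indexed_padd p q \<in> J"
    "\<And>c p. c \<in> F \<Longrightarrow> p \<in> J \<Longrightarrow> (\<lambda>m. c \<otimes> p m) \<in> J"
    "\<And>p i. p \<in> J \<Longrightarrow> i \<in> V \<Longrightarrow> indexed_pmult p i \<in> J"
  using assms unfolding poly_ideal_def by blast+

text \<open>The monomials are compared in the multiset order, which is a monomial well-order.\<close>

theorem (in field) hilbert_basis:
  fixes V :: "nat set"
  assumes F: "subfield F R" and V: "finite V" and J: "poly_ideal V F J"
  obtains G where "finite G" "G \<subseteq> J" "\<And>J'. poly_ideal V F J' \<Longrightarrow> G \<subseteq> J' \<Longrightarrow> J \<subseteq> J'"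
proof -
  note FR = subfieldE(3)[OF F]
  note JD = poly_idealD[OF J]
  define supp where "supp p = {m. p m \<noteq> \<zero>}" for p :: "nat multiset \<Rightarrow> 'a"
  \<comment> \<open>The leading monomial. The multiset order is linear because the variables are
    natural numbers.\<close>
  define lm where "lm p = Max (supp p)" for p
  have fin: "finite (supp p)" if "p \<in> J" for p
    using indexed_pset_finite_support JD(1) that unfolding supp_def by blast
  have lm: "p (lm p) \<noteq> \<zero>" "\<And>m. p m \<noteq> \<zero> \<Longrightarrow> m \<le> lm p" if "p \<in> J" "supp p \<noteq> {}" for p
    using Max_in[OF fin[OF that(1)] that(2)] Max_ge[OF fin[OF that(1)]]
    unfolding lm_def by (auto simp: supp_def)
  have coeff: "p m \<in> F" if "p \<in> J" for p m
  proof -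
    have "p \<in> indexed_pset V F" using that JD(1) by blast
    then show ?thesis
    proof (induction arbitrary: m)
      case (indexed_const k)
      then show ?case using subringE(2)[OF subfieldE(1)[OF F]] by (auto simp: indexed_const_def)
    next
      case (indexed_padd P Q)
      then show ?case using subringE(7)[OF subfieldE(1)[OF F]] by (auto simp: indexed_padd_def)
    next
      case (indexed_pmult P i)
      then show ?case using subringE(2)[OF subfieldE(1)[OF F]] by (auto simp: indexed_pmult_def)
    qed
  qed
  define J0 where "J0 = {p\<in>J. supp p \<noteq> {}}"
  have "set_mset m \<subseteq> V" if "m \<in> lm ` J0" for m
  proof -
    from that obtain p where "p \<in> J" "supp p \<noteq> {}" "m = lm p" by (auto simp: J0_def)
    then show ?thesis using indexed_pset_vars JD(1) lm(1) by blast
  qed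
  then obtain B where B: "B \<subseteq> lm ` J0" "finite B" "\<forall>m\<in>lm ` J0. \<exists>b\<in>B. b \<subseteq># m"
    using dickson[OF V, of "lm ` J0"] by blast
  \<comment> \<open>\<open>G\<close> is a Groebner basis: every leading monomial of \<open>J\<close>
    is divisible by the leading monomial of an element of \<open>G\<close>.\<close>
  obtain G where G: "G \<subseteq> J0" "finite G" "B = lm ` G"
    using finite_subset_image[OF B(2,1)] by blast
  show thesis
  proof (rule that[of G])
    show "finite G" by fact
    show "G \<subseteq> J" using G by (auto simp: J0_def)
    fix J' assume J': "poly_ideal V F J'" and GJ': "G \<subseteq> J'"
    note JD' = poly_idealD[OF J']
    \<comment> \<open>Division by \<open>G\<close>: a multiple of some \<open>g\<close> cancels the
      leading term of \<open>p\<close>, and the remainder has a smaller leading monomial.\<close>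
    have "p \<in> J'" if "p \<in> J" for p
      using that
    proof (induction "lm p" arbitrary: p rule: less_induct)
      case less
      have p: "p m \<in> carrier R" for m using coeff less.prems FR by blast
      show ?case
      proof (cases "supp p = {}")
        case True
        then have "p = indexed_const \<zero>" by (auto simp: supp_def indexed_const_def)
        then show ?thesis using JD' by simp
      next
        case False
        then have "lm p \<in> lm ` J0" using less.prems by (auto simp: J0_def)
        then obtain g where g: "g \<in> G" "lm g \<subseteq># lm p" using B(3) G(3) by blast
        then have gJ: "g \<in> J" "supp g \<noteq> {}" "g \<in> J'" using G(1) GJ' by (auto simp: J0_def)
        obtain t where t: "lm p = lm g + t" using g(2) by (auto simp: mset_subset_eq_exists_conv)
        have tV: "set_mset t \<subseteq> V"
          using indexed_pset_vars[of p V F "lm p"] JD(1) less.prems lm(1)[OF less.prems False] t by auto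
        \<comment> \<open>The product of \<open>g\<close> with the monomial \<open>t\<close>, built
          one variable at a time and followed through both ideals.\<close>
        have "\<exists>q\<in>J \<inter> J'. \<forall>m. q m = (if t \<subseteq># m then g (m - t) else \<zero>)"
          using tV
        proof (induction t)
          case empty
          then show ?case using gJ by (intro bexI[of _ g]) auto
        next
          case (add i t)
          then obtain q where q: "q \<in> J \<inter> J'" "\<And>m. q m = (if t \<subseteq># m then g (m - t) else \<zero>)"
            by auto
          show ?case
          proof (intro bexI[of _ "indexed_pmult q i"] allI)
            show "indexed_pmult q i \<in> J \<inter> J'" using JD(5) JD'(5) q(1) add.prems by auto
            show "indexed_pmult q i m =
                (if add_mset i t \<subseteq># m then g (m - add_mset i t) else \<zero>)" for m
              by (simp add: indexed_pmult_def q(2) insert_subset_eq_iff)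
          qed
        qed
        then obtain q where q: "q \<in> J" "q \<in> J'" "\<And>m. q m = (if t \<subseteq># m then g (m - t) else \<zero>)"
          by auto
        have qc: "q m \<in> carrier R" for m using coeff q(1) FR by blast
        have qp: "q (lm p) = g (lm g)" by (simp add: q(3) t)
        have q_le: "m \<le> lm p" if "q m \<noteq> \<zero>" for m
        proof -
          have "t \<subseteq># m" "g (m - t) \<noteq> \<zero>" using that by (auto simp: q(3) split: if_splits)
          then have "m - t \<le> lm g" using lm(2)[OF gJ(1,2)] by blast
          \<comment> \<open>Here the order must be compatible with multiplication of
            monomials.\<close>
          then have "m - t + t \<le> lm g + t" by (rule add_right_mono)
          with \<open>t \<subseteq># m\<close> show ?thesis by (simp add: t)
        qed
        have u: "g (lm g) \<in> F" "g (lm g) \<noteq> \<zero>" using coeff gJ lm(1)[OF gJ(1,2)] by blast+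
        define c where "c = p (lm p) \<otimes> inv (g (lm g))"
        have inv: "inv (g (lm g)) \<in> F" using subfield_m_inv(1)[OF F] u by auto
        have uR: "g (lm g) \<in> carrier R" and inv': "inv (g (lm g)) \<in> carrier R"
          using u inv FR by blast+
        have c: "c \<in> F" unfolding c_def
          using subringE(6)[OF subfieldE(1)[OF F]] coeff less.prems inv by blast
        have cR: "c \<in> carrier R" using c FR by blast
        have mc: "\<ominus> c \<in> F" using subringE(5)[OF subfieldE(1)[OF F]] c by blast
        define r where "r = indexed_padd p (\<lambda>m. \<ominus> c \<otimes> q m)"
        have r: "r \<in> J" unfolding r_def using JD(3,4) less.prems q(1) mc by blast
        have cg: "c \<otimes> g (lm g) = p (lm p)"
          unfolding c_def using p[of "lm p"] uR inv' m_assoc[of "p (lm p)" "inv (g (lm g))" "g (lm g)"]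
            subfield_m_inv(3)[OF F, of "g (lm g)"] u by simp
        have r_lm: "r (lm p) = \<zero>"
          unfolding r_def indexed_padd_def qp using cg cR uR p[of "lm p"] by (simp add: l_minus r_neg)
        have r_le: "m \<le> lm p" if "r m \<noteq> \<zero>" for m
        proof (rule ccontr)
          assume "\<not> m \<le> lm p"
          then have "p m = \<zero>" "q m = \<zero>" using lm(2)[OF less.prems False] q_le by blast+
          then have "r m = \<zero>" using cR by (simp add: r_def indexed_padd_def)
          with that show False by simp
        qed
        have "r \<in> J'"
        proof (cases "supp r = {}")
          case True
          then have "r = indexed_const \<zero>" by (auto simp: supp_def indexed_const_def)
          then show ?thesis using JD' by simp
        next
          case False
          have "lm r \<le> lm p" "lm r \<noteq> lm p" using lm(1)[OF r False] r_le r_lm by auto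
          then show ?thesis using less.hyps[of r] r by simp
        qed
        then have "indexed_padd r (\<lambda>m. c \<otimes> q m) \<in> J'" using JD'(3,4) c q(2) by blast
        moreover have "indexed_padd r (\<lambda>m. c \<otimes> q m) = p"
          using p qc cR by (auto simp: r_def indexed_padd_def l_minus a_assoc l_neg)
        ultimately show ?thesis by simp
      qed
    qed
    then show "J \<subseteq> J'" by blast
  qed
qed

section \<open>Retractions onto existentially closed subfields\<close>

lemma (in cring) mpoly_eval_smult:
  assumes "subring F R" "a \<in> V \<rightarrow> carrier R" "c \<in> F" "p \<in> indexed_pset V F"
  shows "(\<lambda>m. c \<otimes> p m) \<in> indexed_pset V F"
    and "mpoly_eval R a (\<lambda>m. c \<otimes> p m) = c \<otimes> mpoly_eval R a p"
proof -
  note FR = subringE(1)[OF assms(1)]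
  have cp: "p m \<in> carrier R" for m using indexed_pset_coeff assms(4) FR by blast
  have c: "c \<in> carrier R" using assms(3) FR by blast
  have e: "(\<lambda>m. c \<otimes> p m) = series_mult R p (indexed_const c)"
    using series_mult_const[of p c] cp c by (auto simp: m_comm)
  have "p \<in> indexed_pset V (carrier R)" using assms(4) indexed_pset_mono[OF FR subset_refl] by blast
  moreover have "indexed_const c \<in> indexed_pset V (carrier R)"
    using c by (rule indexed_pset.indexed_const)
  ultimately show "(\<lambda>m. c \<otimes> p m) \<in> indexed_pset V F"
    "mpoly_eval R a (\<lambda>m. c \<otimes> p m) = c \<otimes> mpoly_eval R a p"
    unfolding e
    using series_mult_indexed_pset[OF assms(4) indexed_pset.indexed_const[OF assms(3)] assms(1)]
      mpoly_eval_mult[OF _ _ assms(2)] c mpoly_eval_closed[OF assms(4) FR assms(2)]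
    by (auto simp: m_comm)
qed

lemma (in cring) eval_kernel_poly_ideal:
  assumes "subring F R" "a \<in> V \<rightarrow> carrier R"
  shows "poly_ideal V F {p \<in> indexed_pset V F. mpoly_eval R a p = \<zero>}"
proof -
  note FR = subringE(1)[OF assms(1)]
  have "indexed_const \<zero> \<in> indexed_pset V F"
    using subringE(2)[OF assms(1)] by (rule indexed_pset.indexed_const)
  moreover have "c \<otimes> \<zero> = \<zero>" if "c \<in> F" for c using that FR by auto
  moreover have "a i \<in> carrier R" if "i \<in> V" for i using that assms(2) by auto
  ultimately show ?thesis
    unfolding poly_ideal_def
    using mpoly_eval_smult[OF assms] mpoly_eval_padd[OF _ _ FR assms(2)] mpoly_eval_pmult[OF _ FR assms(2)]
    by (auto intro: indexed_pset.intros)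
qed

text \<open>For subrings \<open>F\<close> of \<open>A\<close>, an \<open>F\<close>-algebra
  homomorphism from \<open>A\<close> to \<open>F\<close>. It is spelled out on elements because both
  are mere subsets of the ambient ring; being the identity on \<open>F\<close>, it preserves zero
  and one.\<close>

definition (in ring) retraction :: "'a set \<Rightarrow> 'a set \<Rightarrow> ('a \<Rightarrow> 'a) \<Rightarrow> bool"
  where "retraction A F \<psi> \<longleftrightarrow> (\<forall>x\<in>A. \<psi> x \<in> F) \<and> (\<forall>x\<in>F. \<psi> x = x) \<and>
    (\<forall>x\<in>A. \<forall>y\<in>A. \<psi> (x \<oplus> y) = \<psi> x \<oplus> \<psi> y \<and> \<psi> (x \<otimes> y) = \<psi> x \<otimes> \<psi> y)"

text \<open>The ideal of relations of \<open>Y\<close> over \<open>F\<close> has finitely many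
  generators, so existential closedness provides a point of \<open>F\<close> that satisfies all
  relations. Sending \<open>Y\<close> to that point is therefore well defined.\<close>

lemma (in field) ec_retraction:
  assumes ec: "ec_as_field F R" and Y: "finite Y" "Y \<subseteq> carrier R"
  obtains \<rho> where "retraction (generate_ring R (F \<union> Y)) F \<rho>"
proof -
  from ec have F: "subfield F R" by (simp add: ec_as_field_def)
  note Fr = subfieldE(1)[OF F] and FR = subfieldE(3)[OF F]
  obtain xs where xs: "set xs = Y" using finite_list[OF Y(1)] by blast
  define n where "n = length xs"
  define b where "b i = xs ! i" for i
  have b: "b \<in> {..<n} \<rightarrow> carrier R" using xs Y(2) by (auto simp: n_def b_def)
  let ?P = "indexed_pset {..<n} F :: (nat multiset \<Rightarrow> 'a) set"
  let ?J = "{p \<in> ?P. mpoly_eval R b p = \<zero>}"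
  obtain G where G: "finite G" "G \<subseteq> ?J" "\<And>J'. poly_ideal {..<n} F J' \<Longrightarrow> G \<subseteq> J' \<Longrightarrow> ?J \<subseteq> J'"
    using hilbert_basis[OF F _ eval_kernel_poly_ideal[OF Fr b]] by auto
  have "\<exists>c\<in>{..<n} \<rightarrow> F. \<forall>p\<in>G. mpoly_eval R c p = \<zero>"
  proof -
    have "finite G \<and> G \<subseteq> ?P \<and> (\<exists>a\<in>{..<n} \<rightarrow> carrier R. \<forall>p\<in>G. mpoly_eval R a p = \<zero>)"
      using G b by blast
    then show ?thesis using ec unfolding ec_as_field_def by blast
  qed
  then obtain c where c: "c \<in> {..<n} \<rightarrow> F" "\<And>p. p \<in> G \<Longrightarrow> mpoly_eval R c p = \<zero>" by blast
  have cR: "c \<in> {..<n} \<rightarrow> carrier R" using c(1) FR by auto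
  \<comment> \<open>The polynomials vanishing at \<open>c\<close> form an ideal as well. It contains
    the generators \<open>G\<close>, hence every relation of \<open>b\<close>.\<close>
  have J: "mpoly_eval R c p = \<zero>" if "p \<in> ?P" "mpoly_eval R b p = \<zero>" for p
    using G(2) c(2) that G(3)[OF eval_kernel_poly_ideal[OF Fr cR]] by blast
  note clb = mpoly_eval_closed[OF _ FR b] and clc = mpoly_eval_closed[OF _ FR cR]
  have PR: "?P \<subseteq> indexed_pset {..<n} (carrier R)" by (rule indexed_pset_mono[OF FR subset_refl])
  have eq: "mpoly_eval R c p = mpoly_eval R c q"
    if "p \<in> ?P" "q \<in> ?P" "mpoly_eval R b p = mpoly_eval R b q" for p q
  proof -
    have k: "indexed_const (\<ominus> \<one>) \<in> ?P"
      using subringE(3,5)[OF Fr] by (intro indexed_pset.indexed_const) auto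
    let ?d = "indexed_padd p (series_mult R q (indexed_const (\<ominus> \<one>)))"
    have s: "series_mult R q (indexed_const (\<ominus> \<one>)) \<in> ?P"
      by (rule series_mult_indexed_pset[OF that(2) k Fr])
    have ev: "mpoly_eval R a ?d = mpoly_eval R a p \<oplus> \<ominus> (mpoly_eval R a q)"
      if a: "a \<in> {..<n} \<rightarrow> carrier R" for a
      using mpoly_eval_padd[OF \<open>p \<in> ?P\<close> s FR a] mpoly_eval_mult[OF subsetD[OF PR \<open>q \<in> ?P\<close>] subsetD[OF PR k] a]
        mpoly_eval_closed[OF \<open>q \<in> ?P\<close> FR a] by (auto simp: r_minus)
    have "mpoly_eval R b ?d = \<zero>" using ev[OF b] that clb by (simp add: r_neg)
    then have "mpoly_eval R c ?d = \<zero>" using J indexed_pset.indexed_padd[OF that(1) s] by blast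
    then have "mpoly_eval R c p \<ominus> mpoly_eval R c q = \<zero>"
      using ev[OF cR] by (simp add: a_minus_def)
    then show ?thesis using clc that by (simp add: r_right_minus_eq)
  qed
  \<comment> \<open>A value of a polynomial at \<open>b\<close> is sent to the value of the same
    polynomial at \<open>c\<close>; by \<open>eq\<close> the choice of the polynomial does not
    matter.\<close>
  define \<rho> where "\<rho> x = mpoly_eval R c (SOME p. p \<in> ?P \<and> mpoly_eval R b p = x)" for x
  have \<rho>: "\<rho> (mpoly_eval R b p) = mpoly_eval R c p" if "p \<in> ?P" for p
  proof -
    have "\<exists>q. q \<in> ?P \<and> mpoly_eval R b q = mpoly_eval R b p" using that by blast
    from someI_ex[OF this] show ?thesis unfolding \<rho>_def by (intro eq that) auto
  qed
  have gen: "\<exists>p\<in>?P. x = mpoly_eval R b p" if "x \<in> generate_ring R (F \<union> Y)" for x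
    using that
  proof induction
    case one
    then show ?case using subringE(3)[OF Fr]
      by (intro bexI[of _ "indexed_const \<one>"]) (auto intro: indexed_pset.indexed_const)
  next
    case (incl h)
    show ?case
    proof (cases "h \<in> F")
      case True
      then show ?thesis using FR
        by (intro bexI[of _ "indexed_const h"]) (auto intro: indexed_pset.indexed_const)
    next
      case False
      with incl xs obtain i where i: "i < n" "h = b i" by (auto simp: in_set_conv_nth n_def b_def)
      have o: "indexed_const \<one> \<in> ?P"
        using subringE(3)[OF Fr] by (rule indexed_pset.indexed_const)
      have "b i \<in> carrier R" using b i by auto
      with i o show ?thesis
        using mpoly_eval_pmult[OF o FR b, of i]
        by (intro bexI[of _ "indexed_pmult (indexed_const \<one>) i"]) (auto intro: indexed_pset.indexed_pmult)
    qed
  next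
    case (a_inv h)
    then obtain p where p: "p \<in> ?P" "h = mpoly_eval R b p" by blast
    have k: "indexed_const (\<ominus> \<one>) \<in> ?P"
      using subringE(3,5)[OF Fr] by (intro indexed_pset.indexed_const) auto
    have "mpoly_eval R b (series_mult R p (indexed_const (\<ominus> \<one>))) = \<ominus> h"
      using mpoly_eval_mult[OF _ _ b, of p "indexed_const (\<ominus> \<one>)"] p k PR clb
      by (auto simp: r_minus)
    then show ?case using series_mult_indexed_pset[OF p(1) k Fr] by (intro bexI) auto
  next
    case (eng_add h1 h2)
    then obtain p q where pq: "p \<in> ?P" "h1 = mpoly_eval R b p" "q \<in> ?P" "h2 = mpoly_eval R b q"
      by blast
    show ?case
      by (rule bexI[OF _ indexed_pset.indexed_padd[OF pq(1,3)]])
        (simp add: pq mpoly_eval_padd[OF pq(1,3) FR b])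
  next
    case (eng_mult h1 h2)
    then obtain p q where pq: "p \<in> ?P" "h1 = mpoly_eval R b p" "q \<in> ?P" "h2 = mpoly_eval R b q"
      by blast
    show ?case
      by (rule bexI[OF _ series_mult_indexed_pset[OF pq(1,3) Fr]])
        (simp add: pq(2,4) mpoly_eval_mult[OF subsetD[OF PR pq(1)] subsetD[OF PR pq(3)] b])
  qed
  show thesis
  proof (rule that[of \<rho>], unfold retraction_def, intro conjI ballI)
    show "\<rho> x \<in> F" if "x \<in> generate_ring R (F \<union> Y)" for x
      using gen[OF that] \<rho> mpoly_eval_in_subring[OF _ Fr subset_refl c(1)] by auto
    show "\<rho> x = x" if "x \<in> F" for x
      using \<rho>[of "indexed_const x"] that FR by (auto simp: indexed_pset.indexed_const)
  next
    fix x y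
    assume xy: "x \<in> generate_ring R (F \<union> Y)" "y \<in> generate_ring R (F \<union> Y)"
    obtain p q where pq: "p \<in> ?P" "x = mpoly_eval R b p" "q \<in> ?P" "y = mpoly_eval R b q"
      using gen[OF xy(1)] gen[OF xy(2)] by blast
    show "\<rho> (x \<oplus> y) = \<rho> x \<oplus> \<rho> y"
      using pq \<rho> \<rho>[OF indexed_pset.indexed_padd[OF pq(1,3)]] mpoly_eval_padd[OF pq(1,3) FR b]
        mpoly_eval_padd[OF pq(1,3) FR cR] by simp
    have "p \<in> indexed_pset {..<n} (carrier R)" "q \<in> indexed_pset {..<n} (carrier R)"
      using pq PR by auto
    then show "\<rho> (x \<otimes> y) = \<rho> x \<otimes> \<rho> y"
      using pq \<rho> \<rho>[OF series_mult_indexed_pset[OF pq(1,3) Fr]] mpoly_eval_mult[OF _ _ b, of p q]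
        mpoly_eval_mult[OF _ _ cR, of p q] by simp
  qed
qed

section \<open>Univariate polynomials over subrings\<close>

context cring
begin

text \<open>The value at \<open>x\<close> of a univariate polynomial given by its coefficients from
  the constant term upwards.\<close>

primrec horner :: "'a \<Rightarrow> 'a list \<Rightarrow> 'a"
  where "horner x [] = \<zero>"
  | "horner x (c # cs) = c \<oplus> x \<otimes> horner x cs"

primrec horner_deriv :: "'a \<Rightarrow> 'a list \<Rightarrow> 'a"
  where "horner_deriv x [] = \<zero>"
  | "horner_deriv x (c # cs) = horner x cs \<oplus> x \<otimes> horner_deriv x cs"

text \<open>Multiplies the coefficient of x^i by \<open>k\<close> + i. Applied with
  \<open>k = 1\<close> to the tail of a list, it gives the coefficients of the derivative.\<close>

primrec scale_from :: "nat \<Rightarrow> 'a list \<Rightarrow> 'a list"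
  where "scale_from k [] = []"
  | "scale_from k (c # cs) = add_pow R k c # scale_from (Suc k) cs"

text \<open>For a subring \<open>A\<close> of a field this is algebraicity over the fraction field
  of \<open>A\<close>, with denominators cleared. Zeros at the end of the list are allowed, so the
  length is only a bound for the degree.\<close>

definition algebraic_over :: "'a set \<Rightarrow> 'a \<Rightarrow> bool"
  where "algebraic_over A x \<longleftrightarrow>
    (\<exists>cs. set cs \<subseteq> A \<and> (\<exists>c\<in>set cs. c \<noteq> \<zero>) \<and> horner x cs = \<zero>)"

lemma horner_closed [simp]: "x \<in> carrier R \<Longrightarrow> set cs \<subseteq> carrier R \<Longrightarrow> horner x cs \<in> carrier R"
  by (induction cs) auto

lemma horner_deriv_closed [simp]:
  "x \<in> carrier R \<Longrightarrow> set cs \<subseteq> carrier R \<Longrightarrow> horner_deriv x cs \<in> carrier R"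
  by (induction cs) auto

lemma horner_in_subring:
  assumes "subring A R" "x \<in> A" "set cs \<subseteq> A"
  shows "horner x cs \<in> A" "horner_deriv x cs \<in> A"
proof -
  have *: "horner x cs \<in> A" if "set cs \<subseteq> A" for cs
    using that by (induction cs) (use subringE[OF assms(1)] assms(2) in auto)
  then show "horner x cs \<in> A" using assms(3) .
  show "horner_deriv x cs \<in> A"
    using assms(3) by (induction cs) (use * subringE[OF assms(1)] assms(2) in auto)
qed

lemma length_scale_from [simp]: "length (scale_from k cs) = length cs"
  by (induction cs arbitrary: k) auto

lemma scale_from_in_subring:
  assumes "subring A R" "set cs \<subseteq> A"
  shows "set (scale_from k cs) \<subseteq> A"
proof -
  have *: "add_pow R (k::nat) c \<in> A" if "c \<in> A" for k c
    using that subringE[OF assms(1)] by (induction k) auto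
  show ?thesis using assms(2) by (induction cs arbitrary: k) (use * in auto)
qed

text \<open>The operator \<open>k\<close> + x d/dx multiplies x^i by \<open>k\<close> + i.\<close>

lemma horner_scale_from:
  assumes "x \<in> carrier R" "set cs \<subseteq> carrier R"
  shows "horner x (scale_from k cs) = add_pow R k (horner x cs) \<oplus> x \<otimes> horner_deriv x cs"
  using assms(2)
proof (induction cs arbitrary: k)
  case Nil
  then show ?case using assms(1) by simp
next
  case (Cons c cs)
  have [simp]: "add_pow R k (x \<otimes> horner x cs) = x \<otimes> add_pow R k (horner x cs)"
    using add_pow_rdistr[of x "horner x cs" k] assms(1) Cons.prems by simp
  show ?case
    using assms(1) Cons by (simp add: add.nat_pow_distrib r_distr a_ac)
qed

lemma horner_map_mult:
  assumes "x \<in> carrier R" "q \<in> carrier R" "set cs \<subseteq> carrier R"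
  shows "horner x (map ((\<otimes>) q) cs) = q \<otimes> horner x cs"
  using assms(3) by (induction cs) (use assms in \<open>auto simp: r_distr m_ac\<close>)

lemma horner_all_zero:
  assumes "x \<in> carrier R" "\<forall>c\<in>set cs. c = \<zero>"
  shows "horner x cs = \<zero>"
  using assms(2) by (induction cs) (use assms in auto)

lemma horner_set_subring:
  assumes A: "subring A R" and x: "x \<in> carrier R"
  shows "subring {horner x cs | cs. set cs \<subseteq> A} R" (is "subring ?E R")
proof -
  note AR = subringE(1)[OF A]
  have plus: "\<exists>es. set es \<subseteq> A \<and> horner x es = horner x cs \<oplus> horner x ds"
    if "set cs \<subseteq> A" "set ds \<subseteq> A" for cs ds
    using that
  proof (induction cs arbitrary: ds)
    case Nil
    then have "horner x ds \<in> carrier R" using AR x by (intro horner_closed) auto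
    then show ?case using Nil by (intro exI[of _ ds]) simp
  next
    case (Cons c cs)
    have cl: "c \<in> carrier R" "horner x cs \<in> carrier R" using Cons.prems AR x by auto
    show ?case
    proof (cases ds)
      case Nil
      then show ?thesis using Cons.prems cl x by (intro exI[of _ "c # cs"]) auto
    next
      case (Cons d ds')
      with Cons.prems have d: "d \<in> A" "set ds' \<subseteq> A" by auto
      then obtain es where es: "set es \<subseteq> A" "horner x es = horner x cs \<oplus> horner x ds'"
        using Cons.IH[of ds'] Cons.prems by auto
      have "horner x ds' \<in> carrier R" "d \<in> carrier R" using d AR x by auto
      then show ?thesis using es d cl x Cons.prems Cons subringE(7)[OF A]
        by (intro exI[of _ "(c \<oplus> d) # es"]) (auto simp: r_distr a_ac)
    qed
  qed
  have scale: "\<exists>es. set es \<subseteq> A \<and> horner x es = q \<otimes> horner x cs" if "q \<in> A" "set cs \<subseteq> A" for q cs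
  proof (intro exI conjI)
    show "horner x (map ((\<otimes>) q) cs) = q \<otimes> horner x cs"
      using that AR x by (intro horner_map_mult) auto
  qed (use that subringE(6)[OF A] in auto)
  have mult: "\<exists>es. set es \<subseteq> A \<and> horner x es = horner x cs \<otimes> horner x ds"
    if cs: "set cs \<subseteq> A" and ds: "set ds \<subseteq> A" for cs ds
    using cs
  proof (induction cs)
    case Nil
    have "horner x ds \<in> carrier R" using ds AR x by (intro horner_closed) auto
    then show ?case by (intro exI[of _ "[]"]) simp
  next
    case (Cons c cs)
    have cl: "c \<in> carrier R" "horner x cs \<in> carrier R" "horner x ds \<in> carrier R"
      using Cons.prems ds AR x by auto
    obtain es where es: "set es \<subseteq> A" "horner x es = horner x cs \<otimes> horner x ds"
      using Cons by auto
    obtain fs where fs: "set fs \<subseteq> A" "horner x fs = c \<otimes> horner x ds"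
      using scale[of c ds] Cons.prems ds by (meson list.set_intros(1) subsetD)
    \<comment> \<open>Prepending \<open>\<zero>\<close> multiplies the value by
      \<open>x\<close>.\<close>
    have "set (\<zero> # es) \<subseteq> A" using es subringE(2)[OF A] by simp
    from plus[OF fs(1) this] obtain gs where "set gs \<subseteq> A"
      "horner x gs = horner x fs \<oplus> horner x (\<zero> # es)" by blast
    then show ?case using fs es cl x
      by (intro exI[of _ gs]) (simp add: l_distr m_assoc)
  qed
  have const: "\<exists>cs. set cs \<subseteq> A \<and> horner x cs = c" if "c \<in> A" for c
    using that AR x by (intro exI[of _ "[c]"]) auto
  have minus: "\<ominus> y = \<ominus> \<one> \<otimes> y" if "y \<in> carrier R" for y using that by (simp add: l_minus)
  show ?thesis
  proof (rule subringI)
    show "?E \<subseteq> carrier R" using AR x by auto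
    show "\<one> \<in> ?E" using const[OF subringE(3)[OF A]] by force
    fix y assume y: "y \<in> ?E"
    then obtain cs where cs: "set cs \<subseteq> A" "y = horner x cs" by blast
    have "\<ominus> \<one> \<in> A" using subringE(3,5)[OF A] by blast
    from scale[OF this cs(1)] show "\<ominus> y \<in> ?E"
      using minus[of y] cs AR x by (force)
    fix z assume z: "z \<in> ?E"
    then obtain ds where ds: "set ds \<subseteq> A" "z = horner x ds" by blast
    show "y \<otimes> z \<in> ?E" using mult[OF cs(1) ds(1)] cs(2) ds(2) by force
    show "y \<oplus> z \<in> ?E" using plus[OF cs(1) ds(1)] cs(2) ds(2) by force
  qed
qed

text \<open>The values at \<open>x\<close> of polynomials over \<open>A\<close> form a subring
  containing \<open>A\<close> and \<open>x\<close>, and the generated ring is the least such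
  subring.\<close>

lemma generate_ring_insert_horner:
  assumes A: "subring A R" and x: "x \<in> carrier R" and y: "y \<in> generate_ring R (insert x A)"
  obtains cs where "set cs \<subseteq> A" "y = horner x cs"
proof -
  note AR = subringE(1)[OF A]
  have "insert x A \<subseteq> {horner x cs | cs. set cs \<subseteq> A}"
  proof
    fix y assume "y \<in> insert x A"
    then consider "y = x" | "y \<in> A" by auto
    then show "y \<in> {horner x cs | cs. set cs \<subseteq> A}"
    proof cases
      case 1
      have "y = horner x [\<zero>, \<one>]" using 1 x by simp
      moreover have "set [\<zero>, \<one>] \<subseteq> A" using subringE(2,3)[OF A] by simp
      ultimately show ?thesis by blast
    next
      case 2
      then have "y = horner x [y]" using x AR by auto
      moreover have "set [y] \<subseteq> A" using 2 by simp
      ultimately show ?thesis by blast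
    qed
  qed
  then have "generate_ring R (insert x A) \<subseteq> {horner x cs | cs. set cs \<subseteq> A}"
    by (rule generate_ring_min_subring1[OF _ horner_set_subring[OF A x], rotated])
      (use x AR in auto)
  with y that show thesis by blast
qed

end

section \<open>Algebraic and transcendental elements over a subring\<close>

context field
begin

text \<open>Among the nontrivial relations of \<open>x\<close> one of least length is taken. The
  coefficient list of its derivative is one entry shorter and nontrivial by characteristic 0, so by
  minimality it does not vanish at \<open>x\<close>.\<close>

lemma separant_nonzero:
  assumes char0: "\<And>n::nat. n > 0 \<Longrightarrow> add_pow R n \<one> \<noteq> \<zero>"
    and A: "subring A R" and x: "x \<in> carrier R" "algebraic_over A x"
  obtains cs where "set cs \<subseteq> A" "horner x cs = \<zero>" "horner_deriv x cs \<noteq> \<zero>"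
proof -
  note AR = subringE(1)[OF A]
  define P where "P n \<longleftrightarrow> (\<exists>cs. set cs \<subseteq> A \<and> (\<exists>c\<in>set cs. c \<noteq> \<zero>) \<and> horner x cs = \<zero> \<and> length cs = n)"
    for n
  have "\<exists>n. P n" using x(2) unfolding P_def algebraic_over_def by blast
  then have P: "P (LEAST n. P n)" by (rule LeastI_ex)
  then obtain cs where cs: "set cs \<subseteq> A" "\<exists>c\<in>set cs. c \<noteq> \<zero>" "horner x cs = \<zero>"
    "length cs = (LEAST n. P n)" unfolding P_def by blast
  then obtain c ds where ds: "cs = c # ds" by (cases cs) auto
  have c: "c \<in> carrier R" "set ds \<subseteq> carrier R" using cs(1) ds AR by auto
  have nz: "\<exists>d\<in>set ds. d \<noteq> \<zero>"
  proof (rule ccontr)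
    assume "\<not> ?thesis"
    then have 0: "\<forall>d\<in>set ds. d = \<zero>" by blast
    then have "c = \<zero>" using cs(3) horner_all_zero[OF x(1) 0] c x ds by simp
    with 0 cs(2) ds show False by auto
  qed
  have pow: "add_pow R k d \<noteq> \<zero>" if "k > 0" "d \<noteq> \<zero>" "d \<in> carrier R" for k :: nat and d
  proof
    assume "add_pow R k d = \<zero>"
    moreover have "add_pow R k d = add_pow R k \<one> \<otimes> d"
      using add_pow_ldistr[of \<one> d k] that(3) by simp
    ultimately show False using integral[of "add_pow R k \<one>" d] char0[OF that(1)] that by auto
  qed
  have nzs: "\<exists>d\<in>set (scale_from k ds). d \<noteq> \<zero>" if "k > 0" for k
    using nz c(2) that by (induction ds arbitrary: k) (auto simp: pow)
  have eq: "horner_deriv x cs = horner x (scale_from 1 ds)"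
    using horner_scale_from[OF x(1) c(2), of 1] c x ds by simp
  have "horner x (scale_from 1 ds) \<noteq> \<zero>"
  proof
    assume "horner x (scale_from 1 ds) = \<zero>"
    then have "P (length ds)"
      unfolding P_def using nzs[of 1] scale_from_in_subring[OF A, of ds 1] cs(1) ds
      by (intro exI[of _ "scale_from 1 ds"]) auto
    then have "(LEAST n. P n) \<le> length ds" by (rule Least_le)
    with cs(4) ds show False by simp
  qed
  with eq cs show thesis by (intro that[of cs]) auto
qed

text \<open>A relation has finitely many coefficients; multiplying it by a common denominator moves
  all of them into \<open>A\<close>.\<close>

lemma algebraic_over_fractions:
  assumes A: "subring A R" and B: "B \<subseteq> carrier R"
    and frac: "\<And>b. b \<in> B \<Longrightarrow> \<exists>q\<in>A. q \<noteq> \<zero> \<and> q \<otimes> b \<in> A"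
    and x: "x \<in> carrier R" "algebraic_over B x"
  shows "algebraic_over A x"
proof -
  note AR = subringE(1)[OF A]
  from x(2) obtain cs where cs: "set cs \<subseteq> B" "\<exists>c\<in>set cs. c \<noteq> \<zero>" "horner x cs = \<zero>"
    unfolding algebraic_over_def by blast
  have "\<exists>q\<in>A. q \<noteq> \<zero> \<and> (\<forall>c\<in>set cs. q \<otimes> c \<in> A)"
    using cs(1)
  proof (induction cs)
    case Nil
    then show ?case using subringE(3)[OF A] by (intro bexI[of _ \<one>]) auto
  next
    case (Cons c cs)
    then obtain q where q: "q \<in> A" "q \<noteq> \<zero>" "\<forall>c\<in>set cs. q \<otimes> c \<in> A" by auto
    obtain r where r: "r \<in> A" "r \<noteq> \<zero>" "r \<otimes> c \<in> A" using frac[of c] Cons.prems by auto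
    have cl: "q \<in> carrier R" "r \<in> carrier R" "c \<in> carrier R" "set cs \<subseteq> carrier R"
      using q r Cons.prems AR B by auto
    show ?case
    proof (intro bexI[of _ "q \<otimes> r"] conjI ballI)
      show "q \<otimes> r \<in> A" using q r subringE(6)[OF A] by blast
      show "q \<otimes> r \<noteq> \<zero>" using q r cl integral by blast
      fix d assume d: "d \<in> set (c # cs)"
      show "q \<otimes> r \<otimes> d \<in> A"
      proof (cases "d = c")
        case True
        then show ?thesis using subringE(6)[OF A] q(1) r(3) cl by (simp add: m_assoc)
      next
        case False
        then have "d \<in> set cs" using d by simp
        then have "r \<otimes> (q \<otimes> d) \<in> A" "d \<in> carrier R" using q(3) r(1) subringE(6)[OF A] cl by auto
        then show ?thesis using cl by (simp add: m_ac)
      qed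
    qed
  qed
  then obtain q where q: "q \<in> A" "q \<noteq> \<zero>" "\<forall>c\<in>set cs. q \<otimes> c \<in> A" by blast
  have csR: "set cs \<subseteq> carrier R" using cs B by auto
  have qR: "q \<in> carrier R" using q AR by auto
  obtain c where "c \<in> set cs" "c \<noteq> \<zero>" using cs(2) by blast
  then have "q \<otimes> c \<in> set (map ((\<otimes>) q) cs)" "q \<otimes> c \<noteq> \<zero>"
    using integral[of q c] q(2) qR csR by auto
  moreover have "horner x (map ((\<otimes>) q) cs) = \<zero>"
    using horner_map_mult[OF x(1) qR csR] cs(3) qR by simp
  ultimately show ?thesis
    unfolding algebraic_over_def using q(3) by (intro exI[of _ "map ((\<otimes>) q) cs"]) auto
qed

text \<open>Over \<open>A\<close> the transcendental element \<open>x\<close> behaves like a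
  variable and may be sent to zero: each element is c + x z with a unique c in \<open>A\<close>, and
  the extension applies \<open>\<psi>\<close> to c.\<close>

lemma retraction_extend:
  assumes A: "subring A R" and F: "subring F R" "F \<subseteq> A"
    and x: "x \<in> carrier R" "\<not> algebraic_over A x" and \<psi>: "retraction A F \<psi>"
  obtains \<psi>' where "retraction (generate_ring R (insert x A)) F \<psi>'" "\<And>y. y \<in> A \<Longrightarrow> \<psi>' y = \<psi> y"
proof -
  note AR = subringE(1)[OF A]
  let ?B = "generate_ring R (insert x A)"
  have xA: "insert x A \<subseteq> carrier R" using x AR by auto
  have B: "subring ?B R" by (rule generate_ring_is_subring[OF xA])
  note BR = subringE(1)[OF B]
  have AB: "A \<subseteq> ?B" and xB: "x \<in> ?B" by (auto intro: generate_ring.incl)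
  have ex: "\<exists>c\<in>A. \<exists>z\<in>?B. y = c \<oplus> x \<otimes> z" if y: "y \<in> ?B" for y
  proof -
    obtain cs where cs: "set cs \<subseteq> A" "y = horner x cs"
      using generate_ring_insert_horner[OF A x(1) y] by blast
    show ?thesis
    proof (cases cs)
      case Nil
      then show ?thesis using cs subringE(2)[OF A] subringE(2)[OF B] x
        by (intro bexI[of _ \<zero>]) auto
    next
      case (Cons c ds)
      then have "horner x ds \<in> ?B" using horner_in_subring(1)[OF B xB, of ds] cs AB by auto
      then show ?thesis using cs Cons by auto
    qed
  qed
  \<comment> \<open>Two such decompositions differ by a relation of \<open>x\<close> over
    \<open>A\<close> with constant term \<open>c \<ominus> c'\<close>; transcendence forces all its
    coefficients to vanish.\<close>
  have uniq: "c = c'" if "c \<in> A" "c' \<in> A" "z \<in> ?B" "z' \<in> ?B" "c \<oplus> x \<otimes> z = c' \<oplus> x \<otimes> z'"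
    for c c' z z'
  proof -
    have cl: "c \<in> carrier R" "c' \<in> carrier R" "z \<in> carrier R" "z' \<in> carrier R"
      using that AR BR by auto
    have "z \<ominus> z' \<in> ?B" using subringE(5,7)[OF B] that unfolding a_minus_def by blast
    then obtain cs where cs: "set cs \<subseteq> A" "z \<ominus> z' = horner x cs"
      using generate_ring_insert_horner[OF A x(1)] by blast
    have "horner x ((c \<ominus> c') # cs) = (c \<oplus> x \<otimes> z) \<ominus> (c' \<oplus> x \<otimes> z')"
      unfolding horner.simps cs(2)[symmetric] using cl x(1) by algebra
    also have "\<dots> = \<zero>" using that(5) cl x(1) by (simp add: a_minus_def r_neg)
    finally have "horner x ((c \<ominus> c') # cs) = \<zero>" .
    moreover have "set ((c \<ominus> c') # cs) \<subseteq> A"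
      using cs that subringE(5,7)[OF A] by (auto simp: a_minus_def)
    ultimately have "\<not> (\<exists>d\<in>set ((c \<ominus> c') # cs). d \<noteq> \<zero>)"
      using x(2) unfolding algebraic_over_def by blast
    then have "c \<ominus> c' = \<zero>" by simp
    then show ?thesis using cl by simp
  qed
  define \<psi>' where "\<psi>' y = \<psi> (SOME c. c \<in> A \<and> (\<exists>z\<in>?B. y = c \<oplus> x \<otimes> z))" for y
  have \<psi>': "\<psi>' (c \<oplus> x \<otimes> z) = \<psi> c" if c: "c \<in> A" "z \<in> ?B" for c z
  proof -
    let ?Q = "\<lambda>c'. c' \<in> A \<and> (\<exists>z'\<in>?B. c \<oplus> x \<otimes> z = c' \<oplus> x \<otimes> z')"
    have "?Q c" using c by blast
    then have "?Q (SOME c'. ?Q c')" by (rule someI)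
    then obtain z' where "(SOME c'. ?Q c') \<in> A" "z' \<in> ?B" "c \<oplus> x \<otimes> z = (SOME c'. ?Q c') \<oplus> x \<otimes> z'"
      by blast
    then have "c = (SOME c'. ?Q c')" by (intro uniq[OF c(1) _ c(2)])
    then show ?thesis unfolding \<psi>'_def by metis
  qed
  have \<psi>'A: "\<psi>' y = \<psi> y" if "y \<in> A" for y
    using \<psi>'[OF that subringE(2)[OF B]] that AR x(1) by (auto simp: subsetD)
  have "retraction ?B F \<psi>'"
    unfolding retraction_def
  proof (intro conjI ballI)
    show "\<psi>' y \<in> F" if "y \<in> ?B" for y
      using ex[OF that] \<psi>' \<psi> unfolding retraction_def by auto
    show "\<psi>' y = y" if "y \<in> F" for y
      using \<psi>'A \<psi> that F(2) unfolding retraction_def by auto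
    fix y y' assume "y \<in> ?B" "y' \<in> ?B"
    then obtain c z c' z' where c: "c \<in> A" "z \<in> ?B" "y = c \<oplus> x \<otimes> z"
      "c' \<in> A" "z' \<in> ?B" "y' = c' \<oplus> x \<otimes> z'" using ex by metis
    have cl: "c \<in> carrier R" "c' \<in> carrier R" "z \<in> carrier R" "z' \<in> carrier R"
      using c AR BR by auto
    have "y \<oplus> y' = (c \<oplus> c') \<oplus> x \<otimes> (z \<oplus> z')" using c cl x(1) by algebra
    moreover have "z \<oplus> z' \<in> ?B" "c \<oplus> c' \<in> A" using c subringE(7)[OF B] subringE(7)[OF A] by auto
    ultimately show "\<psi>' (y \<oplus> y') = \<psi>' y \<oplus> \<psi>' y'"
      using \<psi>' c \<psi> unfolding retraction_def by auto
    have "y \<otimes> y' = (c \<otimes> c') \<oplus> x \<otimes> (z \<otimes> c' \<oplus> y \<otimes> z')" using c(3,6) cl x(1) by algebra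
    moreover have "z \<otimes> c' \<oplus> y \<otimes> z' \<in> ?B" "c \<otimes> c' \<in> A"
      using c \<open>y \<in> ?B\<close> subringE(6,7)[OF B] subringE(6)[OF A] AB by auto
    ultimately show "\<psi>' (y \<otimes> y') = \<psi>' y \<otimes> \<psi>' y'"
      using \<psi>' c \<psi> unfolding retraction_def by auto
  qed
  with \<psi>'A show thesis by (rule that[rotated])
qed

end

section \<open>Derivatives and their ranking\<close>

context differential_field
begin

lemma foldr_der_closed: "x \<in> carrier K \<Longrightarrow> foldr (der K) ds x \<in> carrier K"
  by (induction ds) (auto simp: der_closed)

lemma foldr_der_snoc_commute:
  "x \<in> carrier K \<Longrightarrow> foldr (der K) ds (der K d x) = der K d (foldr (der K) ds x)"
  by (induction ds) (auto simp: foldr_der_closed der_commute)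

text \<open>A derivation can be moved to the front of the list past all others. This makes the
  enumeration chosen in \<open>higher_der\<close> immaterial.\<close>

lemma foldr_der_mset_cong:
  assumes "x \<in> carrier K" "mset ds = mset es"
  shows "foldr (der K) ds x = foldr (der K) es x"
  using assms(2)
proof (induction ds arbitrary: es)
  case Nil
  then show ?case by simp
next
  case (Cons d ds)
  then have "d \<in> set es" by (metis list.set_intros(1) mset_eq_setD)
  then obtain es1 es2 where es: "es = es1 @ d # es2" by (meson split_list)
  then have "foldr (der K) ds x = foldr (der K) (es1 @ es2) x"
    using Cons by (intro Cons.IH) simp
  then show ?case using assms(1) by (simp add: es foldr_der_snoc_commute foldr_der_closed)
qed

lemma higher_der_mset: "x \<in> carrier K \<Longrightarrow> higher_der K (mset ds) x = foldr (der K) ds x"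
  unfolding higher_der_def
  by (rule foldr_der_mset_cong) (auto intro: someI[of "\<lambda>es. mset es = mset ds"])

lemma higher_der_empty [simp]: "x \<in> carrier K \<Longrightarrow> higher_der K {#} x = x"
  using higher_der_mset[of x "[]"] by simp

lemma higher_der_add_mset:
  assumes "x \<in> carrier K"
  shows "higher_der K (add_mset d \<alpha>) x = der K d (higher_der K \<alpha> x)"
proof -
  obtain ds where "\<alpha> = mset ds" by (metis ex_mset)
  then show ?thesis using higher_der_mset[OF assms, of "d # ds"] higher_der_mset[OF assms, of ds] by simp
qed

lemma higher_der_closed: "x \<in> carrier K \<Longrightarrow> higher_der K \<alpha> x \<in> carrier K"
  by (metis ex_mset foldr_der_closed higher_der_mset)

end

lemma finite_multiset_size_le: "finite {\<alpha> :: 'm::finite multiset. size \<alpha> \<le> k}"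
proof -
  have "{\<alpha> :: 'm multiset. size \<alpha> \<le> k} \<subseteq> mset ` {xs. set xs \<subseteq> UNIV \<and> length xs \<le> k}"
    by (auto simp: image_iff) (metis ex_mset size_mset)
  then show ?thesis by (rule finite_subset) (intro finite_imageI finite_lists_length_le finite)
qed

text \<open>An orderly ranking: derivatives are compared by order, then by multi-index, then by
  indeterminate. As only finitely many derivatives lie below a given one, it is counted by \<open>\<rho>\<close>.\<close>

lemma orderly_ranking:
  obtains \<rho> :: "nat \<times> 'm::finite multiset \<Rightarrow> nat"
  where "inj_on \<rho> ({..<n} \<times> UNIV)"
    "\<And>j \<alpha> d. j < n \<Longrightarrow> \<rho> (j, \<alpha>) < \<rho> (j, add_mset d \<alpha>)"
    "\<And>j k \<alpha> \<beta> d. \<lbrakk>j < n; k < n; \<rho> (j, \<alpha>) < \<rho> (k, \<beta>)\<rbrakk> \<Longrightarrow>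
      \<rho> (j, add_mset d \<alpha>) < \<rho> (k, add_mset d \<beta>)"
proof -
  \<comment> \<open>Any numbering of the derivations will do: it turns multi-indices into multisets
    of natural numbers, which the multiset order compares linearly.\<close>
  obtain enc :: "'m \<Rightarrow> nat" where enc: "inj enc"
    using finite_imp_inj_to_nat_seg[of "UNIV :: 'm set"] by auto
  define im where "im \<alpha> = image_mset enc \<alpha>" for \<alpha>
  have im_inj: "\<alpha> = \<beta>" if "im \<alpha> = im \<beta>" for \<alpha> \<beta>
    using that enc unfolding im_def by (metis injD multiset.inj_map)
  define lt where "lt u v \<longleftrightarrow> size (snd u) < size (snd v) \<or>
    size (snd u) = size (snd v) \<and> (im (snd u) < im (snd v) \<or> im (snd u) = im (snd v) \<and> fst u < fst v)"
    for u v :: "nat \<times> 'm multiset"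
  let ?D = "{..<n} \<times> (UNIV :: 'm multiset set)"
  define \<rho> where "\<rho> v = card {u \<in> ?D. lt u v}" for v
  have fin: "finite {u \<in> ?D. lt u v}" for v
  proof -
    have "{u \<in> ?D. lt u v} \<subseteq> {..<n} \<times> {\<alpha>. size \<alpha> \<le> size (snd v)}" by (auto simp: lt_def)
    then show ?thesis by (rule finite_subset) (simp add: finite_multiset_size_le)
  qed
  have irrefl: "\<not> lt u u" for u by (simp add: lt_def)
  have trans: "lt u w" if "lt u v" "lt v w" for u v w
    using that unfolding lt_def by (elim disjE conjE) (auto intro: less_trans)
  have total: "u = v \<or> lt u v \<or> lt v u" for u v
    unfolding lt_def by (cases u; cases v) (auto dest: im_inj simp: not_less_iff_gr_or_eq)
  have mono: "\<rho> u < \<rho> v" if "u \<in> ?D" "lt u v" for u v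
    unfolding \<rho>_def
  proof (rule psubset_card_mono[OF fin])
    show "{x \<in> ?D. lt x u} \<subset> {x \<in> ?D. lt x v}"
      using that irrefl trans by blast
  qed
  have iff: "\<rho> u < \<rho> v \<longleftrightarrow> lt u v" if "u \<in> ?D" "v \<in> ?D" for u v
    using that mono total[of u v] by (metis less_asym less_irrefl)
  \<comment> \<open>One more derivation on each side raises both orders by one, and adding a common
    element preserves comparisons of multisets.\<close>
  have shift: "lt (j, add_mset d \<alpha>) (k, add_mset d \<beta>)" if "lt (j, \<alpha>) (k, \<beta>)" for j k d \<alpha> \<beta>
    using that unfolding lt_def by (auto simp: im_def)
  show thesis
  proof (rule that[of \<rho>])
    show "inj_on \<rho> ?D" using iff total by (intro inj_onI) (metis less_irrefl)
    show "\<rho> (j, \<alpha>) < \<rho> (j, add_mset d \<alpha>)" if "j < n" for j \<alpha> d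
      using that by (intro mono) (auto simp: lt_def)
    show "\<rho> (j, add_mset d \<alpha>) < \<rho> (k, add_mset d \<beta>)"
      if "j < n" "k < n" "\<rho> (j, \<alpha>) < \<rho> (k, \<beta>)" for j k \<alpha> \<beta> d
      using that iff shift by auto
  qed
qed

section \<open>Algebraic points of differentially finitely generated algebras\<close>

context differential_field
begin

lemma der_zero [simp]: "der K d \<zero> = \<zero>"
proof -
  have "der K d \<zero> = der K d \<zero> \<oplus> der K d \<zero>" using der_add[of \<zero> \<zero> d] by simp
  then show ?thesis using der_closed[of \<zero> d] by (metis add.l_cancel_one' zero_closed)
qed

lemma der_one [simp]: "der K d \<one> = \<zero>"
proof -
  have "der K d \<one> = der K d \<one> \<oplus> der K d \<one>" using der_mult[of \<one> \<one> d] der_closed[of \<one> d] by simp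
  then show ?thesis using der_closed[of \<one> d] by (metis add.l_cancel_one' one_closed)
qed

lemma der_minus:
  assumes "x \<in> carrier K"
  shows "der K d (\<ominus> x) = \<ominus> der K d x"
proof -
  have "der K d (\<ominus> x) \<oplus> der K d x = \<zero>"
    using der_add[of "\<ominus> x" x d] assms by (simp add: l_neg)
  then show ?thesis using assms der_closed by (simp add: minus_equality)
qed

text \<open>The chain rule. The factor of \<open>der K d x\<close> is the separant; if the
  polynomial vanishes at \<open>x\<close>, the equation can be solved for \<open>der K d x\<close>
  up to that denominator.\<close>

lemma der_horner:
  assumes "x \<in> carrier K" "set cs \<subseteq> carrier K"
  shows "der K d (horner x cs) = horner x (map (der K d) cs) \<oplus> horner_deriv x cs \<otimes> der K d x"
  using assms(2)
proof (induction cs)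
  case Nil
  then show ?case using assms(1) der_closed by simp
next
  case (Cons c cs)
  have cl: "c \<in> carrier K" "horner x cs \<in> carrier K" "horner_deriv x cs \<in> carrier K"
    "der K d c \<in> carrier K" "der K d x \<in> carrier K" "horner x (map (der K d) cs) \<in> carrier K"
    using Cons.prems assms(1) der_closed by (auto intro!: horner_closed simp: subsetD)
  have "der K d (horner x (c # cs)) = der K d c \<oplus> (der K d x \<otimes> horner x cs \<oplus>
      x \<otimes> (horner x (map (der K d) cs) \<oplus> horner_deriv x cs \<otimes> der K d x))"
    using Cons cl assms(1) by (simp add: der_add der_mult)
  also have "\<dots> = horner x (map (der K d) (c # cs)) \<oplus> horner_deriv x (c # cs) \<otimes> der K d x"
    unfolding horner.simps horner_deriv.simps list.map using cl assms(1) by algebra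
  finally show ?case .
qed

text \<open>By the Leibniz rule it suffices to look at generators. A second generating set
  \<open>H'\<close> is needed because derivations raise the rank.\<close>

lemma der_generate_ring:
  assumes H: "H \<subseteq> carrier K" "H' \<subseteq> carrier K" "H \<subseteq> generate_ring K H'"
    and der: "\<And>h. h \<in> H \<Longrightarrow> der K d h \<in> generate_ring K H'"
    and x: "x \<in> generate_ring K H"
  shows "der K d x \<in> generate_ring K H'"
proof -
  note sub = generate_ring_is_subring[OF H(2)]
  have H': "generate_ring K H \<subseteq> generate_ring K H'"
    by (rule generate_ring_min_subring1[OF H(1) sub H(3)])
  note car = generate_ring_in_carrier[OF H(1)]
  show ?thesis using x
  proof induction
    case one
    then show ?case using subringE(2)[OF sub] by simp
  next
    case (incl h)
    then show ?case by (rule der)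
  next
    case (a_inv h)
    then show ?case using car by (simp add: der_minus generate_ring.a_inv)
  next
    case (eng_add h1 h2)
    then show ?case using car by (simp add: der_add generate_ring.eng_add)
  next
    case (eng_mult h1 h2)
    then have "h1 \<in> generate_ring K H'" "h2 \<in> generate_ring K H'" using H' by auto
    with eng_mult show ?case using car
      by (simp add: der_mult generate_ring.eng_mult generate_ring.eng_add)
  qed
qed

lemma minus_eq_mult_minus: "x \<in> carrier K \<Longrightarrow> y \<in> carrier K \<Longrightarrow> z \<in> carrier K \<Longrightarrow>
    x \<oplus> y \<otimes> z = \<zero> \<Longrightarrow> y \<otimes> z = \<ominus> x"
  by (metis a_comm m_closed minus_equality)

text \<open>Once finitely many separants are inverted, a point of a finitely generated subalgebra extends: the
  remaining algebraic derivatives add nothing, and the transcendental ones may be sent to zero.\<close>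

theorem algebraic_point:
  fixes a :: "nat \<Rightarrow> 'a"
  assumes ec: "ec_as_field F K" and der_F: "\<And>d x. x \<in> F \<Longrightarrow> der K d x \<in> F"
    and a: "\<And>j. j < n \<Longrightarrow> a j \<in> carrier K"
  obtains \<psi> where "retraction (generate_ring K (F \<union> {higher_der K \<alpha> (a j) | j \<alpha>. j < n})) F \<psi>"
proof -
  have F: "subfield F K" using ec by (simp add: ec_as_field_def)
  note Fr = subfieldE(1)[OF F] and FK = subfieldE(3)[OF F]
  obtain \<rho> :: "nat \<times> 'm multiset \<Rightarrow> nat" where \<rho>: "inj_on \<rho> ({..<n} \<times> UNIV)"
    "\<And>j \<alpha> d. j < n \<Longrightarrow> \<rho> (j, \<alpha>) < \<rho> (j, add_mset d \<alpha>)"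
    "\<And>j k \<alpha> \<beta> d. \<lbrakk>j < n; k < n; \<rho> (j, \<alpha>) < \<rho> (k, \<beta>)\<rbrakk> \<Longrightarrow>
      \<rho> (j, add_mset d \<alpha>) < \<rho> (k, add_mset d \<beta>)"
    using orderly_ranking by blast
  define w where "w v = higher_der K (snd v) (a (fst v))" for v :: "nat \<times> 'm multiset"
  define D where "D = {..<n} \<times> (UNIV :: 'm multiset set)"
  have wc: "w v \<in> carrier K" if "v \<in> D" for v
    using that a higher_der_closed by (auto simp: w_def D_def)
  have der_w: "der K d (w (j, \<alpha>)) = w (j, add_mset d \<alpha>)" if "j < n" for d j \<alpha>
    using a[OF that] by (simp add: w_def higher_der_add_mset)
  \<comment> \<open>A filtration by rank: \<open>G k\<close> is generated by \<open>F\<close> and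
    the derivatives of rank strictly below \<open>k\<close>, so a derivative \<open>v\<close> is to
    be compared with \<open>G (\<rho> v)\<close>.\<close>
  define H where "H k = F \<union> w ` {v \<in> D. \<rho> v < k}" for k
  define G where "G k = generate_ring K (H k)" for k
  have HK: "H k \<subseteq> carrier K" for k using FK wc by (auto simp: H_def)
  have G: "subring (G k) K" for k unfolding G_def by (rule generate_ring_is_subring[OF HK])
  note GK = subringE(1)[OF G]
  have Hmono: "H k \<subseteq> H l" if "k \<le> l" for k l using that by (auto simp: H_def)
  have Gmono: "G k \<subseteq> G l" if "k \<le> l" for k l
    unfolding G_def by (rule mono_generate_ring[OF Hmono[OF that] HK])
  have wG: "w v \<in> G k" if "v \<in> D" "\<rho> v < k" for v k
    using that by (auto simp: G_def H_def intro: generate_ring.incl)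
  \<comment> \<open>Differentiation moves each stage into the correspondingly shifted one, because
    the ranking is preserved when the same derivation is added on both sides.\<close>
  have der_G: "der K d x \<in> G (\<rho> (j, add_mset d \<alpha>))" if "x \<in> G (\<rho> (j, \<alpha>))" "j < n" for d x j \<alpha>
    unfolding G_def
  proof (rule der_generate_ring[OF HK HK _ _ that(1)[unfolded G_def]])
    have "\<rho> (j, \<alpha>) \<le> \<rho> (j, add_mset d \<alpha>)" using \<rho>(2) that(2) less_imp_le by blast
    then show "H (\<rho> (j, \<alpha>)) \<subseteq> generate_ring K (H (\<rho> (j, add_mset d \<alpha>)))"
      using Hmono by (auto intro: generate_ring.incl)
    fix h assume "h \<in> H (\<rho> (j, \<alpha>))"
    then consider "h \<in> F" | k \<beta> where "k < n" "\<rho> (k, \<beta>) < \<rho> (j, \<alpha>)" "h = w (k, \<beta>)"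
      by (auto simp: H_def D_def)
    then have "der K d h \<in> H (\<rho> (j, add_mset d \<alpha>))"
    proof cases
      case 1
      then show ?thesis using der_F by (auto simp: H_def)
    next
      case 2
      then have "\<rho> (k, add_mset d \<beta>) < \<rho> (j, add_mset d \<alpha>)" using \<rho>(3) that(2) by blast
      with 2 show ?thesis using der_w by (auto simp: H_def D_def)
    qed
    then show "der K d h \<in> generate_ring K (H (\<rho> (j, add_mset d \<alpha>)))" by (rule generate_ring.incl)
  qed
  define Alg where "Alg = {v \<in> D. algebraic_over (G (\<rho> v)) (w v)}"
  \<comment> \<open>\<open>s\<close> is the separant of a relation of
    \<open>w (j, \<alpha>)\<close>. One and the same \<open>s\<close> is a denominator for all
    proper derivatives of \<open>w (j, \<alpha>)\<close>, which is why finitely many denominators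
    will be enough.\<close>
  have sep: "\<exists>s. s \<in> G (Suc (\<rho> (j, \<alpha>))) \<and> s \<noteq> \<zero> \<and>
      (\<forall>\<beta>. \<beta> \<noteq> {#} \<longrightarrow> s \<otimes> w (j, \<alpha> + \<beta>) \<in> G (\<rho> (j, \<alpha> + \<beta>)))" if "(j, \<alpha>) \<in> Alg" for j \<alpha>
  proof -
    have j: "j < n" and v: "(j, \<alpha>) \<in> D" using that by (auto simp: Alg_def D_def)
    let ?x = "w (j, \<alpha>)" and ?A = "G (\<rho> (j, \<alpha>))"
    have x: "?x \<in> carrier K" using wc v by blast
    have al: "algebraic_over ?A ?x" using that by (simp add: Alg_def)
    obtain cs where cs: "set cs \<subseteq> ?A" "horner ?x cs = \<zero>" "horner_deriv ?x cs \<noteq> \<zero>"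
      using separant_nonzero[OF char_zero G x al] by blast
    have csK: "set cs \<subseteq> carrier K" using cs GK by blast
    define s where "s = horner_deriv ?x cs"
    have sG: "s \<in> G (Suc (\<rho> (j, \<alpha>)))"
      unfolding s_def
      by (rule horner_in_subring(2)[OF G wG[OF v]])
        (use cs Gmono[of "\<rho> (j, \<alpha>)" "Suc (\<rho> (j, \<alpha>))"] in auto)
    have lt: "\<rho> (j, \<alpha>) < \<rho> (j, \<alpha> + \<beta>)" if "\<beta> \<noteq> {#}" for \<beta>
      using that
    proof (induction \<beta>)
      case (add d \<beta>)
      then show ?case using \<rho>(2)[OF j, of "\<alpha> + \<beta>" d]
        by (cases "\<beta> = {#}") auto
    qed simp
    have sK: "s \<in> carrier K" using sG GK by blast
    have *: "s \<otimes> w (j, \<alpha> + \<beta>) \<in> G (\<rho> (j, \<alpha> + \<beta>))" if "\<beta> \<noteq> {#}" for \<beta>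
      using that
    proof (induction \<beta>)
      case (add d \<beta>)
      let ?\<gamma> = "\<alpha> + \<beta>" and ?\<gamma>' = "\<alpha> + add_mset d \<beta>"
      have v': "(j, ?\<gamma>) \<in> D" "(j, ?\<gamma>') \<in> D" using j by (auto simp: D_def)
      have dw: "der K d (w (j, ?\<gamma>)) = w (j, ?\<gamma>')" using der_w[OF j, of d ?\<gamma>] by simp
      have r': "\<rho> (j, ?\<gamma>) < \<rho> (j, ?\<gamma>')" using \<rho>(2)[OF j, of ?\<gamma> d] by simp
      show ?case
      proof (cases "\<beta> = {#}")
        \<comment> \<open>The relation itself is differentiated: \<open>s\<close> multiplies the new
          derivative, and everything else has lower rank.\<close>
        case True
        have "set (map (der K d) cs) \<subseteq> G (\<rho> (j, ?\<gamma>'))" using der_G[OF _ j, of _ \<alpha> d] cs(1) True by auto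
        moreover have "?x \<in> G (\<rho> (j, ?\<gamma>'))" using wG[OF v] r' True by simp
        ultimately have e: "horner ?x (map (der K d) cs) \<in> G (\<rho> (j, ?\<gamma>'))"
          using horner_in_subring(1)[OF G] by blast
        have "horner ?x (map (der K d) cs) \<oplus> s \<otimes> w (j, ?\<gamma>') = \<zero>"
          using der_horner[OF x csK, of d] cs(2) dw True by (simp add: s_def)
        then have "s \<otimes> w (j, ?\<gamma>') = \<ominus> horner ?x (map (der K d) cs)"
          using e GK sK wc[OF v'(2)] by (intro minus_eq_mult_minus) auto
        then show ?thesis using e subringE(5)[OF G] by simp
      next
        \<comment> \<open>By the product rule \<open>s \<otimes> ?y'\<close> is the derivative of
          \<open>s \<otimes> ?y\<close> minus \<open>der K d s \<otimes> ?y\<close>, and both of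
          these have lower rank.\<close>
        case False
        let ?y = "w (j, ?\<gamma>)" and ?y' = "w (j, ?\<gamma>')"
        have IH: "s \<otimes> ?y \<in> G (\<rho> (j, ?\<gamma>))" using add.IH False by blast
        have d1: "der K d (s \<otimes> ?y) \<in> G (\<rho> (j, ?\<gamma>'))" using der_G[OF IH j, of d] by simp
        have "s \<in> G (\<rho> (j, ?\<gamma>))"
          using sG subsetD[OF Gmono[OF Suc_leI[OF lt[OF False]]]] by blast
        then have "der K d s \<in> G (\<rho> (j, ?\<gamma>'))" using der_G[OF _ j, of s ?\<gamma> d] by simp
        moreover have "?y \<in> G (\<rho> (j, ?\<gamma>'))" using wG[OF v'(1) r'] .
        ultimately have d2: "der K d s \<otimes> ?y \<in> G (\<rho> (j, ?\<gamma>'))" using subringE(6)[OF G] by blast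
        have cl: "?y \<in> carrier K" "?y' \<in> carrier K" "der K d s \<in> carrier K"
          using wc v' der_closed sK by auto
        have "der K d (s \<otimes> ?y) = der K d s \<otimes> ?y \<oplus> s \<otimes> ?y'"
          using sK cl by (simp add: der_mult dw)
        then have "s \<otimes> ?y' = der K d (s \<otimes> ?y) \<oplus> \<ominus> (der K d s \<otimes> ?y)"
          using cl sK by algebra
        then show ?thesis using d1 d2 subringE(5,7)[OF G] by simp
      qed
    qed simp
    show ?thesis using sG cs(3) * by (intro exI[of _ s]) (auto simp: s_def)
  qed
  then obtain s where s: "s (j, \<alpha>) \<in> G (Suc (\<rho> (j, \<alpha>)))" "s (j, \<alpha>) \<noteq> \<zero>"
      "\<beta> \<noteq> {#} \<Longrightarrow> s (j, \<alpha>) \<otimes> w (j, \<alpha> + \<beta>) \<in> G (\<rho> (j, \<alpha> + \<beta>))"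
    if "(j, \<alpha>) \<in> Alg" for j \<alpha> \<beta>
  proof -
    define t where "t v = (SOME s. s \<in> G (Suc (\<rho> v)) \<and> s \<noteq> \<zero> \<and> (\<forall>\<beta>. \<beta> \<noteq> {#} \<longrightarrow>
      s \<otimes> w (fst v, snd v + \<beta>) \<in> G (\<rho> (fst v, snd v + \<beta>))))" for v
    have "t (j, \<alpha>) \<in> G (Suc (\<rho> (j, \<alpha>))) \<and> t (j, \<alpha>) \<noteq> \<zero> \<and> (\<forall>\<beta>. \<beta> \<noteq> {#} \<longrightarrow>
      t (j, \<alpha>) \<otimes> w (j, \<alpha> + \<beta>) \<in> G (\<rho> (j, \<alpha> + \<beta>)))" if "(j, \<alpha>) \<in> Alg" for j \<alpha>
      unfolding t_def fst_conv snd_conv by (rule someI_ex[OF sep[OF that]])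
    then show ?thesis by (intro that[of t]) auto
  qed
  \<comment> \<open>Dickson's lemma for each indeterminate: finitely many algebraic multi-indices
    lie below all the algebraic ones. They form the set \<open>M\<close> of leaders.\<close>
  have "\<forall>j. \<exists>B\<subseteq>{\<alpha>. (j, \<alpha>) \<in> Alg}. finite B \<and> (\<forall>\<alpha>\<in>{\<alpha>. (j, \<alpha>) \<in> Alg}. \<exists>\<beta>\<in>B. \<beta> \<subseteq># \<alpha>)"
    by (intro allI dickson[of UNIV]) auto
  from choice[OF this] obtain B where B: "\<forall>j. B j \<subseteq> {\<alpha>. (j, \<alpha>) \<in> Alg} \<and> finite (B j) \<and>
      (\<forall>\<alpha>\<in>{\<alpha>. (j, \<alpha>) \<in> Alg}. \<exists>\<beta>\<in>B j. \<beta> \<subseteq># \<alpha>)" ..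
  define M where "M = (SIGMA j:{..<n}. B j)"
  have M: "finite M" "M \<subseteq> Alg" using B by (auto simp: M_def)
  have leader: "\<exists>\<beta>. (j, \<beta>) \<in> M \<and> \<beta> \<subseteq># \<alpha>" if "(j, \<alpha>) \<in> Alg" for j \<alpha>
  proof -
    from B that obtain \<beta> where "\<beta> \<in> B j" "\<beta> \<subseteq># \<alpha>" by blast
    then show ?thesis using that by (auto simp: M_def Alg_def D_def)
  qed
  \<comment> \<open>Above the rank of every leader, the sum being a crude bound. From
    \<open>N\<close> on, \<open>G k\<close> contains all separants of leaders, and an algebraic
    derivative of such a rank is a proper derivative of some leader.\<close>
  define N where "N = Suc (\<Sum>v\<in>M. \<rho> v)"
  have N: "\<rho> v < N" if "v \<in> M" for v
    unfolding N_def less_Suc_eq_le using M(1) that by (intro member_le_sum) auto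
  have sK: "s v \<in> carrier K - {\<zero>}" if "v \<in> M" for v
    using that M(2) s(1,2) GK by (cases v) blast
  \<comment> \<open>Generators of the algebra to which existential closedness is applied. As the
    inverses of the separants are among them, the retraction keeps the separants invertible.\<close>
  define Y where "Y = (\<lambda>v. inv (s v)) ` M \<union> w ` {v \<in> D. \<rho> v < N}"
  have finD: "finite {v \<in> D. \<rho> v < k}" for k
  proof (rule finite_imageD[of \<rho>])
    show "inj_on \<rho> {v \<in> D. \<rho> v < k}" using \<rho>(1) by (auto simp: D_def intro: inj_on_subset)
    show "finite (\<rho> ` {v \<in> D. \<rho> v < k})" by (rule finite_subset[of _ "{..<k}"]) auto
  qed
  have Y: "finite Y" "Y \<subseteq> carrier K"
    using finD[of N] M(1) wc sK field_Units by (auto simp: Y_def)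
  obtain \<psi>0 where "retraction (generate_ring K (F \<union> Y)) F \<psi>0"
    using ec_retraction[OF ec Y] by blast
  define H' where "H' k = F \<union> Y \<union> w ` {v \<in> D. \<rho> v < k}" for k
  define G' where "G' k = generate_ring K (H' k)" for k
  have H'K: "H' k \<subseteq> carrier K" for k using FK Y wc by (auto simp: H'_def)
  have G': "subring (G' k) K" for k unfolding G'_def by (rule generate_ring_is_subring[OF H'K])
  note G'K = subringE(1)[OF G']
  have G'mono: "G' k \<subseteq> G' l" if "k \<le> l" for k l
    unfolding G'_def by (rule mono_generate_ring[OF _ H'K]) (use that in \<open>auto simp: H'_def\<close>)
  have GG': "G k \<subseteq> G' k" for k
    unfolding G'_def G_def by (rule mono_generate_ring[OF _ H'K]) (auto simp: H'_def H_def)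
  have FG': "F \<subseteq> G' k" for k by (auto simp: G'_def H'_def intro: generate_ring.incl)
  \<comment> \<open>The inverted separants already lie in \<open>G k\<close>, so \<open>G' k\<close>
    consists of fractions over \<open>G k\<close>. Consequently an element transcendental over
    \<open>G k\<close> remains so over \<open>G' k\<close>.\<close>
  have frac: "\<exists>q\<in>G k. q \<noteq> \<zero> \<and> q \<otimes> b \<in> G k" if Nk: "N \<le> k" and b: "b \<in> G' k" for k b
    using b[unfolded G'_def]
  proof induction
    case one
    then show ?case using subringE(3)[OF G] by (intro bexI[of _ \<one>]) auto
  next
    case (incl h)
    then consider "h \<in> H k" | v where "v \<in> M" "h = inv (s v)"
      using Nk by (auto simp: H'_def Y_def H_def)
    then show ?case
    proof cases
      case 1
      then have "h \<in> G k" by (auto simp: G_def intro: generate_ring.incl)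
      moreover from this have "h \<in> carrier K" using GK by blast
      ultimately show ?thesis using subringE(3)[OF G] GK by (intro bexI[of _ \<one>]) auto
    next
      case 2
      have "s v \<in> G (Suc (\<rho> v))" using s(1) M(2) 2(1) by (cases v) blast
      then have "s v \<in> G k" using Gmono[of "Suc (\<rho> v)" k] N[OF 2(1)] Nk by auto
      moreover have "s v \<otimes> h = \<one>" using 2 sK[OF 2(1)] field_Units Units_r_inv by auto
      ultimately show ?thesis using sK[OF 2(1)] subringE(3)[OF G] by (intro bexI[of _ "s v"]) auto
    qed
  next
    case (a_inv h)
    then obtain q where q: "q \<in> G k" "q \<noteq> \<zero>" "q \<otimes> h \<in> G k" by blast
    have "h \<in> carrier K" using a_inv generate_ring_in_carrier[OF H'K] by blast
    moreover have "q \<in> carrier K" using q GK by blast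
    ultimately have "q \<otimes> (\<ominus> h) = \<ominus> (q \<otimes> h)" by (simp add: r_minus)
    then show ?case using q subringE(5)[OF G] by (intro bexI[of _ q]) auto
  next
    case (eng_add h1 h2)
    then obtain q r where q: "q \<in> G k" "q \<noteq> \<zero>" "q \<otimes> h1 \<in> G k" "r \<in> G k" "r \<noteq> \<zero>" "r \<otimes> h2 \<in> G k"
      by blast
    have cl: "h1 \<in> carrier K" "h2 \<in> carrier K" "q \<in> carrier K" "r \<in> carrier K"
      using eng_add generate_ring_in_carrier[OF H'K] q GK by blast+
    have "q \<otimes> r \<otimes> (h1 \<oplus> h2) = r \<otimes> (q \<otimes> h1) \<oplus> q \<otimes> (r \<otimes> h2)" using cl by algebra
    moreover have "r \<otimes> (q \<otimes> h1) \<oplus> q \<otimes> (r \<otimes> h2) \<in> G k" using q subringE(6,7)[OF G] by simp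
    moreover have "q \<otimes> r \<in> G k" "q \<otimes> r \<noteq> \<zero>" using q subringE(6)[OF G] cl integral[of q r] by auto
    ultimately show ?case by (intro bexI[of _ "q \<otimes> r"]) auto
  next
    case (eng_mult h1 h2)
    then obtain q r where q: "q \<in> G k" "q \<noteq> \<zero>" "q \<otimes> h1 \<in> G k" "r \<in> G k" "r \<noteq> \<zero>" "r \<otimes> h2 \<in> G k"
      by blast
    have cl: "h1 \<in> carrier K" "h2 \<in> carrier K" "q \<in> carrier K" "r \<in> carrier K"
      using eng_mult generate_ring_in_carrier[OF H'K] q GK by blast+
    have "q \<otimes> r \<otimes> (h1 \<otimes> h2) = (q \<otimes> h1) \<otimes> (r \<otimes> h2)" using cl by algebra
    moreover have "(q \<otimes> h1) \<otimes> (r \<otimes> h2) \<in> G k" using q subringE(6)[OF G] by simp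
    moreover have "q \<otimes> r \<in> G k" "q \<otimes> r \<noteq> \<zero>" using q subringE(6)[OF G] cl integral[of q r] by auto
    ultimately show ?case by (intro bexI[of _ "q \<otimes> r"]) auto
  qed
  have step: "\<exists>\<psi>'. retraction (G' (Suc k)) F \<psi>' \<and> (\<forall>x\<in>G' k. \<psi>' x = \<psi> x)"
    if \<psi>: "retraction (G' k) F \<psi>" for k \<psi>
  proof (cases "\<exists>v\<in>D. \<rho> v = k \<and> w v \<notin> G' k")
    case False
    have "H' (Suc k) \<subseteq> G' k"
    proof
      fix x assume "x \<in> H' (Suc k)"
      then consider "x \<in> H' k" | v where "v \<in> D" "\<rho> v = k" "x = w v"
        by (auto simp: H'_def less_Suc_eq)
      then show "x \<in> G' k"
        using False by cases (auto simp: G'_def intro: generate_ring.incl)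
    qed
    then have "G' (Suc k) \<subseteq> G' k"
      unfolding G'_def[of "Suc k"] by (rule generate_ring_min_subring1[OF H'K G'])
    then have "G' (Suc k) = G' k" using G'mono[of k "Suc k"] by auto
    then show ?thesis using \<psi> by auto
  next
    case True
    then obtain v where v: "v \<in> D" "\<rho> v = k" "w v \<notin> G' k" by blast
    have Nk: "N \<le> k"
    proof (rule ccontr)
      assume "\<not> N \<le> k"
      then have "w v \<in> Y" using v by (auto simp: Y_def)
      then show False using v(3) by (auto simp: G'_def H'_def intro: generate_ring.incl)
    qed
    have "v \<notin> Alg"
    proof
      assume vA: "v \<in> Alg"
      obtain j \<alpha> where j: "v = (j, \<alpha>)" by (cases v)
      obtain \<beta> where \<beta>: "(j, \<beta>) \<in> M" "\<beta> \<subseteq># \<alpha>" using leader vA j by blast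
      obtain \<gamma> where \<gamma>: "\<alpha> = \<beta> + \<gamma>" using \<beta>(2) by (auto simp: mset_subset_eq_exists_conv)
      \<comment> \<open>The leader has rank below \<open>N\<close>, while \<open>v\<close> has rank
        \<open>k\<close>, which is at least \<open>N\<close>; so \<open>v\<close> is a proper
        derivative of it and its separant serves as denominator for \<open>w v\<close>.\<close>
      have "\<gamma> \<noteq> {#}" using N[OF \<beta>(1)] Nk v(2) j \<gamma> by auto
      then have "s (j, \<beta>) \<otimes> w v \<in> G k" using s(3) \<beta>(1) M(2) j \<gamma> v(2) by blast
      then have 1: "s (j, \<beta>) \<otimes> w v \<in> G' k" using GG' by blast
      have "inv (s (j, \<beta>)) \<in> Y" using \<beta>(1) by (auto simp: Y_def)
      then have 2: "inv (s (j, \<beta>)) \<in> G' k" by (auto simp: G'_def H'_def intro: generate_ring.incl)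
      have u: "s (j, \<beta>) \<in> Units K" using sK[OF \<beta>(1)] field_Units by blast
      have "w v = inv (s (j, \<beta>)) \<otimes> (s (j, \<beta>) \<otimes> w v)"
        using u wc[OF v(1)] m_assoc[of "inv (s (j, \<beta>))" "s (j, \<beta>)" "w v"] Units_closed[OF u]
          Units_inv_closed[OF u] Units_l_inv[OF u] by simp
      then have "w v \<in> G' k" using subringE(6)[OF G' 2 1] by simp
      with v(3) show False by blast
    qed
    then have "\<not> algebraic_over (G k) (w v)" using v by (auto simp: Alg_def)
    then have "\<not> algebraic_over (G' k) (w v)"
      using algebraic_over_fractions[OF G G'K frac[OF Nk] wc[OF v(1)]] by blast
    then obtain \<psi>' where \<psi>': "retraction (generate_ring K (insert (w v) (G' k))) F \<psi>'"
      "\<And>x. x \<in> G' k \<Longrightarrow> \<psi>' x = \<psi> x"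
      using retraction_extend[OF G' Fr FG' wc[OF v(1)] _ \<psi>] by blast
    have "H' (Suc k) \<subseteq> generate_ring K (insert (w v) (G' k))"
    proof
      fix x assume "x \<in> H' (Suc k)"
      then consider "x \<in> H' k" | u where "u \<in> D" "\<rho> u = k" "x = w u"
        by (auto simp: H'_def less_Suc_eq)
      then show "x \<in> generate_ring K (insert (w v) (G' k))"
      proof cases
        case 1
        then have "x \<in> G' k" by (auto simp: G'_def intro: generate_ring.incl)
        then show ?thesis by (auto intro: generate_ring.incl)
      next
        case 2
        then have "u = v" using \<rho>(1) v by (auto simp: D_def inj_on_def)
        then show ?thesis using 2 by (auto intro: generate_ring.incl)
      qed
    qed
    then have "G' (Suc k) \<subseteq> generate_ring K (insert (w v) (G' k))"
      unfolding G'_def[of "Suc k"]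
      by (rule generate_ring_min_subring1[OF H'K generate_ring_is_subring, rotated])
        (use wc[OF v(1)] G'K in auto)
    then have "retraction (G' (Suc k)) F \<psi>'"
      using \<psi>'(1) unfolding retraction_def by blast
    then show ?thesis using \<psi>'(2) by blast
  qed
  have "G' 0 = generate_ring K (F \<union> Y)" by (simp add: G'_def H'_def)
  with \<open>retraction (generate_ring K (F \<union> Y)) F \<psi>0\<close> have "\<exists>\<psi>. retraction (G' 0) F \<psi>" by auto
  \<comment> \<open>Dependent choice gives a compatible chain of retractions; \<open>\<chi>\<close>
    evaluates each element at the first stage that contains it.\<close>
  from dependent_nat_choice[of "\<lambda>k. retraction (G' k) F" "\<lambda>k \<psi> \<psi>'. \<forall>x\<in>G' k. \<psi>' x = \<psi> x", OF this step]
  obtain \<psi> where \<psi>: "\<And>k. retraction (G' k) F (\<psi> k)" "\<And>k x. x \<in> G' k \<Longrightarrow> \<psi> (Suc k) x = \<psi> k x"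
    by blast
  have \<psi>_le: "\<psi> l x = \<psi> k x" if "k \<le> l" "x \<in> G' k" for k l x
    using that(1)
  proof (induction l rule: dec_induct)
    case (step l)
    then show ?case using \<psi>(2)[OF subsetD[OF G'mono that(2)], of l] by simp
  qed simp
  define \<chi> where "\<chi> x = \<psi> (LEAST k. x \<in> G' k) x" for x
  have \<chi>: "\<chi> x = \<psi> k x" if "x \<in> G' k" for k x
    unfolding \<chi>_def using \<psi>_le[OF Least_le[of "\<lambda>k. x \<in> G' k", OF that] LeastI[of "\<lambda>k. x \<in> G' k", OF that]]
    by simp
  have ex: "\<exists>k. x \<in> G' k" if "x \<in> generate_ring K (F \<union> {higher_der K \<alpha> (a j) | j \<alpha>. j < n})" for x
    using that
  proof induction
    case one
    then show ?case using subringE(3)[OF G'] by blast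
  next
    case (incl h)
    then consider "h \<in> F" | j \<alpha> where "j < n" "h = w (j, \<alpha>)" by (auto simp: w_def)
    then show ?case
    proof cases
      case 1
      then show ?thesis using FG' by blast
    next
      case 2
      then have "h \<in> H' (Suc (\<rho> (j, \<alpha>)))" by (auto simp: H'_def D_def)
      then show ?thesis by (auto simp: G'_def intro: generate_ring.incl)
    qed
  next
    case (a_inv h)
    then show ?case using subringE(5)[OF G'] by blast
  next
    case (eng_add h1 h2)
    then obtain k l where "h1 \<in> G' k" "h2 \<in> G' l" by blast
    then have "h1 \<in> G' (max k l)" "h2 \<in> G' (max k l)" using G'mono[of k "max k l"] G'mono[of l "max k l"] by auto
    then show ?case using subringE(7)[OF G'] by blast
  next
    case (eng_mult h1 h2)
    then obtain k l where "h1 \<in> G' k" "h2 \<in> G' l" by blast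
    then have "h1 \<in> G' (max k l)" "h2 \<in> G' (max k l)" using G'mono[of k "max k l"] G'mono[of l "max k l"] by auto
    then show ?case using subringE(6)[OF G'] by blast
  qed
  show thesis
  proof (rule that[of \<chi>], unfold retraction_def, intro conjI ballI)
    let ?A = "generate_ring K (F \<union> {higher_der K \<alpha> (a j) | j \<alpha>. j < n})"
    show "\<chi> x \<in> F" if "x \<in> ?A" for x
      using ex[OF that] \<chi> \<psi>(1) unfolding retraction_def by force
    show "\<chi> x = x" if "x \<in> F" for x
      using \<chi>[of x 0] FG' \<psi>(1) that unfolding retraction_def by auto
    fix x y assume "x \<in> ?A" "y \<in> ?A"
    then obtain k l where "x \<in> G' k" "y \<in> G' l" using ex by blast
    then have xy: "x \<in> G' (max k l)" "y \<in> G' (max k l)"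
      using G'mono[of k "max k l"] G'mono[of l "max k l"] by auto
    then have "x \<oplus> y \<in> G' (max k l)" "x \<otimes> y \<in> G' (max k l)" using subringE(6,7)[OF G'] by auto
    with xy show "\<chi> (x \<oplus> y) = \<chi> x \<oplus> \<chi> y" "\<chi> (x \<otimes> y) = \<chi> x \<otimes> \<chi> y"
      using \<chi> \<psi>(1)[of "max k l"] unfolding retraction_def by auto
  qed
qed

end

section \<open>The twisted Taylor morphism\<close>

text \<open>Both products become sums over the divisors \<open>k\<close> of
  \<open>add_mset d m\<close>, weighted by \<open>count k d\<close> and by
  \<open>Suc (count m d) - count k d\<close>. The weights add up to \<open>Suc (count m d)\<close>,
  whatever \<open>k\<close> is.\<close>

lemma (in cring) formal_deriv_series_mult:
  fixes p q :: "'v multiset \<Rightarrow> 'a"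
  assumes p: "\<And>m. p m \<in> carrier R" and q: "\<And>m. q m \<in> carrier R"
  shows "formal_deriv R d (series_mult R p q) m =
    series_mult R (formal_deriv R d p) q m \<oplus> series_mult R p (formal_deriv R d q) m"
proof -
  let ?m = "add_mset d m"
  let ?t = "\<lambda>k. p k \<otimes> q (?m - k)"
  have t: "?t k \<in> carrier R" for k using p q by simp
  have fin: "finite {k. k \<subseteq># m}" "finite {k. k \<subseteq># ?m}" by (rule finite_subseteq_mset)+
  have sub: "{k. k \<subseteq># m} \<subseteq> {k. k \<subseteq># ?m}" by (auto intro: subset_mset.order_trans)
  have pow: "add_pow R (n::nat) x \<in> carrier R" if "x \<in> carrier R" for n x using that by simp
  have 1: "series_mult R (formal_deriv R d p) q m =
      (\<Oplus>k\<in>{k. k \<subseteq># ?m}. add_pow R (count k d) (?t k))"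
  proof -
    have "series_mult R (formal_deriv R d p) q m =
        (\<Oplus>k\<in>{k. k \<subseteq># m}. add_pow R (count (add_mset d k) d) (?t (add_mset d k)))"
      unfolding series_mult_def formal_deriv_def
      by (rule add.finprod_cong') (use p q add_pow_ldistr in \<open>auto simp del: add.nat_pow_Suc\<close>)
    also have "\<dots> = (\<Oplus>k\<in>add_mset d ` {k. k \<subseteq># m}. add_pow R (count k d) (?t k))"
      by (rule add.finprod_reindex[symmetric]) (use t pow in \<open>auto simp: inj_on_def simp del: add.nat_pow_Suc\<close>)
    also have "\<dots> = (\<Oplus>k\<in>{k. k \<subseteq># ?m}. add_pow R (count k d) (?t k))"
    proof (rule add.finprod_mono_neutral_cong_left[OF fin(2)])
      \<comment> \<open>Divisors that are not of the form \<open>add_mset d k'\<close> do not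
        contain \<open>d\<close> and have weight zero.\<close>
      fix k assume k: "k \<in> {k. k \<subseteq># ?m} - add_mset d ` {k. k \<subseteq># m}"
      have "d \<notin># k"
      proof
        assume "d \<in># k"
        then obtain k' where "k = add_mset d k'" by (metis insert_DiffM)
        with k show False by auto
      qed
      then show "add_pow R (count k d) (?t k) = \<zero>" using t by (simp add: not_in_iff)
    qed (use t in auto)
    finally show ?thesis .
  qed
  have 2: "series_mult R p (formal_deriv R d q) m =
      (\<Oplus>k\<in>{k. k \<subseteq># ?m}. add_pow R (Suc (count m d) - count k d) (?t k))"
    unfolding series_mult_def formal_deriv_def
  proof (rule add.finprod_mono_neutral_cong_left[OF fin(2) sub])
    fix k assume k: "k \<in> {k. k \<subseteq># ?m} - {k. k \<subseteq># m}"
    have "count k d = Suc (count m d)"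
    proof (rule ccontr)
      assume ne: "count k d \<noteq> Suc (count m d)"
      have "k \<subseteq># m" unfolding subseteq_mset_def
      proof
        fix x
        have "count k x \<le> count ?m x" using k by (intro mset_subset_eq_count) simp
        then show "count k x \<le> count m x" using ne by (cases "x = d") auto
      qed
      with k show False by simp
    qed
    then show "add_pow R (Suc (count m d) - count k d) (?t k) = \<zero>" using t by simp
  next
    fix k assume k: "k \<in> {k. k \<subseteq># m}"
    then obtain l where l: "m = k + l" by (auto simp: mset_subset_eq_exists_conv)
    show "p k \<otimes> add_pow R (Suc (count (m - k) d)) (q (add_mset d (m - k))) =
        add_pow R (Suc (count m d) - count k d) (?t k)"
      using add_pow_rdistr[of "p k" "q (add_mset d l)" "Suc (count l d)"] p q by (simp add: l del: add.nat_pow_Suc)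
  qed (use t in auto)
  have "series_mult R (formal_deriv R d p) q m \<oplus> series_mult R p (formal_deriv R d q) m =
      (\<Oplus>k\<in>{k. k \<subseteq># ?m}. add_pow R (count k d) (?t k) \<oplus>
        add_pow R (Suc (count m d) - count k d) (?t k))"
    unfolding 1 2 by (rule add.finprod_multf[symmetric]) (use t in auto)
  also have "\<dots> = (\<Oplus>k\<in>{k. k \<subseteq># ?m}. add_pow R (Suc (count m d)) (?t k))"
  proof (rule add.finprod_cong')
    fix k assume "k \<in> {k. k \<subseteq># ?m}"
    then have "count k d \<le> Suc (count m d)" by (metis mem_Collect_eq mset_subset_eq_count count_add_mset)
    then show "add_pow R (count k d) (?t k) \<oplus> add_pow R (Suc (count m d) - count k d) (?t k) =
        add_pow R (Suc (count m d)) (?t k)"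
      using t by (simp add: add.nat_pow_mult del: add.nat_pow_Suc)
  qed (use t pow in auto)
  also have "\<dots> = add_pow R (Suc (count m d)) (\<Oplus>k\<in>{k. k \<subseteq># ?m}. ?t k)"
    using fin(2)
  proof (induction)
    case (insert x B)
    have "(\<Oplus>k\<in>B. ?t k) \<in> carrier R" using t by (intro finsum_closed) auto
    then show ?case using insert t pow
      by (subst (1 2) finsum_insert) (auto simp: add.nat_pow_distrib simp del: add.nat_pow_Suc)
  qed (simp del: add.nat_pow_Suc)
  also have "\<dots> = formal_deriv R d (series_mult R p q) m"
    by (simp add: formal_deriv_def series_mult_def)
  finally show ?thesis ..
qed

context differential_field
begin

lemma der_finsum:
  assumes "\<And>x. x \<in> B \<Longrightarrow> g x \<in> carrier K"
  shows "der K d (\<Oplus>x\<in>B. g x) = (\<Oplus>x\<in>B. der K d (g x))"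
  using assms
proof (induction B rule: infinite_finite_induct)
  case (insert x B)
  have "(\<Oplus>x\<in>B. g x) \<in> carrier K" using insert by (intro finsum_closed) auto
  with insert show ?case
    by (subst (1 2) finsum_insert) (auto simp: der_add der_closed)
qed simp_all

lemma der_series_mult:
  fixes p q :: "'v multiset \<Rightarrow> 'a"
  assumes p: "\<And>m. p m \<in> carrier K" and q: "\<And>m. q m \<in> carrier K"
  shows "der K d (series_mult K p q m) =
    series_mult K (\<lambda>m. der K d (p m)) q m \<oplus> series_mult K p (\<lambda>m. der K d (q m)) m"
proof -
  have "der K d (series_mult K p q m) = (\<Oplus>k\<in>{k. k \<subseteq># m}.
      der K d (p k) \<otimes> q (m - k) \<oplus> p k \<otimes> der K d (q (m - k)))"
    unfolding series_mult_def by (subst der_finsum) (use p q in \<open>auto simp: der_mult\<close>)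
  also have "\<dots> = series_mult K (\<lambda>m. der K d (p m)) q m \<oplus> series_mult K p (\<lambda>m. der K d (q m)) m"
    unfolding series_mult_def by (rule add.finprod_multf) (use p q der_closed in auto)
  finally show ?thesis .
qed

lemma nat_nonzero: "n > 0 \<Longrightarrow> add_pow K (n::nat) \<one> \<noteq> \<zero>"
  by (rule char_zero)

lemma der_nat: "der K d (add_pow K (n::nat) \<one>) = \<zero>"
  by (induction n) (simp_all add: der_add)

text \<open>The Taylor coefficients carry the factor 1/\<alpha>!, which has to be a constant for all
  derivations.\<close>

lemma der_inv_nat:
  assumes "n > 0"
  shows "der K d (inv (add_pow K (n::nat) \<one>)) = \<zero>"
proof -
  let ?c = "add_pow K n \<one>"
  have u: "?c \<in> Units K" using nat_nonzero[OF assms] field_Units by simp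
  have c: "?c \<in> carrier K" "inv ?c \<in> carrier K" using u by auto
  have "der K d (inv ?c \<otimes> ?c) = der K d (inv ?c) \<otimes> ?c"
    using c der_closed by (simp add: der_mult der_nat)
  then have "der K d (inv ?c) \<otimes> ?c = \<zero>" using u by (simp add: Units_l_inv)
  then show ?thesis using integral[OF _ der_closed[OF c(2)] c(1)] nat_nonzero[OF assms] by blast
qed

lemma add_pow_cancel:
  assumes "add_pow K n x = add_pow K n y" "(n::nat) > 0" "x \<in> carrier K" "y \<in> carrier K"
  shows "x = y"
proof -
  have "add_pow K n \<one> \<otimes> x = add_pow K n \<one> \<otimes> y"
    using assms(1) add_pow_ldistr[of \<one> x n] add_pow_ldistr[of \<one> y n] assms(3,4) by simp
  then show ?thesis using m_lcancel[OF nat_nonzero[OF assms(2)]] assms(3,4) by simp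
qed

text \<open>The commutator of \<open>\<chi>\<close> with a derivation: it measures the failure of
  \<open>\<chi>\<close> to be differential.\<close>

definition twist :: "'m \<Rightarrow> ('a \<Rightarrow> 'a) \<Rightarrow> 'a \<Rightarrow> 'a"
  where "twist d \<chi> x = \<chi> (der K d x) \<ominus> der K d (\<chi> x)"

text \<open>The coefficient at \<open>\<alpha>\<close> of the Taylor series of \<open>x\<close> is the \<open>\<alpha>\<close>-fold twist of \<open>\<psi>\<close> at
  \<open>x\<close> divided by \<open>\<alpha>!\<close>. Twisting makes up for the derivations acting on the coefficients of
  the series as well.\<close>

theorem twisted_taylor:
  assumes F: "subfield F K" and der_F: "\<And>d x. x \<in> F \<Longrightarrow> der K d x \<in> F"
    and A: "subring A K" and FA: "F \<subseteq> A" and der_A: "\<And>d x. x \<in> A \<Longrightarrow> der K d x \<in> A"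
    and \<psi>: "retraction A F \<psi>"
  obtains T :: "'a \<Rightarrow> 'm multiset \<Rightarrow> 'a"
  where "\<And>x \<alpha>. x \<in> A \<Longrightarrow> T x \<alpha> \<in> F" "\<And>x. x \<in> F \<Longrightarrow> T x = indexed_const x"
    "\<And>x y. x \<in> A \<Longrightarrow> y \<in> A \<Longrightarrow> T (x \<oplus> y) = indexed_padd (T x) (T y)"
    "\<And>x y. x \<in> A \<Longrightarrow> y \<in> A \<Longrightarrow> T (x \<otimes> y) = series_mult K (T x) (T y)"
    "\<And>d x \<alpha>. x \<in> A \<Longrightarrow> T (der K d x) \<alpha> = der K d (T x \<alpha>) \<oplus> formal_deriv K d (T x) \<alpha>"
proof -
  note Fr = subfieldE(1)[OF F] and FK = subfieldE(3)[OF F] and AK = subringE(1)[OF A]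
  have \<psi>F: "\<psi> x \<in> F" if "x \<in> A" for x using \<psi> that by (simp add: retraction_def)
  \<comment> \<open>If the derivations vanish on \<open>F\<close>, this is \<open>\<psi>\<close>
    applied to the iterated derivative, the numerator of the ordinary Taylor coefficient.\<close>
  define nab where "nab ds = foldr twist ds \<psi>" for ds
  have nab_Nil: "nab [] = \<psi>" and nab_Cons: "nab (d # ds) x = nab ds (der K d x) \<ominus> der K d (nab ds x)"
    for d ds x by (simp_all add: nab_def twist_def)
  have nabF: "nab ds x \<in> F" if "x \<in> A" for ds x
    using that
  proof (induction ds arbitrary: x)
    case (Cons d ds)
    then show ?case using der_A der_F subringE(5,7)[OF Fr] by (simp add: nab_Cons a_minus_def)
  qed (simp add: nab_Nil \<psi>F)
  have nabK: "nab ds x \<in> carrier K" if "x \<in> A" for ds x using nabF[OF that] FK by blast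
  \<comment> \<open>Commuting derivations have commuting twists, so iterated twists depend only on
    the multiset of derivations and can be indexed by monomials.\<close>
  have swap: "nab (ds @ d # es) x = nab (d # ds @ es) x" if "x \<in> A" for ds d es x
    using that
  proof (induction ds arbitrary: x)
    case (Cons e ds)
    have cl: "nab (ds @ es) x \<in> carrier K" "nab (ds @ es) (der K d x) \<in> carrier K"
      "nab (ds @ es) (der K e x) \<in> carrier K" "nab (ds @ es) (der K d (der K e x)) \<in> carrier K"
      using nabK der_A Cons.prems by auto
    have c: "der K e (der K d x) = der K d (der K e x)"
      "der K e (der K d (nab (ds @ es) x)) = der K d (der K e (nab (ds @ es) x))"
      using der_commute Cons.prems AK cl by auto
    have "nab ((e # ds) @ d # es) x = nab (ds @ d # es) (der K e x) \<ominus> der K e (nab (ds @ d # es) x)"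
      by (simp add: nab_Cons)
    also have "\<dots> = nab (d # ds @ es) (der K e x) \<ominus> der K e (nab (d # ds @ es) x)"
      using Cons.IH[of x] Cons.IH[of "der K e x"] Cons.prems der_A by simp
    also have "\<dots> = nab (d # e # ds @ es) x"
      unfolding nab_Cons c(1)
      using cl der_closed c(2) by (simp add: a_minus_def der_add der_minus minus_add a_ac)
    finally show ?case by simp
  qed simp
  have nab_mset: "nab ds x = nab es x" if "mset ds = mset es" "x \<in> A" for ds es x
    using that
  proof (induction ds arbitrary: es x)
    case (Cons d ds)
    then have "d \<in> set es" by (metis list.set_intros(1) mset_eq_setD)
    then obtain es1 es2 where es: "es = es1 @ d # es2" by (meson split_list)
    have "nab ds y = nab (es1 @ es2) y" if "y \<in> A" for y
      using Cons.prems es that by (intro Cons.IH) auto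
    then show ?case using swap[OF Cons.prems(2)] Cons.prems(2) der_A by (simp add: es nab_Cons)
  qed simp
  define fac :: "'m multiset \<Rightarrow> nat" where "fac \<alpha> = (\<Prod>d\<in>UNIV. fact (count \<alpha> d))" for \<alpha>
  have fac_pos: "fac \<alpha> > 0" for \<alpha> by (simp add: fac_def prod_pos)
  have fac_add: "fac (add_mset d \<alpha>) = Suc (count \<alpha> d) * fac \<alpha>" for d \<alpha>
    unfolding fac_def prod.remove[OF finite UNIV_I, of _ d] by (simp add: algebra_simps)
  define c where "c \<alpha> = inv (add_pow K (fac \<alpha>) \<one>)" for \<alpha>
  have cK: "c \<alpha> \<in> carrier K" for \<alpha>
    unfolding c_def using nat_nonzero[OF fac_pos] field_Units by simp
  have natF: "add_pow K (n::nat) \<one> \<in> F" for n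
    using subringE(2,3,7)[OF Fr] by (induction n) auto
  have cF: "c \<alpha> \<in> F" for \<alpha>
    unfolding c_def using subfield_m_inv(1)[OF F] natF nat_nonzero[OF fac_pos] by blast
  \<comment> \<open>With \<alpha>_d for \<open>count \<alpha> d\<close>, this is (\<alpha>_d + 1) /
    (\<alpha> + d)! = 1 / \<alpha>!, the rescaling of coefficients under d/dt_d.\<close>
  have c_add: "add_pow K (Suc (count \<alpha> d)) (c (add_mset d \<alpha>)) = c \<alpha>" for \<alpha> d
  proof -
    let ?u = "add_pow K (fac \<alpha>) \<one>" and ?v = "add_pow K (Suc (count \<alpha> d)) \<one>"
    have nz: "?u \<in> carrier K - {\<zero>}" "?v \<in> carrier K - {\<zero>}"
      using nat_nonzero[OF fac_pos] nat_nonzero[of "Suc (count \<alpha> d)"] by (auto simp del: add.nat_pow_Suc)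
    have "add_pow K (fac (add_mset d \<alpha>)) \<one> = ?v \<otimes> ?u"
      unfolding fac_add using add_pow_ldistr[of \<one> ?u "Suc (count \<alpha> d)"]
      by (simp add: add.nat_pow_pow mult.commute del: add.nat_pow_Suc)
    moreover have "?v \<otimes> ?u \<in> Units K"
      using nz integral[of ?v ?u] unfolding field_Units by blast
    ultimately have "c (add_mset d \<alpha>) \<otimes> (?v \<otimes> ?u) = \<one>"
      unfolding c_def by (simp only: Units_l_inv)
    moreover have "c (add_mset d \<alpha>) \<otimes> (?v \<otimes> ?u) = ?u \<otimes> (?v \<otimes> c (add_mset d \<alpha>))"
      using nz(1,2) cK[of "add_mset d \<alpha>"] m_comm[of "c (add_mset d \<alpha>)" "?v \<otimes> ?u"]
        m_assoc[of ?u ?v "c (add_mset d \<alpha>)"] m_comm[of ?u ?v] m_closed[of ?v ?u] by (metis DiffD1)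
    ultimately have "inv ?u = ?v \<otimes> c (add_mset d \<alpha>)"
      using nz(1,2) cK m_closed[of ?v "c (add_mset d \<alpha>)"] by (intro comm_inv_char) auto
    then show ?thesis
      using add_pow_ldistr[of \<one> "c (add_mset d \<alpha>)" "Suc (count \<alpha> d)"] cK
      by (simp add: c_def[of \<alpha>] del: add.nat_pow_Suc)
  qed
  have der_c: "der K d (c \<alpha>) = \<zero>" for d \<alpha>
    unfolding c_def by (rule der_inv_nat[OF fac_pos])
  have c_empty: "c {#} = \<one>" by (simp add: c_def fac_def)
  define T where "T x \<alpha> = c \<alpha> \<otimes> nab (SOME ds. mset ds = \<alpha>) x" for x \<alpha>
  have T: "T x (mset ds) = c (mset ds) \<otimes> nab ds x" if "x \<in> A" for ds x
  proof -
    have "mset (SOME es. mset es = mset ds) = mset ds" by (rule someI_ex) blast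
    then show ?thesis unfolding T_def using nab_mset[OF _ that] by metis
  qed
  have TF: "T x \<alpha> \<in> F" if "x \<in> A" for x \<alpha>
    unfolding T_def using cF nabF[OF that] subringE(6)[OF Fr] by blast
  have TK: "T x \<alpha> \<in> carrier K" if "x \<in> A" for x \<alpha> using TF[OF that] FK by blast
  have add_minus_cancel: "u = v \<oplus> (u \<ominus> v)" if "u \<in> carrier K" "v \<in> carrier K" for u v
    using that by algebra
  \<comment> \<open>By \<open>c_add\<close>, the formal derivative has at \<open>\<alpha>\<close>
    the next twist divided by \<alpha>!. The claim is then the definition of that twist, solved for
    the term with \<open>der K d x\<close>.\<close>
  have Tder: "T (der K d x) \<alpha> = der K d (T x \<alpha>) \<oplus> formal_deriv K d (T x) \<alpha>" if x: "x \<in> A" for d x \<alpha>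
  proof -
    obtain ds where ds: "\<alpha> = mset ds" by (metis ex_mset)
    have cl: "nab ds x \<in> carrier K" "nab (d # ds) x \<in> carrier K" "nab ds (der K d x) \<in> carrier K"
      using nabK x der_A by auto
    have "formal_deriv K d (T x) \<alpha> = add_pow K (Suc (count \<alpha> d)) (c (add_mset d \<alpha>) \<otimes> nab (d # ds) x)"
      using T[OF x, of "d # ds"] by (simp add: formal_deriv_def ds del: add.nat_pow_Suc)
    also have "\<dots> = c \<alpha> \<otimes> nab (d # ds) x"
      using add_pow_ldistr[OF cK cl(2)] c_add by (metis)
    also have "\<dots> = c \<alpha> \<otimes> nab ds (der K d x) \<ominus> c \<alpha> \<otimes> der K d (nab ds x)"
      unfolding nab_Cons using cl cK der_closed by (simp add: a_minus_def r_distr r_minus)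
    finally have 1: "formal_deriv K d (T x) \<alpha> =
        c \<alpha> \<otimes> nab ds (der K d x) \<ominus> c \<alpha> \<otimes> der K d (nab ds x)" .
    have 2: "der K d (T x \<alpha>) = c \<alpha> \<otimes> der K d (nab ds x)"
      unfolding ds T[OF x] using cK cl der_closed by (simp add: der_mult der_c)
    show ?thesis
      unfolding 1 2 unfolding ds T[OF der_A[OF x]] using cK cl der_closed
      by (intro add_minus_cancel) auto
  qed
  have Tempty: "T x {#} = \<psi> x" if "x \<in> A" for x
    using T[OF that, of "[]"] \<psi>F[OF that] FK by (auto simp: c_empty nab_Nil)
  have nab_add: "nab ds (x \<oplus> y) = nab ds x \<oplus> nab ds y" if "x \<in> A" "y \<in> A" for ds x y
    using that
  proof (induction ds arbitrary: x y)
    case Nil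
    then show ?case using \<psi> by (simp add: nab_Nil retraction_def)
  next
    case (Cons d ds)
    have cl: "nab ds x \<in> carrier K" "nab ds y \<in> carrier K" "nab ds (der K d x) \<in> carrier K"
       "nab ds (der K d y) \<in> carrier K" using nabK der_A Cons.prems by auto
    have xy: "x \<in> carrier K" "y \<in> carrier K" using Cons.prems AK by auto
    have "nab (d # ds) (x \<oplus> y) = (nab ds (der K d x) \<oplus> nab ds (der K d y)) \<ominus>
        (der K d (nab ds x) \<oplus> der K d (nab ds y))"
      unfolding nab_Cons der_add[OF xy]
      using Cons.IH[OF Cons.prems] Cons.IH[OF der_A[OF Cons.prems(1)] der_A[OF Cons.prems(2)]] cl
      by (simp add: der_add)
    then show ?case unfolding nab_Cons using cl der_closed by (simp add: a_minus_def minus_add a_ac)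
  qed
  have Tadd: "T (x \<oplus> y) \<alpha> = T x \<alpha> \<oplus> T y \<alpha>" if "x \<in> A" "y \<in> A" for x y \<alpha>
    unfolding T_def nab_add[OF that] using cK nabK that by (simp add: r_distr)
  \<comment> \<open>\<open>Tder\<close> for the product, the Leibniz rules and the induction
    hypothesis for the pairs \<open>(der K d x, y)\<close>, \<open>(x, der K d y)\<close> and
    \<open>(x, y)\<close> show that \<open>Suc (count \<alpha> d)\<close> times both sides agree at
    \<open>add_mset d \<alpha>\<close>. Characteristic 0 cancels the integer.\<close>
  have Tmult: "T (x \<otimes> y) \<alpha> = series_mult K (T x) (T y) \<alpha>" if "x \<in> A" "y \<in> A" for x y \<alpha>
    using that
  proof (induction \<alpha> arbitrary: x y)
    case empty
    have "{k. k \<subseteq># ({#} :: 'm multiset)} = {{#}}" by auto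
    moreover have "\<psi> x \<in> carrier K" "\<psi> y \<in> carrier K" using \<psi>F empty FK by auto
    ultimately show ?case
      using empty \<psi> subringE(6)[OF A] by (simp add: series_mult_def Tempty retraction_def)
  next
    case (add d \<alpha>)
    note xy = add.prems
    have dxy: "der K d x \<in> A" "der K d y \<in> A" using xy der_A by auto
    have p: "x \<otimes> y \<in> A" "der K d x \<otimes> y \<in> A" "x \<otimes> der K d y \<in> A"
      using subringE(6)[OF A] xy dxy by auto
    have Kxy: "x \<in> carrier K" "y \<in> carrier K" using xy AK by auto
    note c = TK[OF xy(1)] TK[OF xy(2)] TK[OF dxy(1)] TK[OF dxy(2)]
    have fc: "formal_deriv K d (T x) m \<in> carrier K" "formal_deriv K d (T y) m \<in> carrier K" for m
      unfolding formal_deriv_def using c by auto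
    let ?S = "series_mult K"
    have e: "T (der K d x) = indexed_padd (\<lambda>m. der K d (T x m)) (formal_deriv K d (T x))"
      "T (der K d y) = indexed_padd (\<lambda>m. der K d (T y m)) (formal_deriv K d (T y))"
      using Tder xy by (auto simp: indexed_padd_def)
    have indexed_padd_closed: "indexed_padd p q m \<in> carrier K"
      if "\<And>m. p m \<in> carrier K" "\<And>m. q m \<in> carrier K" for p q :: "'m multiset \<Rightarrow> 'a" and m
      using that by (simp add: indexed_padd_def)
    have dc: "der K d (T x m) \<in> carrier K" "der K d (T y m) \<in> carrier K" for m
      using c der_closed by auto
    have s1: "?S (T (der K d x)) (T y) \<alpha> = ?S (\<lambda>m. der K d (T x m)) (T y) \<alpha> \<oplus>
        ?S (formal_deriv K d (T x)) (T y) \<alpha>"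
      unfolding e(1) using dc fc c
      by (subst (1 2 3) series_mult_comm)
        (auto simp: series_mult_padd indexed_padd_def[of "series_mult K _ _"]
          intro!: indexed_padd_closed)
    have s2: "?S (T x) (T (der K d y)) \<alpha> = ?S (T x) (\<lambda>m. der K d (T y m)) \<alpha> \<oplus>
        ?S (T x) (formal_deriv K d (T y)) \<alpha>"
      unfolding e(2) using dc fc c by (auto simp: series_mult_padd indexed_padd_def[of "series_mult K _ _"])
    have cl: "?S (\<lambda>m. der K d (T x m)) (T y) \<alpha> \<in> carrier K"
      "?S (formal_deriv K d (T x)) (T y) \<alpha> \<in> carrier K"
      "?S (T x) (\<lambda>m. der K d (T y m)) \<alpha> \<in> carrier K"
      "?S (T x) (formal_deriv K d (T y)) \<alpha> \<in> carrier K" "?S (T x) (T y) (add_mset d \<alpha>) \<in> carrier K"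
      using dc fc c by (auto intro!: series_mult_closed)
    have "T (der K d (x \<otimes> y)) \<alpha> = ?S (T (der K d x)) (T y) \<alpha> \<oplus> ?S (T x) (T (der K d y)) \<alpha>"
      using Kxy p by (simp add: der_mult Tadd add.IH xy dxy)
    also have "\<dots> = (?S (\<lambda>m. der K d (T x m)) (T y) \<alpha> \<oplus> ?S (T x) (\<lambda>m. der K d (T y m)) \<alpha>) \<oplus>
        (?S (formal_deriv K d (T x)) (T y) \<alpha> \<oplus> ?S (T x) (formal_deriv K d (T y)) \<alpha>)"
      unfolding s1 s2 using cl by (simp add: a_ac)
    also have "\<dots> = der K d (?S (T x) (T y) \<alpha>) \<oplus> formal_deriv K d (?S (T x) (T y)) \<alpha>"
      using der_series_mult[of "T x" "T y"] formal_deriv_series_mult[of "T x" "T y"] c by simp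
    finally have "der K d (?S (T x) (T y) \<alpha>) \<oplus> formal_deriv K d (T (x \<otimes> y)) \<alpha> =
        der K d (?S (T x) (T y) \<alpha>) \<oplus> formal_deriv K d (?S (T x) (T y)) \<alpha>"
      using Tder[OF p(1), of d \<alpha>] add.IH[OF xy] by simp
    moreover have "der K d (?S (T x) (T y) \<alpha>) \<in> carrier K"
      using c by (intro der_closed series_mult_closed)
    moreover have "formal_deriv K d (T (x \<otimes> y)) \<alpha> \<in> carrier K"
      "formal_deriv K d (?S (T x) (T y)) \<alpha> \<in> carrier K"
      unfolding formal_deriv_def using TK[OF p(1)] cl(5) by auto
    ultimately have "formal_deriv K d (T (x \<otimes> y)) \<alpha> = formal_deriv K d (?S (T x) (T y)) \<alpha>"
      by (simp del: add.nat_pow_Suc)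
    then show ?case
      unfolding formal_deriv_def
      by (rule add_pow_cancel) (use TK[OF p(1)] cl(5) in auto)
  qed
  \<comment> \<open>On \<open>F\<close> the map \<open>\<psi>\<close> is the identity and commutes
    with the derivations, so the first twist vanishes there, and with it all further ones.\<close>
  have TconstF: "nab ds x = \<zero>" if "x \<in> F" "ds \<noteq> []" for ds x
    using that
  proof (induction ds arbitrary: x)
    case (Cons d ds)
    have "x \<in> A" "der K d x \<in> A" using Cons.prems FA der_F by auto
    show ?case
    proof (cases "ds = []")
      case True
      then show ?thesis
        using \<psi> Cons.prems(1) der_F[OF Cons.prems(1), of d] FK der_closed
        by (auto simp: nab_Cons nab_Nil retraction_def a_minus_def r_neg subsetD)
    next
      case False
      then show ?thesis using Cons.IH Cons.prems der_F by (simp add: nab_Cons a_minus_def)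
    qed
  qed simp
  have Tconst: "T x = indexed_const x" if "x \<in> F" for x
  proof
    fix \<alpha> :: "'m multiset"
    obtain ds where ds: "\<alpha> = mset ds" by (metis ex_mset)
    have "x \<in> A" using that FA by blast
    then show "T x \<alpha> = indexed_const x \<alpha>"
      using Tempty[of x] T[of x ds] TconstF[OF that, of ds] \<psi> cK that unfolding ds
      by (cases "ds = []") (auto simp: indexed_const_def retraction_def)
  qed
  show thesis
    by (rule that[of T]) (use TF Tconst Tadd Tmult Tder in \<open>auto simp: indexed_padd_def\<close>)
qed

end

section \<open>Transfer of differential solutions\<close>

lemma differential_embeddingD:
  assumes "differential_embedding h R S"
  shows "h \<in> ring_hom R S" "inj_on h (carrier R)" "\<And>d x. x \<in> carrier R \<Longrightarrow> h (der R d x) = der S d (h x)"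
    "\<And>x. x \<in> carrier R \<Longrightarrow> h x \<in> carrier S"
  using assms unfolding differential_embedding_def differential_hom_def
  by (auto intro: ring_hom_closed)

text \<open>The composite A -> K[[t]] -> M -> L of the twisted Taylor morphism,
  \<open>\<phi>\<close> and \<open>e\<close> is a differential homomorphism that fixes the image of
  \<open>K\<close>. It maps a solution of a system over \<open>K\<close> to a solution with entries
  in the image of \<open>M\<close>.\<close>

theorem differential_solution_transfer:
  fixes L :: "('b, 'm::finite, 'z) diff_ring_scheme"
    and K :: "('a, 'm, 'y) diff_ring_scheme"
    and M :: "('c, 'm, 'x) diff_ring_scheme"
  assumes L: "differential_field L" and K: "differential_field K" and M: "differential_field M"
    and g: "differential_embedding g K L" and ec: "ec_as_field (g ` carrier K) L"
    and \<phi>: "differential_hom \<phi> (power_series_ring K) M"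
    and e: "differential_embedding e M L"
    and e\<phi>: "\<And>x. x \<in> carrier K \<Longrightarrow> e (\<phi> (ring.indexed_const K x)) = g x"
    and S: "S \<subseteq> ring.indexed_pset L ({..<n} \<times> UNIV) (g ` carrier K)"
    and a: "a \<in> {..<n} \<rightarrow> carrier L" "\<And>p. p \<in> S \<Longrightarrow> diff_poly_eval L a p = \<zero>\<^bsub>L\<^esub>"
  shows "\<exists>b\<in>{..<n} \<rightarrow> e ` carrier M. \<forall>p\<in>S. diff_poly_eval L b p = \<zero>\<^bsub>L\<^esub>"
proof -
  interpret L: differential_field L by fact
  interpret K: differential_field K by fact
  interpret M: differential_field M by fact
  note gD = differential_embeddingD[OF g] and eD = differential_embeddingD[OF e]
  interpret g: ring_hom_cring K L g by unfold_locales (rule gD(1))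
  interpret e: ring_hom_cring M L e by unfold_locales (rule eD(1))
  let ?F = "g ` carrier K"
  let ?P = "power_series_ring K"
  have F: "subfield ?F L" using ec by (simp add: ec_as_field_def)
  note Fr = subfieldE(1)[OF F] and FL = subfieldE(3)[OF F]
  have der_F: "der L d x \<in> ?F" if "x \<in> ?F" for d x
    using that gD(3)[symmetric] K.der_closed by auto
  let ?H = "?F \<union> {higher_der L \<alpha> (a j) | j \<alpha>. j < n}"
  define A where "A = generate_ring L ?H"
  have aL: "a j \<in> carrier L" if "j < n" for j using a(1) that by auto
  obtain \<psi> where \<psi>: "L.retraction A ?F \<psi>"
    unfolding A_def by (rule L.algebraic_point[where a = a and n = n, OF ec]) (rule der_F aL that, assumption)+
  have HL: "?H \<subseteq> carrier L" using FL aL L.higher_der_closed by auto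
  have A: "subring A L" unfolding A_def by (rule L.generate_ring_is_subring[OF HL])
  note AL = subringE(1)[OF A]
  have FA: "?F \<subseteq> A" by (auto simp: A_def intro: generate_ring.incl)
  have der_A: "der L d x \<in> A" if "x \<in> A" for d x
    unfolding A_def
  proof (rule L.der_generate_ring[OF HL HL _ _ that[unfolded A_def]])
    fix h assume "h \<in> ?H"
    then consider "h \<in> ?F" | j \<alpha> where "j < n" "h = higher_der L \<alpha> (a j)" by auto
    then have "der L d h \<in> ?H"
    proof cases
      case 1
      then show ?thesis using der_F by blast
    next
      case 2
      then have "der L d h = higher_der L (add_mset d \<alpha>) (a j)"
        using aL by (simp add: L.higher_der_add_mset)
      then show ?thesis using 2(1) by blast
    qed
    then show "der L d h \<in> generate_ring L ?H" by (rule generate_ring.incl)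
  qed (auto intro: generate_ring.incl)
  obtain T :: "'b \<Rightarrow> 'm multiset \<Rightarrow> 'b" where T:
    "\<And>x \<alpha>. x \<in> A \<Longrightarrow> T x \<alpha> \<in> ?F" "\<And>x. x \<in> ?F \<Longrightarrow> T x = L.indexed_const x"
    "\<And>x y. x \<in> A \<Longrightarrow> y \<in> A \<Longrightarrow> T (x \<oplus>\<^bsub>L\<^esub> y) = L.indexed_padd (T x) (T y)"
    "\<And>x y. x \<in> A \<Longrightarrow> y \<in> A \<Longrightarrow> T (x \<otimes>\<^bsub>L\<^esub> y) = series_mult L (T x) (T y)"
    "\<And>d x \<alpha>. x \<in> A \<Longrightarrow> T (der L d x) \<alpha> = der L d (T x \<alpha>) \<oplus>\<^bsub>L\<^esub> formal_deriv L d (T x) \<alpha>"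
    by (rule L.twisted_taylor[OF F _ A FA _ \<psi>]) (rule der_F der_A that, assumption+)+
  \<comment> \<open>The Taylor coefficients lie in the image of \<open>g\<close>; pulled back along
    \<open>g\<close> they form a series over \<open>K\<close>, to which \<open>\<phi>\<close>
    applies.\<close>
  define U where "U x = (\<lambda>\<alpha>. inv_into (carrier K) g (T x \<alpha>))" for x
  have UK: "U x \<alpha> \<in> carrier K" and gU': "g (U x \<alpha>) = T x \<alpha>" if "x \<in> A" for x \<alpha>
    using T(1)[OF that] unfolding U_def by (auto intro: inv_into_into f_inv_into_f)
  have gU: "g \<circ> U x = T x" if "x \<in> A" for x using gU'[OF that] by auto
  have gcancel: "p = q" if "g \<circ> p = g \<circ> q" "\<And>\<alpha>. p \<alpha> \<in> carrier K" "\<And>\<alpha>. q \<alpha> \<in> carrier K"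
    for p q :: "'m multiset \<Rightarrow> 'a"
    using that gD(2) by (metis comp_eq_dest ext inj_onD)
  have sumA: "x \<oplus>\<^bsub>L\<^esub> y \<in> A" "x \<otimes>\<^bsub>L\<^esub> y \<in> A" if "x \<in> A" "y \<in> A" for x y
    using that subringE(6,7)[OF A] by auto
  have Uadd: "U (x \<oplus>\<^bsub>L\<^esub> y) = K.indexed_padd (U x) (U y)" if "x \<in> A" "y \<in> A" for x y
    by (rule gcancel)
      (use that UK sumA gU T(3) g.map_indexed_padd[of "U x" "U y"] in \<open>simp_all add: K.indexed_padd_def\<close>)
  have Umult: "U (x \<otimes>\<^bsub>L\<^esub> y) = series_mult K (U x) (U y)" if "x \<in> A" "y \<in> A" for x y
    by (rule gcancel)
      (use that UK sumA gU T(4) g.map_series_mult[of "U x" "U y"] 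
      K.series_mult_closed[of "U x" "U y"] in simp_all)
  have Uder: "U (der L d x) = (\<lambda>\<alpha>. der K d (U x \<alpha>) \<oplus>\<^bsub>K\<^esub> formal_deriv K d (U x) \<alpha>)"
    if x: "x \<in> A" for d x
  proof (rule gcancel)
    have fc: "formal_deriv K d (U x) \<alpha> \<in> carrier K" for \<alpha>
      unfolding formal_deriv_def using UK[OF x] by simp
    have "g (formal_deriv K d (U x) \<alpha>) = formal_deriv L d (T x) \<alpha>" for \<alpha>
      using g.map_formal_deriv[of "U x" d] UK[OF x] gU[OF x] by (metis comp_apply)
    then have "g (der K d (U x \<alpha>) \<oplus>\<^bsub>K\<^esub> formal_deriv K d (U x) \<alpha>) = T (der L d x) \<alpha>" for \<alpha>
      using UK[OF x] fc K.der_closed gD(3) gU'[OF x] T(5)[OF x] by simp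
    then show "g \<circ> U (der L d x) = g \<circ> (\<lambda>\<alpha>. der K d (U x \<alpha>) \<oplus>\<^bsub>K\<^esub> formal_deriv K d (U x) \<alpha>)"
      unfolding gU[OF der_A[OF x]] by auto
    show "der K d (U x \<alpha>) \<oplus>\<^bsub>K\<^esub> formal_deriv K d (U x) \<alpha> \<in> carrier K" for \<alpha>
      using UK[OF x] fc K.der_closed by simp
  qed (use UK der_A x in blast)
  have Uconst: "U (g x) = K.indexed_const x" if "x \<in> carrier K" for x
  proof (rule gcancel)
    have "g x \<in> ?F" "g x \<in> A" using that FA by auto
    then show "g \<circ> U (g x) = g \<circ> K.indexed_const x"
      using gU T(2) by (simp add: g.map_indexed_const)
    show "U (g x) \<alpha> \<in> carrier K" for \<alpha> using UK \<open>g x \<in> A\<close> by blast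
  qed (use that in \<open>simp add: K.indexed_const_def\<close>)
  have \<phi>h: "\<phi> \<in> ring_hom ?P M" and \<phi>d: "\<And>d x. x \<in> carrier ?P \<Longrightarrow> \<phi> (der ?P d x) = der M d (\<phi> x)"
    using \<phi> by (auto simp: differential_hom_def)
  have UP: "U x \<in> carrier ?P" if "x \<in> A" for x using UK[OF that] by (auto simp: power_series_ring_def)
  have \<phi>M: "\<phi> (U x) \<in> carrier M" if "x \<in> A" for x using ring_hom_closed[OF \<phi>h UP[OF that]] .
  define \<chi> where "\<chi> x = e (\<phi> (U x))" for x
  have \<chi>e: "\<chi> x \<in> e ` carrier M" if "x \<in> A" for x using \<phi>M[OF that] by (simp add: \<chi>_def)
  have \<chi>add: "\<chi> (x \<oplus>\<^bsub>L\<^esub> y) = \<chi> x \<oplus>\<^bsub>L\<^esub> \<chi> y" if "x \<in> A" "y \<in> A" for x y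
    using ring_hom_add[OF \<phi>h UP[OF that(1)] UP[OF that(2)]] \<phi>M that
    by (simp add: \<chi>_def Uadd power_series_ring_def)
  have \<chi>mult: "\<chi> (x \<otimes>\<^bsub>L\<^esub> y) = \<chi> x \<otimes>\<^bsub>L\<^esub> \<chi> y" if "x \<in> A" "y \<in> A" for x y
    using ring_hom_mult[OF \<phi>h UP[OF that(1)] UP[OF that(2)]] \<phi>M that
    by (simp add: \<chi>_def Umult power_series_ring_def)
  have \<chi>der: "\<chi> (der L d x) = der L d (\<chi> x)" if "x \<in> A" for d x
    using \<phi>d[OF UP[OF that], of d] eD(3) \<phi>M[OF that] that
    by (simp add: \<chi>_def Uder power_series_ring_def)
  have \<chi>F: "\<chi> x = x" if "x \<in> ?F" for x
    using that e\<phi> by (auto simp: \<chi>_def Uconst)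
  have \<chi>L: "\<chi> x \<in> carrier L" if "x \<in> A" for x using \<chi>e[OF that] eD(4) by auto
  have aA: "higher_der L \<alpha> (a j) \<in> A" if "j < n" for j \<alpha>
    using that unfolding A_def by (auto intro: generate_ring.incl)
  have aA0: "a j \<in> A" if "j < n" for j using aA[OF that, of "{#}"] aL[OF that] by simp
  have \<chi>hd: "\<chi> (higher_der L \<alpha> (a j)) = higher_der L \<alpha> (\<chi> (a j))" if "j < n" for j \<alpha>
  proof (induction \<alpha>)
    case empty
    then show ?case using aL[OF that] \<chi>L[OF aA0[OF that]] by simp
  next
    case (add d \<alpha>)
    then show ?case
      using aL[OF that] \<chi>L[OF aA0[OF that]] \<chi>der[OF aA[OF that]] by (simp add: L.higher_der_add_mset)
  qed
  let ?V = "{..<n} \<times> (UNIV :: 'm multiset set)"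
  let ?a = "\<lambda>(j, \<alpha>). higher_der L \<alpha> (a j)" and ?b = "\<lambda>(j, \<alpha>). higher_der L \<alpha> (\<chi> (a j))"
  have aV: "?a \<in> ?V \<rightarrow> A" and aVL: "?a \<in> ?V \<rightarrow> carrier L" using aA AL by auto
  have bVL: "?b \<in> ?V \<rightarrow> carrier L" using \<chi>L[OF aA0] L.higher_der_closed by auto
  \<comment> \<open>\<open>\<chi>\<close> fixes the coefficients and commutes with higher
    derivatives, so evaluating at the images amounts to applying \<open>\<chi>\<close> to the
    value.\<close>
  have ev: "mpoly_eval L ?b p = \<chi> (mpoly_eval L ?a p)" if "p \<in> L.indexed_pset ?V ?F" for p
    using that
  proof induction
    case (indexed_const k)
    then have "k \<in> carrier L" using FL by blast
    then show ?case using \<chi>F[OF indexed_const] by simp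
  next
    case (indexed_padd p q)
    then show ?case
      using L.mpoly_eval_padd[OF indexed_padd.hyps FL aVL] L.mpoly_eval_padd[OF indexed_padd.hyps FL bVL]
        L.mpoly_eval_in_subring[OF indexed_padd.hyps(1) A FA aV]
        L.mpoly_eval_in_subring[OF indexed_padd.hyps(2) A FA aV] by (simp add: \<chi>add)
  next
    case (indexed_pmult p v)
    have "?a v \<in> A" "?b v = \<chi> (?a v)" using indexed_pmult(2) aA \<chi>hd by auto
    then show ?case
      using indexed_pmult.IH L.mpoly_eval_pmult[OF indexed_pmult.hyps(1) FL aVL indexed_pmult.hyps(2)]
        L.mpoly_eval_pmult[OF indexed_pmult.hyps(1) FL bVL indexed_pmult.hyps(2)]
        L.mpoly_eval_in_subring[OF indexed_pmult.hyps(1) A FA aV] by (simp only: \<chi>mult)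
  qed
  have "\<chi> \<zero>\<^bsub>L\<^esub> = \<zero>\<^bsub>L\<^esub>" using \<chi>F subringE(2)[OF Fr] by blast
  then show ?thesis
    using ev S a(2) \<chi>e[OF aA0] unfolding diff_poly_eval_def
    by (intro bexI[of _ "\<lambda>j. \<chi> (a j)"]) (auto simp: subset_iff)
qed

section \<open>Extension of scalars for polynomial ideals\<close>

context cring
begin

text \<open>Links ideals of the ring of polynomials with \<open>poly_ideal\<close>, the form in
  which the basis theorem and extension of scalars are expressed.\<close>

lemma ideal_imp_poly_ideal:
  assumes "ideal J (mpoly_ring R V)"
  shows "poly_ideal V (carrier R) J"
proof -
  interpret J: ideal J "mpoly_ring R V" by fact
  have sub: "J \<subseteq> indexed_pset V (carrier R)" using J.a_subset by (simp add: mpoly_ring_simps)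
  have c: "p m \<in> carrier R" if "p \<in> J" for p m using sub that indexed_pset_coeff by blast
  have mult: "series_mult R p q \<in> J" if "p \<in> J" "q \<in> indexed_pset V (carrier R)" for p q
    using J.I_r_closed[of p q] that by (simp add: mpoly_ring_simps)
  have 1: "(\<lambda>m. k \<otimes> p m) \<in> J" if "k \<in> carrier R" "p \<in> J" for k p
  proof -
    have "(\<lambda>m. k \<otimes> p m) = series_mult R p (indexed_const k)"
      using series_mult_const[of p k] c that by (auto simp: m_comm)
    then show ?thesis using mult[OF that(2) indexed_pset.indexed_const[OF that(1)]] by simp
  qed
  have 2: "indexed_pmult p i \<in> J" if "i \<in> V" "p \<in> J" for i p
  proof -
    have "indexed_const \<one> m \<in> carrier R" for m :: "'c multiset" by (simp add: indexed_const_def)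
    then have "series_mult R p (indexed_pmult (indexed_const \<one>) i) = indexed_pmult p i"
      using series_mult_pmult[of p "indexed_const \<one>" i] series_mult_const[of p \<one>] c[OF that(2)] by simp
    then show ?thesis
      using mult[OF that(2) indexed_pset.indexed_pmult[OF indexed_pset.indexed_const that(1)], of \<one>] by simp
  qed
  show ?thesis
    unfolding poly_ideal_def
    using sub 1 2 additive_subgroup.zero_closed[OF ideal.axioms(1)[OF assms]]
      additive_subgroup.a_closed[OF ideal.axioms(1)[OF assms]]
    by (auto simp: mpoly_ring_simps)
qed

lemma poly_ideal_imp_ideal:
  assumes "poly_ideal V (carrier R) J"
  shows "ideal J (mpoly_ring R V)"
proof -
  interpret M: cring "mpoly_ring R V" by (rule mpoly_ring_cring)
  note JD = poly_idealD[OF assms]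
  have c: "p m \<in> carrier R" if "p \<in> J" for p m using JD(1) that indexed_pset_coeff by blast
  have mult: "series_mult R p q \<in> J" if "p \<in> J" "q \<in> indexed_pset V (carrier R)" for p q
    using that(2)
  proof induction
    case (indexed_const k)
    have "series_mult R p (indexed_const k) = (\<lambda>m. k \<otimes> p m)"
      using series_mult_const[of p k] c that(1) indexed_const by (auto simp: m_comm)
    then show ?case using JD(4)[OF indexed_const that(1)] by simp
  next
    case (indexed_padd q r)
    then have "q m \<in> carrier R" "r m \<in> carrier R" for m using indexed_pset_coeff by blast+
    then show ?case using series_mult_padd[of p q r] c[OF that(1)] indexed_padd.IH JD(3) by simp
  next
    case (indexed_pmult q i)
    then have "q m \<in> carrier R" for m using indexed_pset_coeff by blast
    then show ?case using series_mult_pmult[of p q i] c[OF that(1)] indexed_pmult JD(5) by simp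
  qed
  have rc: "a \<otimes>\<^bsub>mpoly_ring R V\<^esub> x \<in> J" if "a \<in> J" "x \<in> carrier (mpoly_ring R V)" for a x
    using mult that by (simp add: mpoly_ring_simps)
  have JM: "J \<subseteq> carrier (mpoly_ring R V)" using JD(1) by (simp add: mpoly_ring_simps)
  show ?thesis
  proof (rule idealI[OF M.ring_axioms])
    show "subgroup J (add_monoid (mpoly_ring R V))"
    proof (rule M.add.subgroupI)
      show "J \<noteq> {}" using JD(2) by blast
      show "\<ominus>\<^bsub>mpoly_ring R V\<^esub> x \<in> J" if "x \<in> J" for x
      proof -
        have "\<ominus>\<^bsub>mpoly_ring R V\<^esub> x = x \<otimes>\<^bsub>mpoly_ring R V\<^esub> (\<ominus>\<^bsub>mpoly_ring R V\<^esub> \<one>\<^bsub>mpoly_ring R V\<^esub>)"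
          using that JM by (auto simp: M.r_minus)
        then show ?thesis using rc[OF that] by simp
      qed
    qed (use JM JD(3) in \<open>auto simp: mpoly_ring_simps\<close>)
    show "x \<otimes>\<^bsub>mpoly_ring R V\<^esub> a \<in> J" if "a \<in> J" "x \<in> carrier (mpoly_ring R V)" for a x
      using rc[OF that] M.m_comm[of x a] that JM by auto
  qed (use rc in auto)
qed

text \<open>This and the next identity are the bookkeeping of
  \<open>not_extension_retraction\<close>, where a relation scaled by \<open>u\<close> is subtracted
  in order to remove a term.\<close>

lemma diff_mult_add_diff:
  assumes "a \<in> carrier R" "b \<in> carrier R" "c \<in> carrier R" "d \<in> carrier R" "e \<in> carrier R" "u \<in> carrier R"
  shows "(a \<ominus> u \<otimes> b) \<otimes> c \<oplus> (d \<ominus> u \<otimes> e) = (a \<otimes> c \<oplus> d) \<ominus> u \<otimes> (b \<otimes> c \<oplus> e)"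
  using assms by algebra

lemma add_mult_cancel:
  assumes "a \<in> carrier R" "b \<in> carrier R" "c \<in> carrier R" "d \<in> carrier R" "e \<in> carrier R" "u \<in> carrier R"
  shows "(a \<ominus> u \<otimes> b) \<oplus> ((c \<oplus> (d \<oplus> u \<otimes> b \<oplus> u \<otimes> e)) \<oplus> (\<ominus> u) \<otimes> e) = d \<oplus> a \<oplus> c"
  using assms by algebra

text \<open>Membership of the sum in \<open>A\<close> is carried along because \<open>\<rho>\<close>
  is known to be additive on \<open>A\<close> only.\<close>

lemma retraction_finsum:
  assumes \<rho>: "retraction A F \<rho>" and A: "subring A R" and F: "subring F R"
    and g: "\<And>x. x \<in> B \<Longrightarrow> g x \<in> A"
  shows "\<rho> (\<Oplus>x\<in>B. g x) = (\<Oplus>x\<in>B. \<rho> (g x)) \<and> (\<Oplus>x\<in>B. g x) \<in> A"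
proof -
  note AR = subringE(1)[OF A] and FR = subringE(1)[OF F]
  have z: "\<rho> \<zero> = \<zero>" using \<rho> subringE(2)[OF F] by (auto simp: retraction_def)
  have \<rho>R: "\<rho> x \<in> carrier R" if "x \<in> A" for x using \<rho> that FR by (auto simp: retraction_def)
  show ?thesis
    using g
  proof (induction B rule: infinite_finite_induct)
    case (insert x B)
    have gA: "g \<in> B \<rightarrow> carrier R" "g x \<in> carrier R" "(\<lambda>x. \<rho> (g x)) \<in> B \<rightarrow> carrier R" "\<rho> (g x) \<in> carrier R"
      using insert.prems AR \<rho>R by auto
    have IH: "\<rho> (\<Oplus>x\<in>B. g x) = (\<Oplus>x\<in>B. \<rho> (g x))" "(\<Oplus>x\<in>B. g x) \<in> A" using insert by auto
    have "\<rho> (g x \<oplus> (\<Oplus>x\<in>B. g x)) = \<rho> (g x) \<oplus> \<rho> (\<Oplus>x\<in>B. g x)"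
      using \<rho> IH(2) insert.prems by (simp add: retraction_def)
    then show ?case
      using insert gA IH subringE(7)[OF A]
      by (subst (1 2 3) finsum_insert) auto
  qed (use z subringE(2)[OF A] in auto)
qed

lemma retraction_series_mult:
  assumes \<rho>: "retraction A F \<rho>" and A: "subring A R" and F: "subring F R"
    and p: "\<And>m. p m \<in> A" and q: "\<And>m. q m \<in> A"
  shows "\<rho> \<circ> series_mult R p q = series_mult R (\<rho> \<circ> p) (\<rho> \<circ> q)"
proof
  fix m
  have "\<rho> (p k \<otimes> q (m - k)) = \<rho> (p k) \<otimes> \<rho> (q (m - k))" for k
    using \<rho> p q by (simp add: retraction_def)
  moreover have "p k \<otimes> q (m - k) \<in> A" for k using subringE(6)[OF A] p q by simp
  ultimately show "(\<rho> \<circ> series_mult R p q) m = series_mult R (\<rho> \<circ> p) (\<rho> \<circ> q) m"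
    unfolding series_mult_def
    using retraction_finsum[OF \<rho> A F, of "{k. k \<subseteq># m}" "\<lambda>k. p k \<otimes> q (m - k)"] by simp
qed

end

text \<open>An embedding instead of an inclusion, because a member of the directed system and the
  limit have different types.\<close>

locale ec_embedding = ring_hom_cring R S h + R?: field R + S?: field S
  for R (structure) and S (structure) and h +
  assumes ec: "ec_as_field (h ` carrier R) S"
begin

lemma image_subfield: "subfield (h ` carrier R) S"
  using ec by (simp add: ec_as_field_def)

lemmas image_subring = subfieldE(1)[OF image_subfield]
lemmas image_subset = subfieldE(3)[OF image_subfield]

lemma inj: "inj_on h (carrier R)"
  by (rule non_trivial_field_hom_is_inj[OF homh R.field_axioms S.field_axioms])

lemma map_cancel:
  assumes "h \<circ> p = h \<circ> q" "\<And>m. p m \<in> carrier R" "\<And>m. q m \<in> carrier R"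
  shows "p = q"
  using assms inj by (metis comp_eq_dest ext inj_onD)

abbreviation polyR :: "'v set \<Rightarrow> ('v multiset \<Rightarrow> 'a) set"
  where "polyR V \<equiv> R.indexed_pset V (carrier R)"

abbreviation polyS :: "'v set \<Rightarrow> ('v multiset \<Rightarrow> 'c) set"
  where "polyS V \<equiv> S.indexed_pset V (carrier S)"

text \<open>For an ideal \<open>C\<close>, the ideal generated by its image over \<open>S\<close>.
  Scalars from \<open>S\<close> suffice as multipliers, since \<open>C\<close> is already closed
  under multiplication by variables.\<close>

inductive_set extension :: "('v multiset \<Rightarrow> 'a) set \<Rightarrow> ('v multiset \<Rightarrow> 'c) set"
  for C where
    zero: "(\<lambda>m. \<zero>\<^bsub>S\<^esub>) \<in> extension C"
  | step: "\<lbrakk>q \<in> extension C; c \<in> C; l \<in> carrier S\<rbrakk> \<Longrightarrow>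
      (\<lambda>m. q m \<oplus>\<^bsub>S\<^esub> l \<otimes>\<^bsub>S\<^esub> h (c m)) \<in> extension C"

lemma map_coeff: "c \<in> polyR V \<Longrightarrow> h (c m) \<in> carrier S"
  using R.indexed_pset_coeff by blast

lemma scaled_map_polyS:
  assumes "c \<in> polyR V" "l \<in> carrier S"
  shows "(\<lambda>m. l \<otimes>\<^bsub>S\<^esub> h (c m)) \<in> polyS V"
proof -
  have "h \<circ> c \<in> polyS V" by (rule map_indexed_pset_carrier[OF assms(1)])
  moreover have "series_mult S (h \<circ> c) (S.indexed_const l) = (\<lambda>m. l \<otimes>\<^bsub>S\<^esub> h (c m))"
    using S.series_mult_const[of "h \<circ> c" l] map_coeff[OF assms(1)] assms(2) by (auto simp: S.m_comm)
  ultimately show ?thesis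
    using S.series_mult_indexed_pset[OF _ S.indexed_pset.indexed_const[OF assms(2)] S.carrier_is_subring]
    by metis
qed

lemma extension_polyS:
  assumes "q \<in> extension C" "C \<subseteq> polyR V"
  shows "q \<in> polyS V"
  using assms(1)
proof induction
  case zero
  then show ?case using S.indexed_pset.indexed_const[of "\<zero>\<^bsub>S\<^esub>" "carrier S" V]
    by (simp add: S.indexed_zero_def)
next
  case (step q c l)
  then show ?case
    using S.indexed_pset.indexed_padd[OF step.IH scaled_map_polyS[of c V l]] assms(2)
    by (auto simp: S.indexed_padd_def)
qed

lemma extension_coeff: "q \<in> extension C \<Longrightarrow> C \<subseteq> polyR V \<Longrightarrow> q m \<in> carrier S"
  using extension_polyS S.indexed_pset_coeff by blast

lemma extension_add:
  assumes "q \<in> extension C" "r \<in> extension C" "C \<subseteq> polyR V"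
  shows "(\<lambda>m. q m \<oplus>\<^bsub>S\<^esub> r m) \<in> extension C"
  using assms(2)
proof induction
  case zero
  then show ?case using assms(1) extension_coeff[OF assms(1,3)] by simp
next
  case (step r c l)
  have "(\<lambda>m. (q m \<oplus>\<^bsub>S\<^esub> r m) \<oplus>\<^bsub>S\<^esub> l \<otimes>\<^bsub>S\<^esub> h (c m)) \<in> extension C"
    by (rule extension.step[OF step.IH step.hyps(2,3)])
  moreover have "c \<in> polyR V" using step assms(3) by blast
  then have "(q m \<oplus>\<^bsub>S\<^esub> r m) \<oplus>\<^bsub>S\<^esub> l \<otimes>\<^bsub>S\<^esub> h (c m) = q m \<oplus>\<^bsub>S\<^esub> (r m \<oplus>\<^bsub>S\<^esub> l \<otimes>\<^bsub>S\<^esub> h (c m))" for m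
    using extension_coeff[OF assms(1,3), of m] extension_coeff[OF step.hyps(1) assms(3), of m]
      step.hyps(3) map_coeff[of c V m] by (simp add: S.a_assoc)
  ultimately show ?case by simp
qed

lemma extension_poly_ideal:
  assumes C: "R.poly_ideal V (carrier R) C"
  shows "S.poly_ideal V (carrier S) (extension C)"
proof -
  note CD = R.poly_idealD[OF C]
  have scale: "(\<lambda>m. k \<otimes>\<^bsub>S\<^esub> q m) \<in> extension C" if "k \<in> carrier S" "q \<in> extension C" for k q
    using that(2)
  proof induction
    case zero
    then show ?case using that(1) by (simp add: extension.zero)
  next
    case (step q c l)
    have "(\<lambda>m. k \<otimes>\<^bsub>S\<^esub> q m \<oplus>\<^bsub>S\<^esub> (k \<otimes>\<^bsub>S\<^esub> l) \<otimes>\<^bsub>S\<^esub> h (c m)) \<in> extension C"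
      using step that(1) by (intro extension.step) auto
    moreover have "c \<in> polyR V" using step CD(1) by blast
    then have "k \<otimes>\<^bsub>S\<^esub> q m \<oplus>\<^bsub>S\<^esub> (k \<otimes>\<^bsub>S\<^esub> l) \<otimes>\<^bsub>S\<^esub> h (c m) = k \<otimes>\<^bsub>S\<^esub> (q m \<oplus>\<^bsub>S\<^esub> l \<otimes>\<^bsub>S\<^esub> h (c m))" for m
      using extension_coeff[OF step.hyps(1) CD(1), of m] step.hyps(3) that(1) map_coeff[of c V m]
      by (simp add: S.r_distr S.m_assoc)
    ultimately show ?case by simp
  qed
  have pmult: "S.indexed_pmult q i \<in> extension C" if "i \<in> V" "q \<in> extension C" for i q
    using that(2)
  proof induction
    case zero
    then show ?case by (simp add: S.indexed_pmult_def extension.zero)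
  next
    case (step q c l)
    have "(\<lambda>m. S.indexed_pmult q i m \<oplus>\<^bsub>S\<^esub> l \<otimes>\<^bsub>S\<^esub> h (R.indexed_pmult c i m)) \<in> extension C"
      using step CD(5) that(1) by (intro extension.step) auto
    moreover have "(\<lambda>m. S.indexed_pmult q i m \<oplus>\<^bsub>S\<^esub> l \<otimes>\<^bsub>S\<^esub> h (R.indexed_pmult c i m)) =
        S.indexed_pmult (\<lambda>m. q m \<oplus>\<^bsub>S\<^esub> l \<otimes>\<^bsub>S\<^esub> h (c m)) i"
      using step.hyps(3) by (auto simp: S.indexed_pmult_def R.indexed_pmult_def)
    ultimately show ?case by simp
  qed
  show ?thesis
    unfolding S.poly_ideal_def
    using extension_polyS[OF _ CD(1)] extension.zero extension_add[OF _ _ CD(1)] scale pmult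
    by (auto simp: S.indexed_zero_def S.indexed_padd_def)
qed

text \<open>A combination over \<open>S\<close> of polynomials over \<open>R\<close>, kept as a list
  of pairs so that its number of terms can be minimised.\<close>

primrec combination :: "('c \<times> ('v multiset \<Rightarrow> 'a)) list \<Rightarrow> 'v multiset \<Rightarrow> 'c"
  where "combination [] m = \<zero>\<^bsub>S\<^esub>"
  | "combination (z # zs) m = fst z \<otimes>\<^bsub>S\<^esub> h (snd z m) \<oplus>\<^bsub>S\<^esub> combination zs m"

lemma combination_closed:
  assumes "\<And>z. z \<in> set zs \<Longrightarrow> fst z \<in> carrier S" "\<And>z m. z \<in> set zs \<Longrightarrow> h (snd z m) \<in> carrier S"
  shows "combination zs m \<in> carrier S"
  using assms by (induction zs) auto

lemma combination_append:
  assumes "\<And>z. z \<in> set zs \<union> set ws \<Longrightarrow> fst z \<in> carrier S"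
    "\<And>z m. z \<in> set zs \<union> set ws \<Longrightarrow> h (snd z m) \<in> carrier S"
  shows "combination (zs @ ws) m = combination zs m \<oplus>\<^bsub>S\<^esub> combination ws m"
  using assms
proof (induction zs)
  case Nil
  then show ?case using combination_closed[of ws m] by simp
next
  case (Cons z zs)
  then show ?case using combination_closed[of ws m] combination_closed[of zs m]
    by (simp add: S.a_assoc)
qed

text \<open>The data entering a membership in the extended ideal lies in a finitely generated subring,
  so a retraction carries it over to the original ideal.\<close>

lemma extension_retraction:
  assumes "q \<in> extension C" and C: "R.poly_ideal V (carrier R) C"
  obtains Y where "finite Y" "Y \<subseteq> carrier S"
    "\<And>A \<rho>. \<lbrakk>subring A S; h ` carrier R \<subseteq> A; Y \<subseteq> A; S.retraction A (h ` carrier R) \<rho>\<rbrakk> \<Longrightarrow>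
      (\<forall>m. q m \<in> A) \<and> (\<exists>c\<in>C. \<rho> \<circ> q = h \<circ> c)"
proof -
  note CD = R.poly_idealD[OF C]
  \<comment> \<open>The property refers to every \<open>A\<close> containing \<open>Y\<close>. Hence
    the data of several polynomials may be united before a single retraction is chosen.\<close>
  define Q where "Q q Y \<longleftrightarrow> (\<forall>A \<rho>. subring A S \<and> h ` carrier R \<subseteq> A \<and> Y \<subseteq> A \<and>
      S.retraction A (h ` carrier R) \<rho> \<longrightarrow> (\<forall>m. q m \<in> A) \<and> (\<exists>c\<in>C. \<rho> \<circ> q = h \<circ> c))" for q Y
  have "\<exists>Y. finite Y \<and> Y \<subseteq> carrier S \<and> Q q Y"
    using assms(1)
  proof induction
    case zero
    have "\<rho> \<circ> (\<lambda>m. \<zero>\<^bsub>S\<^esub>) = h \<circ> R.indexed_const \<zero>\<^bsub>R\<^esub>" if "S.retraction A (h ` carrier R) \<rho>" for A \<rho>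
      using that subringE(2)[OF image_subring] by (auto simp: S.retraction_def R.indexed_zero_def)
    moreover have "\<zero>\<^bsub>S\<^esub> \<in> A" if "subring A S" for A using subringE(2)[OF that] .
    ultimately show ?case using CD(2) unfolding Q_def by (intro exI[of _ "{}"]) blast
  next
    case (step q c l)
    then obtain Y where Y: "finite Y" "Y \<subseteq> carrier S" "Q q Y" by blast
    have "Q (\<lambda>m. q m \<oplus>\<^bsub>S\<^esub> l \<otimes>\<^bsub>S\<^esub> h (c m)) (insert l Y)"
      unfolding Q_def
    proof (intro conjI allI impI; elim conjE)
      fix A \<rho> assume A: "subring A S" "h ` carrier R \<subseteq> A" "insert l Y \<subseteq> A"
        and \<rho>: "S.retraction A (h ` carrier R) \<rho>"
      then have Yq: "(\<forall>m. q m \<in> A) \<and> (\<exists>c\<in>C. \<rho> \<circ> q = h \<circ> c)"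
        using Y(3) unfolding Q_def by blast
      then have q: "q m \<in> A" for m by blast
      obtain c0 where c0: "c0 \<in> C" "\<rho> \<circ> q = h \<circ> c0" using Yq by blast
      have cR: "c m \<in> carrier R" "c0 m \<in> carrier R" for m
        using CD(1) step.hyps c0 R.indexed_pset_coeff by blast+
      have hc: "h (c m) \<in> A" for m using cR A by auto
      have lA: "l \<in> A" using A by auto
      show "q m \<oplus>\<^bsub>S\<^esub> l \<otimes>\<^bsub>S\<^esub> h (c m) \<in> A" for m
        using q hc lA subringE(6,7)[OF A(1)] by simp
      obtain r where r: "r \<in> carrier R" "\<rho> l = h r" using \<rho> lA by (auto simp: S.retraction_def)
      have "\<rho> (q m \<oplus>\<^bsub>S\<^esub> l \<otimes>\<^bsub>S\<^esub> h (c m)) = h (R.indexed_padd c0 (\<lambda>m. r \<otimes>\<^bsub>R\<^esub> c m) m)" for m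
      proof -
        have "\<rho> (q m \<oplus>\<^bsub>S\<^esub> l \<otimes>\<^bsub>S\<^esub> h (c m)) = \<rho> (q m) \<oplus>\<^bsub>S\<^esub> \<rho> l \<otimes>\<^bsub>S\<^esub> \<rho> (h (c m))"
          using \<rho> q hc lA subringE(6)[OF A(1)] by (simp add: S.retraction_def)
        also have "\<rho> (h (c m)) = h (c m)" using \<rho> cR by (simp add: S.retraction_def)
        also have "\<rho> (q m) = h (c0 m)" using c0(2) by (metis comp_apply)
        finally show ?thesis using r cR by (simp add: R.indexed_padd_def)
      qed
      then show "\<exists>c'\<in>C. \<rho> \<circ> (\<lambda>m. q m \<oplus>\<^bsub>S\<^esub> l \<otimes>\<^bsub>S\<^esub> h (c m)) = h \<circ> c'"
        using CD(3)[OF c0(1) CD(4)[OF r(1) step.hyps(2)]]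
        by (intro bexI[of _ "R.indexed_padd c0 (\<lambda>m. r \<otimes>\<^bsub>R\<^esub> c m)"]) auto
    qed
    then show ?case using Y(1,2) step.hyps(3) by (intro exI[of _ "insert l Y"]) simp
  qed
  then obtain Y where "finite Y" "Y \<subseteq> carrier S" "Q q Y" by blast
  then show thesis unfolding Q_def by (intro that[of Y]) blast+
qed

text \<open>Provides some expression modulo the extended ideal, from which a shortest one is
  selected later.\<close>

lemma combination_exists:
  assumes "f \<in> polyS V" and C: "R.poly_ideal V (carrier R) C"
  shows "\<exists>zs. (\<forall>z\<in>set zs. fst z \<in> carrier S \<and> snd z \<in> polyR V) \<and>
    (\<exists>q\<in>extension C. \<forall>m. f m = combination zs m \<oplus>\<^bsub>S\<^esub> q m)"
  using assms(1)
proof induction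
  case (indexed_const k)
  then show ?case
    using R.indexed_pset.indexed_const[OF R.one_closed, of V]
    by (intro exI[of _ "[(k, R.indexed_const \<one>\<^bsub>R\<^esub>)]"] conjI bexI[OF _ extension.zero])
      (simp_all add: R.indexed_const_def S.indexed_const_def)
next
  case (indexed_padd f g)
  then obtain zs ws q r where z: "\<forall>z\<in>set zs. fst z \<in> carrier S \<and> snd z \<in> polyR V" "q \<in> extension C"
    "\<And>m. f m = combination zs m \<oplus>\<^bsub>S\<^esub> q m" "\<forall>z\<in>set ws. fst z \<in> carrier S \<and> snd z \<in> polyR V"
    "r \<in> extension C" "\<And>m. g m = combination ws m \<oplus>\<^bsub>S\<^esub> r m" by metis
  note CV = R.poly_idealD(1)[OF C]
  have hz: "fst w \<in> carrier S" "h (snd w m) \<in> carrier S" if "w \<in> set zs \<union> set ws" for w m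
    using that z(1,4) map_coeff[of "snd w" V m] by auto
  have cl: "combination zs m \<in> carrier S" "combination ws m \<in> carrier S" "q m \<in> carrier S" "r m \<in> carrier S"
    for m using combination_closed[of zs m] combination_closed[of ws m] hz
      extension_coeff[OF z(2) CV] extension_coeff[OF z(5) CV] by simp_all
  have "combination (zs @ ws) m = combination zs m \<oplus>\<^bsub>S\<^esub> combination ws m" for m
    using hz by (intro combination_append) auto
  then have "S.indexed_padd f g m = combination (zs @ ws) m \<oplus>\<^bsub>S\<^esub> (q m \<oplus>\<^bsub>S\<^esub> r m)" for m
    using cl[of m] z(3)[of m] z(6)[of m] by (simp add: S.indexed_padd_def S.a_ac)
  then show ?case
    using z(1,4) by (intro exI[of _ "zs @ ws"] conjI bexI[OF _ extension_add[OF z(2,5) CV]]) auto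
next
  case (indexed_pmult f i)
  then obtain zs q where z: "\<forall>z\<in>set zs. fst z \<in> carrier S \<and> snd z \<in> polyR V" "q \<in> extension C"
    "\<And>m. f m = combination zs m \<oplus>\<^bsub>S\<^esub> q m" by metis
  let ?f = "\<lambda>z. (fst z, R.indexed_pmult (snd z) i)"
  have "combination (map ?f zs) m = S.indexed_pmult (combination zs) i m" for m
    using z(1) by (induction zs) (auto simp: R.indexed_pmult_def S.indexed_pmult_def)
  then have "S.indexed_pmult f i m = combination (map ?f zs) m \<oplus>\<^bsub>S\<^esub> S.indexed_pmult q i m" for m
    using z(3) by (auto simp: S.indexed_pmult_def)
  moreover have "S.indexed_pmult q i \<in> extension C"
    using S.poly_idealD(5)[OF extension_poly_ideal[OF C]] z(2) indexed_pmult(2) by blast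
  ultimately show ?case
    using z(1) indexed_pmult(2)
    by (intro exI[of _ "map ?f zs"] conjI bexI[of _ "S.indexed_pmult q i"])
      (auto intro: R.indexed_pset.indexed_pmult)
qed

text \<open>In a shortest expression of \<open>f\<close> modulo the extended ideal, no term may become redundant after
  a retraction that keeps its coefficient invertible.\<close>

lemma not_extension_retraction:
  assumes f: "f \<in> polyS V" "f \<notin> extension C" and C: "R.poly_ideal V (carrier R) C"
  obtains Y where "finite Y" "Y \<subseteq> carrier S"
    "\<And>A \<rho>. \<lbrakk>subring A S; h ` carrier R \<subseteq> A; Y \<subseteq> A; S.retraction A (h ` carrier R) \<rho>\<rbrakk> \<Longrightarrow>
      (\<forall>m. f m \<in> A) \<and> \<not> (\<exists>c\<in>C. \<rho> \<circ> f = h \<circ> c)"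
proof -
  note CD = R.poly_idealD[OF C]
  define P where "P zs \<longleftrightarrow> (\<forall>z\<in>set zs. fst z \<in> carrier S \<and> snd z \<in> polyR V) \<and>
    (\<exists>q\<in>extension C. \<forall>m. f m = combination zs m \<oplus>\<^bsub>S\<^esub> q m)" for zs
  obtain zs0 where "P zs0" using combination_exists[OF f(1) C] unfolding P_def by blast
  then obtain zs where zs: "P zs" "\<And>ws. P ws \<Longrightarrow> length zs \<le> length ws"
    using ex_has_least_nat[of P zs0 length] by blast
  from zs(1) obtain q where q: "q \<in> extension C" "\<And>m. f m = combination zs m \<oplus>\<^bsub>S\<^esub> q m"
    unfolding P_def by blast
  have qS: "q m \<in> carrier S" for m using extension_coeff[OF q(1) CD(1)] .
  have "zs \<noteq> []"
  proof
    assume "zs = []"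
    then have "f m = q m" for m using q(2)[of m] qS[of m] by simp
    then have "f = q" by (rule ext)
    with q(1) f(2) show False by simp
  qed
  then obtain z ws where z: "zs = z # ws" by (cases zs) auto
  define l e where "l = fst z" and "e = snd z"
  have le: "l \<in> carrier S" "e \<in> polyR V"
    and ws: "\<And>w. w \<in> set ws \<Longrightarrow> fst w \<in> carrier S \<and> snd w \<in> polyR V"
    using zs(1) unfolding P_def z l_def e_def by auto
  have he: "h (e m) \<in> carrier S" for m using map_coeff le by blast
  have hw: "h (snd w m) \<in> carrier S" if "w \<in> set ws" for w m
    using map_coeff[of "snd w" V m] ws[OF that] by simp
  have cw: "combination ws m \<in> carrier S" for m using combination_closed[of ws m] ws hw by simp
  have fe: "f m = l \<otimes>\<^bsub>S\<^esub> h (e m) \<oplus>\<^bsub>S\<^esub> combination ws m \<oplus>\<^bsub>S\<^esub> q m" for m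
    using q(2)[of m] by (simp add: z l_def e_def)
  have "l \<noteq> \<zero>\<^bsub>S\<^esub>"
  proof
    assume "l = \<zero>\<^bsub>S\<^esub>"
    then have "f m = combination ws m \<oplus>\<^bsub>S\<^esub> q m" for m using fe[of m] he[of m] cw[of m] by simp
    then have "P ws" unfolding P_def using ws q(1) by blast
    then show False using zs(2)[of ws] z by simp
  qed
  then have "l \<in> Units S" using S.field_Units le by blast
  then have linv: "inv\<^bsub>S\<^esub> l \<in> carrier S" "l \<otimes>\<^bsub>S\<^esub> inv\<^bsub>S\<^esub> l = \<one>\<^bsub>S\<^esub>" by auto
  obtain Y where Y: "finite Y" "Y \<subseteq> carrier S" "\<And>A \<rho>. \<lbrakk>subring A S; h ` carrier R \<subseteq> A; Y \<subseteq> A;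
      S.retraction A (h ` carrier R) \<rho>\<rbrakk> \<Longrightarrow> (\<forall>m. q m \<in> A) \<and> (\<exists>c\<in>C. \<rho> \<circ> q = h \<circ> c)"
    by (rule extension_retraction[OF q(1) C]) (rule that, assumption+)
  show thesis
  \<comment> \<open>The coefficient \<open>l\<close> of the first term is listed together with its
    inverse, so that \<open>\<rho> l\<close> is a unit.\<close>
  proof (rule that[of "{l, inv\<^bsub>S\<^esub> l} \<union> fst ` set ws \<union> Y"])
    show "finite ({l, inv\<^bsub>S\<^esub> l} \<union> fst ` set ws \<union> Y)" using Y(1) by simp
    show "{l, inv\<^bsub>S\<^esub> l} \<union> fst ` set ws \<union> Y \<subseteq> carrier S" using Y(2) le linv ws by auto
    fix A \<rho> assume A: "subring A S" "h ` carrier R \<subseteq> A" "{l, inv\<^bsub>S\<^esub> l} \<union> fst ` set ws \<union> Y \<subseteq> A"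
      and \<rho>: "S.retraction A (h ` carrier R) \<rho>"
    note AS = subringE(1)[OF A(1)]
    have \<rho>S: "\<rho> x \<in> carrier S" if "x \<in> A" for x
      using \<rho> that image_subset by (auto simp: S.retraction_def)
    have \<rho>add: "\<rho> (x \<oplus>\<^bsub>S\<^esub> y) = \<rho> x \<oplus>\<^bsub>S\<^esub> \<rho> y" and \<rho>mult: "\<rho> (x \<otimes>\<^bsub>S\<^esub> y) = \<rho> x \<otimes>\<^bsub>S\<^esub> \<rho> y"
      if "x \<in> A" "y \<in> A" for x y using \<rho> that by (auto simp: S.retraction_def)
    have \<rho>h: "\<rho> (h x) = h x" if "x \<in> carrier R" for x using \<rho> that by (auto simp: S.retraction_def)
    have qA: "q m \<in> A" for m using Y(3)[of A \<rho>] A \<rho> by auto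
    obtain c0 where c0: "c0 \<in> C" "\<rho> \<circ> q = h \<circ> c0" using Y(3)[of A \<rho>] A \<rho> by auto
    have lA: "l \<in> A" "inv\<^bsub>S\<^esub> l \<in> A" using A by auto
    have wA: "fst w \<in> A" "h (snd w m) \<in> A" if "w \<in> set ws" for w m
    proof -
      have "snd w m \<in> carrier R" using ws[OF that] R.indexed_pset_coeff by blast
      then show "fst w \<in> A" "h (snd w m) \<in> A" using that A by auto
    qed
    have eR: "e m \<in> carrier R" for m using le(2) R.indexed_pset_coeff by blast
    have eA: "h (e m) \<in> A" for m using eR A by auto
    let ?g = "\<lambda>w. (\<rho> (fst w), snd w)"
    have comb: "combination ws' m \<in> A \<and> \<rho> (combination ws' m) = combination (map ?g ws') m"
      if "set ws' \<subseteq> set ws" for ws' m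
      using that
    proof (induction ws')
      case Nil
      then show ?case using subringE(2)[OF A(1)] \<rho>h[of "\<zero>\<^bsub>R\<^esub>"] by simp
    next
      case (Cons w ws')
      have "snd w m \<in> carrier R" using ws[of w] Cons.prems R.indexed_pset_coeff by auto
      then show ?case
        using Cons wA(1)[of w] wA(2)[of w m] subringE(6,7)[OF A(1)] by (simp add: \<rho>add \<rho>mult \<rho>h)
    qed
    have fA: "f m \<in> A" for m
      unfolding fe using lA eA comb[OF subset_refl] qA subringE(6,7)[OF A(1)] by simp
    \<comment> \<open>Otherwise the retracted expression is a relation between the terms modulo the
      extended ideal, in which the first term has the unit coefficient \<open>\<rho> l\<close>.
      Subtracting \<open>\<mu>\<close> times this relation, where \<open>\<mu>\<close> is
      \<open>l\<close> divided by \<open>\<rho> l\<close>, removes the first term from the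
      expression of \<open>f\<close>, against minimality.\<close>
    have "\<rho> \<circ> f \<noteq> h \<circ> c" if c: "c \<in> C" for c
    proof
      assume eq: "\<rho> \<circ> f = h \<circ> c"
      have cS: "h (c m) \<in> carrier S" "h (c0 m) \<in> carrier S" for m
        using map_coeff c c0(1) CD(1) by blast+
      define \<mu> where "\<mu> = l \<otimes>\<^bsub>S\<^esub> \<rho> (inv\<^bsub>S\<^esub> l)"
      have \<mu>S: "\<mu> \<in> carrier S" unfolding \<mu>_def using le \<rho>S lA by simp
      have inv1: "\<rho> (inv\<^bsub>S\<^esub> l) \<otimes>\<^bsub>S\<^esub> \<rho> l = \<one>\<^bsub>S\<^esub>"
        using \<rho>mult[OF lA(2,1)] \<rho>h[of "\<one>\<^bsub>R\<^esub>"] linv le by (simp add: S.m_comm)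
      let ?k = "\<lambda>w. (fst w \<ominus>\<^bsub>S\<^esub> \<mu> \<otimes>\<^bsub>S\<^esub> \<rho> (fst w), snd w)"
      have comb2: "combination (map ?k ws') m =
          combination ws' m \<ominus>\<^bsub>S\<^esub> \<mu> \<otimes>\<^bsub>S\<^esub> combination (map ?g ws') m"
        if "set ws' \<subseteq> set ws" for ws' m
        using that
      proof (induction ws')
        case Nil
        then show ?case using \<mu>S by (simp add: a_minus_def)
      next
        case (Cons w ws')
        have 1: "fst w \<in> carrier S" "h (snd w m) \<in> carrier S" "\<rho> (fst w) \<in> carrier S"
          using Cons.prems wA(1)[of w] wA(2)[of w m] ws[of w] hw[of w] \<rho>S by auto
        have 2: "combination ws' m \<in> carrier S" "combination (map ?g ws') m \<in> carrier S"
          using comb[of ws' m] Cons.prems AS \<rho>S[of "combination ws' m"] by auto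
        have IH: "combination (map ?k ws') m =
          combination ws' m \<ominus>\<^bsub>S\<^esub> \<mu> \<otimes>\<^bsub>S\<^esub> combination (map ?g ws') m" using Cons by simp
        have "combination (map ?k (w # ws')) m =
          (fst w \<ominus>\<^bsub>S\<^esub> \<mu> \<otimes>\<^bsub>S\<^esub> \<rho> (fst w)) \<otimes>\<^bsub>S\<^esub> h (snd w m) \<oplus>\<^bsub>S\<^esub>
          (combination ws' m \<ominus>\<^bsub>S\<^esub> \<mu> \<otimes>\<^bsub>S\<^esub> combination (map ?g ws') m)"
          using IH by simp
        also have "\<dots> = (fst w \<otimes>\<^bsub>S\<^esub> h (snd w m) \<oplus>\<^bsub>S\<^esub> combination ws' m) \<ominus>\<^bsub>S\<^esub>
          \<mu> \<otimes>\<^bsub>S\<^esub> (\<rho> (fst w) \<otimes>\<^bsub>S\<^esub> h (snd w m) \<oplus>\<^bsub>S\<^esub> combination (map ?g ws') m)"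
          by (rule S.diff_mult_add_diff) (use 1 2 \<mu>S in auto)
        finally show ?case by simp
      qed
      \<comment> \<open>The part of the scaled relation that lies in the extended ideal is absorbed
        into \<open>q\<close>.\<close>
      define q' where "q' = (\<lambda>m. (q m \<oplus>\<^bsub>S\<^esub> \<mu> \<otimes>\<^bsub>S\<^esub> h (c m)) \<oplus>\<^bsub>S\<^esub> (\<ominus>\<^bsub>S\<^esub> \<mu>) \<otimes>\<^bsub>S\<^esub> h (c0 m))"
      have q': "q' \<in> extension C"
        unfolding q'_def using q(1) c c0(1) \<mu>S by (intro extension.step) auto
      have "f m = combination (map ?k ws) m \<oplus>\<^bsub>S\<^esub> q' m" for m
      proof -
        let ?r = "combination (map ?g ws) m"
        have cl: "?r \<in> carrier S" "\<rho> l \<in> carrier S" "\<rho> (inv\<^bsub>S\<^esub> l) \<in> carrier S"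
          using comb[OF subset_refl, of m] \<rho>S[of "combination ws m"] \<rho>S lA by auto
        have "h (c m) = \<rho> (f m)" using eq by (metis comp_apply)
        also have "\<dots> = \<rho> l \<otimes>\<^bsub>S\<^esub> h (e m) \<oplus>\<^bsub>S\<^esub> ?r \<oplus>\<^bsub>S\<^esub> \<rho> (q m)"
          unfolding fe using lA eA qA comb[OF subset_refl, of m] subringE(6,7)[OF A(1)] eR
          by (simp add: \<rho>add \<rho>mult \<rho>h)
        also have "\<rho> (q m) = h (c0 m)" using c0(2) by (metis comp_apply)
        finally have hc: "h (c m) = \<rho> l \<otimes>\<^bsub>S\<^esub> h (e m) \<oplus>\<^bsub>S\<^esub> ?r \<oplus>\<^bsub>S\<^esub> h (c0 m)" .
        have "\<mu> \<otimes>\<^bsub>S\<^esub> \<rho> l = l \<otimes>\<^bsub>S\<^esub> (\<rho> (inv\<^bsub>S\<^esub> l) \<otimes>\<^bsub>S\<^esub> \<rho> l)"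
          unfolding \<mu>_def using cl le by (simp add: S.m_assoc)
        then have \<mu>l: "\<mu> \<otimes>\<^bsub>S\<^esub> \<rho> l = l" using inv1 le by simp
        have "\<mu> \<otimes>\<^bsub>S\<^esub> h (c m) = \<mu> \<otimes>\<^bsub>S\<^esub> \<rho> l \<otimes>\<^bsub>S\<^esub> h (e m) \<oplus>\<^bsub>S\<^esub> \<mu> \<otimes>\<^bsub>S\<^esub> ?r \<oplus>\<^bsub>S\<^esub> \<mu> \<otimes>\<^bsub>S\<^esub> h (c0 m)"
          unfolding hc using \<mu>S cl he[of m] cS[of m] by (simp add: S.r_distr S.m_assoc)
        then have "combination (map ?k ws) m \<oplus>\<^bsub>S\<^esub> q' m =
          (combination ws m \<ominus>\<^bsub>S\<^esub> \<mu> \<otimes>\<^bsub>S\<^esub> ?r) \<oplus>\<^bsub>S\<^esub> ((q m \<oplus>\<^bsub>S\<^esub> (l \<otimes>\<^bsub>S\<^esub> h (e m) \<oplus>\<^bsub>S\<^esub> \<mu> \<otimes>\<^bsub>S\<^esub> ?r \<oplus>\<^bsub>S\<^esub>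
            \<mu> \<otimes>\<^bsub>S\<^esub> h (c0 m))) \<oplus>\<^bsub>S\<^esub> (\<ominus>\<^bsub>S\<^esub> \<mu>) \<otimes>\<^bsub>S\<^esub> h (c0 m))"
          unfolding comb2[OF subset_refl] q'_def \<mu>l by simp
        also have "\<dots> = l \<otimes>\<^bsub>S\<^esub> h (e m) \<oplus>\<^bsub>S\<^esub> combination ws m \<oplus>\<^bsub>S\<^esub> q m"
          by (rule S.add_mult_cancel) (use \<mu>S cl he[of m] cS[of m] cw[of m] qS[of m] le(1) in auto)
        finally show ?thesis using fe by simp
      qed
      moreover have "fst (?k w) \<in> carrier S \<and> snd (?k w) \<in> polyR V" if "w \<in> set ws" for w
        using ws[OF that] \<rho>S wA[OF that] \<mu>S by simp
      ultimately have "P (map ?k ws)" unfolding P_def using q' by auto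
      then show False using zs(2)[of "map ?k ws"] z by simp
    qed
    with fA show "(\<forall>m. f m \<in> A) \<and> \<not> (\<exists>c\<in>C. \<rho> \<circ> f = h \<circ> c)" by blast
  qed
qed

end

section \<open>Contraction of extended ideals and primality\<close>

context ec_embedding
begin

lemma retraction_exists:
  assumes "finite Y" "Y \<subseteq> carrier S"
  obtains A \<rho> where "subring A S" "h ` carrier R \<subseteq> A" "Y \<subseteq> A" "S.retraction A (h ` carrier R) \<rho>"
proof -
  obtain \<rho> where \<rho>: "S.retraction (generate_ring S (h ` carrier R \<union> Y)) (h ` carrier R) \<rho>"
    using S.ec_retraction[OF ec assms] by blast
  have "h ` carrier R \<union> Y \<subseteq> carrier S" using assms image_subset by blast
  then have "subring (generate_ring S (h ` carrier R \<union> Y)) S" by (rule S.generate_ring_is_subring)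
  moreover have "h ` carrier R \<union> Y \<subseteq> generate_ring S (h ` carrier R \<union> Y)"
    by (blast intro: generate_ring.incl)
  ultimately show thesis using \<rho> by (intro that) auto
qed

lemma retraction_map:
  assumes "S.retraction A (h ` carrier R) \<rho>" "p \<in> polyR V"
  shows "\<rho> \<circ> (h \<circ> p) = h \<circ> p"
  using assms R.indexed_pset_coeff[OF assms(2) subset_refl] by (auto simp: S.retraction_def)

text \<open>A retraction fixes \<open>h \<circ> p\<close> because its coefficients come from
  \<open>R\<close>, and it carries this element of the extended ideal back into the image of
  \<open>C\<close>.\<close>

lemma extension_contract:
  assumes C: "R.poly_ideal V (carrier R) C" and p: "p \<in> polyR V" "h \<circ> p \<in> extension C"
  shows "p \<in> C"
proof -
  obtain Y where Y: "finite Y" "Y \<subseteq> carrier S" "\<And>A \<rho>. \<lbrakk>subring A S; h ` carrier R \<subseteq> A; Y \<subseteq> A;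
      S.retraction A (h ` carrier R) \<rho>\<rbrakk> \<Longrightarrow> (\<forall>m. (h \<circ> p) m \<in> A) \<and> (\<exists>c\<in>C. \<rho> \<circ> (h \<circ> p) = h \<circ> c)"
    by (rule extension_retraction[OF p(2) C]) (rule that, assumption+)
  obtain A \<rho> where A: "subring A S" "h ` carrier R \<subseteq> A" "Y \<subseteq> A" "S.retraction A (h ` carrier R) \<rho>"
    using retraction_exists[OF Y(1,2)] by blast
  obtain c where c: "c \<in> C" "\<rho> \<circ> (h \<circ> p) = h \<circ> c" using Y(3)[OF A] by blast
  have cR: "c m \<in> carrier R" "p m \<in> carrier R" for m
    using R.poly_idealD(1)[OF C] c(1) p(1) R.indexed_pset_coeff by blast+
  have "h \<circ> p = h \<circ> c" using c(2) retraction_map[OF A(4) p(1)] by simp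
  then have "p = c" by (rule map_cancel) (use cR in auto)
  then show ?thesis using c(1) by simp
qed

lemma map_in_extension:
  assumes "c \<in> C" "C \<subseteq> polyR V"
  shows "h \<circ> c \<in> extension C"
proof -
  have "(\<lambda>m. \<zero>\<^bsub>S\<^esub> \<oplus>\<^bsub>S\<^esub> \<one>\<^bsub>S\<^esub> \<otimes>\<^bsub>S\<^esub> h (c m)) \<in> extension C"
    using assms by (intro extension.step extension.zero) auto
  moreover have "(\<lambda>m. \<zero>\<^bsub>S\<^esub> \<oplus>\<^bsub>S\<^esub> \<one>\<^bsub>S\<^esub> \<otimes>\<^bsub>S\<^esub> h (c m)) = h \<circ> c"
  proof -
    have "h (c m) \<in> carrier S" for m using map_coeff[of c V m] assms by blast
    then show ?thesis by auto
  qed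
  ultimately show ?thesis by simp
qed

lemma polyR_poly_ideal: "R.poly_ideal V (carrier R) (polyR V)"
  by (rule R.ideal_imp_poly_ideal)
    (use ring.oneideal[OF cring.axioms(1)[OF R.mpoly_ring_cring], of V] in \<open>simp add: R.mpoly_ring_simps\<close>)

text \<open>Makes \<open>extension_retraction\<close> applicable to arbitrary polynomials over
  \<open>S\<close>: after a retraction they become polynomials over \<open>R\<close>.\<close>

lemma extension_polyR: "extension (polyR V) = polyS V"
proof -
  have "ideal (extension (polyR V)) (mpoly_ring S V)"
    by (rule S.poly_ideal_imp_ideal[OF extension_poly_ideal[OF polyR_poly_ideal]])
  moreover have "\<one>\<^bsub>mpoly_ring S V\<^esub> \<in> extension (polyR V)"
    using map_in_extension[OF R.indexed_pset.indexed_const[OF R.one_closed] subset_refl, of V]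
    by (simp add: map_indexed_const S.mpoly_ring_simps)
  ultimately show ?thesis
    using ideal.one_imp_carrier by (fastforce simp: S.mpoly_ring_simps)
qed

text \<open>A single retraction turns a counterexample over \<open>S\<close> into one over
  \<open>R\<close>: it carries the product into \<open>C\<close> while keeping both factors
  outside.\<close>

theorem extension_prime:
  fixes C :: "('v multiset \<Rightarrow> 'a) set"
  assumes "primeideal C (mpoly_ring R V)"
  shows "primeideal (extension C) (mpoly_ring S V)"
proof -
  interpret C: primeideal C "mpoly_ring R V" by fact
  have C: "R.poly_ideal V (carrier R) C" by (rule R.ideal_imp_poly_ideal[OF C.is_ideal])
  note CV = R.poly_idealD(1)[OF C]
  show ?thesis
  proof (rule primeidealI)
    show "ideal (extension C) (mpoly_ring S V)"
      by (rule S.poly_ideal_imp_ideal[OF extension_poly_ideal[OF C]])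
    show "cring (mpoly_ring S V)" by (rule S.mpoly_ring_cring)
    show "carrier (mpoly_ring S V) \<noteq> extension C"
    proof
      assume "carrier (mpoly_ring S V) = extension C"
      then have "S.indexed_const \<one>\<^bsub>S\<^esub> \<in> extension C"
        by (metis S.mpoly_ring_simps(1) S.indexed_pset.indexed_const S.one_closed)
      then have "h \<circ> R.indexed_const \<one>\<^bsub>R\<^esub> \<in> extension C" by (simp add: map_indexed_const)
      then have "R.indexed_const \<one>\<^bsub>R\<^esub> \<in> C"
        by (rule extension_contract[OF C R.indexed_pset.indexed_const[OF R.one_closed]])
      then show False
        using C.one_imp_carrier C.I_notcarr by (simp add: R.mpoly_ring_simps)
    qed
    fix f g
    assume "f \<in> carrier (mpoly_ring S V)" "g \<in> carrier (mpoly_ring S V)"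
      and fg: "f \<otimes>\<^bsub>mpoly_ring S V\<^esub> g \<in> extension C"
    then have f: "f \<in> polyS V" and g: "g \<in> polyS V" by (simp_all add: S.mpoly_ring_simps)
    show "f \<in> extension C \<or> g \<in> extension C"
    proof (rule ccontr)
      assume "\<not> ?thesis"
      then have nf: "f \<notin> extension C" and ng: "g \<notin> extension C" by auto
      define Q where "Q D q Y \<longleftrightarrow> finite Y \<and> Y \<subseteq> carrier S \<and> (\<forall>A \<rho>. subring A S \<and> h ` carrier R \<subseteq> A \<and>
        Y \<subseteq> A \<and> S.retraction A (h ` carrier R) \<rho> \<longrightarrow> (\<forall>m. q m \<in> A) \<and> (\<exists>c\<in>D. \<rho> \<circ> q = h \<circ> c))" for D and q :: "'v multiset \<Rightarrow> 'c" and Y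
      define N where "N q Y \<longleftrightarrow> finite Y \<and> Y \<subseteq> carrier S \<and> (\<forall>A \<rho>. subring A S \<and> h ` carrier R \<subseteq> A \<and>
        Y \<subseteq> A \<and> S.retraction A (h ` carrier R) \<rho> \<longrightarrow> (\<forall>m. q m \<in> A) \<and> \<not> (\<exists>c\<in>C. \<rho> \<circ> q = h \<circ> c))" for q Y
      have Q: "\<exists>Y. Q D q Y" if qD: "q \<in> extension D" "R.poly_ideal V (carrier R) D" for D q
      proof -
        obtain Y where Y: "finite Y" "Y \<subseteq> carrier S" "\<And>A \<rho>. \<lbrakk>subring A S; h ` carrier R \<subseteq> A; Y \<subseteq> A;
          S.retraction A (h ` carrier R) \<rho>\<rbrakk> \<Longrightarrow> (\<forall>m. q m \<in> A) \<and> (\<exists>c\<in>D. \<rho> \<circ> q = h \<circ> c)"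
          by (rule extension_retraction[OF qD]) (rule that, assumption+)
        have "Q D q Y"
          unfolding Q_def
        proof (intro conjI Y(1,2))
          show "\<forall>A \<rho>. subring A S \<and> h ` carrier R \<subseteq> A \<and> Y \<subseteq> A \<and> S.retraction A (h ` carrier R) \<rho> \<longrightarrow>
              (\<forall>m. q m \<in> A) \<and> (\<exists>c\<in>D. \<rho> \<circ> q = h \<circ> c)"
            by (intro allI impI Y(3)) (elim conjE, assumption)+
        qed
        then show ?thesis by blast
      qed
      have N: "\<exists>Y. N q Y" if qN: "q \<in> polyS V" "q \<notin> extension C" for q
      proof -
        obtain Y where Y: "finite Y" "Y \<subseteq> carrier S" "\<And>A \<rho>. \<lbrakk>subring A S; h ` carrier R \<subseteq> A; Y \<subseteq> A;
          S.retraction A (h ` carrier R) \<rho>\<rbrakk> \<Longrightarrow> (\<forall>m. q m \<in> A) \<and> \<not> (\<exists>c\<in>C. \<rho> \<circ> q = h \<circ> c)"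
          by (rule not_extension_retraction[OF qN C]) (rule that, assumption+)
        have "N q Y"
          unfolding N_def
        proof (intro conjI Y(1,2))
          show "\<forall>A \<rho>. subring A S \<and> h ` carrier R \<subseteq> A \<and> Y \<subseteq> A \<and> S.retraction A (h ` carrier R) \<rho> \<longrightarrow>
              (\<forall>m. q m \<in> A) \<and> \<not> (\<exists>c\<in>C. \<rho> \<circ> q = h \<circ> c)"
            by (intro allI impI Y(3)) (elim conjE, assumption)+
        qed
        then show ?thesis by blast
      qed
      have f': "f \<in> extension (polyR V)" "g \<in> extension (polyR V)" using f g extension_polyR by auto
      obtain Y1 Y2 Y3 Y4 Y5 where Y: "Q C (series_mult S f g) Y1" "N f Y2" "N g Y3"
          "Q (polyR V) f Y4" "Q (polyR V) g Y5"
        using Q[OF fg[unfolded S.mpoly_ring_simps] C] N[OF f nf] N[OF g ng]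
          Q[OF f'(1) polyR_poly_ideal] Q[OF f'(2) polyR_poly_ideal] by blast
      \<comment> \<open>Five sets of data are united: the product goes into \<open>C\<close>,
        neither factor does, and both factors become polynomials over \<open>R\<close>.\<close>
      have "finite (Y1 \<union> Y2 \<union> Y3 \<union> Y4 \<union> Y5)" "Y1 \<union> Y2 \<union> Y3 \<union> Y4 \<union> Y5 \<subseteq> carrier S"
        using Y unfolding Q_def N_def by auto
      then obtain A \<rho> where A: "subring A S" "h ` carrier R \<subseteq> A" "Y1 \<union> Y2 \<union> Y3 \<union> Y4 \<union> Y5 \<subseteq> A"
        "S.retraction A (h ` carrier R) \<rho>"
        by (rule retraction_exists)
      have Y': "Y1 \<subseteq> A" "Y2 \<subseteq> A" "Y3 \<subseteq> A" "Y4 \<subseteq> A" "Y5 \<subseteq> A" using A(3) by auto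
      obtain c where c: "c \<in> C" "\<rho> \<circ> series_mult S f g = h \<circ> c"
        using Y(1) A(1,2,4) Y'(1) unfolding Q_def by blast
      have fA: "\<And>m. f m \<in> A" "\<not> (\<exists>c\<in>C. \<rho> \<circ> f = h \<circ> c)"
        using Y(2) A(1,2,4) Y'(2) unfolding N_def by blast+
      have gA: "\<And>m. g m \<in> A" "\<not> (\<exists>c\<in>C. \<rho> \<circ> g = h \<circ> c)"
        using Y(3) A(1,2,4) Y'(3) unfolding N_def by blast+
      obtain f0 where f0: "f0 \<in> polyR V" "\<rho> \<circ> f = h \<circ> f0"
        using Y(4) A(1,2,4) Y'(4) unfolding Q_def by blast
      obtain g0 where g0: "g0 \<in> polyR V" "\<rho> \<circ> g = h \<circ> g0"
        using Y(5) A(1,2,4) Y'(5) unfolding Q_def by blast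
      have cR: "f0 m \<in> carrier R" "g0 m \<in> carrier R" "c m \<in> carrier R" for m
        using f0(1) g0(1) c(1) CV R.indexed_pset_coeff by blast+
      have "h \<circ> series_mult R f0 g0 = series_mult S (h \<circ> f0) (h \<circ> g0)"
        by (rule map_series_mult) (use cR in auto)
      also have "\<dots> = h \<circ> c"
        using S.retraction_series_mult[OF A(4,1) image_subring, of f g] fA(1) gA(1) f0(2) g0(2) c(2) by simp
      finally have "series_mult R f0 g0 = c"
        by (rule map_cancel) (use cR R.series_mult_closed[of f0 g0] in auto)
      then have "f0 \<in> C \<or> g0 \<in> C"
        using C.I_prime[of f0 g0] f0(1) g0(1) c(1) by (simp add: R.mpoly_ring_simps)
      then show False using fA(2) gA(2) f0(2) g0(2) by blast
    qed
  qed
qed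

end

section \<open>Krull dimension\<close>

text \<open>Chains of primes of the quotient by \<open>P\<close>, seen in the polynomial ring
  itself, where extension and contraction of ideals operate.\<close>

definition prime_chain :: "('a, 'b) ring_scheme \<Rightarrow> 'a set \<Rightarrow> nat \<Rightarrow> (nat \<Rightarrow> 'a set) \<Rightarrow> bool"
  where "prime_chain R P d C \<longleftrightarrow>
    (\<forall>i\<le>d. primeideal (C i) R \<and> P \<subseteq> C i) \<and> (\<forall>i<d. C i \<subset> C (Suc i))"

lemma (in cring) quotient_prime_vimage:
  assumes I: "ideal I R" and J: "primeideal J (R Quot I)"
  shows "primeideal {r \<in> carrier R. I +> r \<in> J} R" "I \<subseteq> {r \<in> carrier R. I +> r \<in> J}"
proof -
  interpret I: ideal I R by fact
  interpret J: primeideal J "R Quot I" by fact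
  show "primeideal {r \<in> carrier R. I +> r \<in> J} R"
    by (rule ring_hom_ring.primeideal_vimage[OF I.rcos_ring_hom_ring is_cring J])
  show "I \<subseteq> {r \<in> carrier R. I +> r \<in> J}"
  proof
    fix x assume x: "x \<in> I"
    then have "I +> x = I" using I.a_rcos_const by blast
    moreover have "I \<in> J"
      using additive_subgroup.zero_closed[OF ideal.axioms(1)[OF primeideal.axioms(1)[OF J]]]
      by (simp add: FactRing_def)
    ultimately show "x \<in> {r \<in> carrier R. I +> r \<in> J}" using x I.a_subset by auto
  qed
qed

text \<open>As \<open>J\<close> contains \<open>I\<close>, it is a union of cosets, so membership of
  a coset in the image can be tested on any representative.\<close>

lemma (in cring) quotient_prime_image:
  assumes I: "ideal I R" and J: "primeideal J R" "I \<subseteq> J"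
  shows "primeideal ((+>) I ` J) (R Quot I)"
    and "\<And>r. r \<in> carrier R \<Longrightarrow> I +> r \<in> (+>) I ` J \<longleftrightarrow> r \<in> J"
proof -
  interpret I: ideal I R by fact
  interpret J: primeideal J R by fact
  let ?J = "(+>) I ` J"
  have idl: "ideal ?J (R Quot I)" by (rule ring_ideal_imp_quot_ideal[OF I J.is_ideal])
  have sub: "?J \<subseteq> carrier (R Quot I)" by (rule additive_subgroup.a_subset[OF ideal.axioms(1)[OF idl]])
  have "J = \<Union> ?J" using ideal_incl_iff[OF I J.is_ideal] J(2) by simp
  then show iff: "I +> r \<in> ?J \<longleftrightarrow> r \<in> J" if "r \<in> carrier R" for r
    using canonical_proj_vimage_mem_iff[OF I sub that] by simp
  have surj: "\<exists>r\<in>carrier R. A = I +> r" if "A \<in> carrier (R Quot I)" for A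
    using that by (auto simp: FactRing_def A_RCOSETS_def')
  show "primeideal ?J (R Quot I)"
  proof (rule primeidealI[OF idl I.quotient_is_cring[OF is_cring]])
    show "carrier (R Quot I) \<noteq> ?J"
    proof
      assume "carrier (R Quot I) = ?J"
      then have "r \<in> J" if "r \<in> carrier R" for r
        using iff[OF that] ring_hom_closed[OF I.rcos_ring_hom that] by simp
      then show False using J.I_notcarr J.a_subset by blast
    qed
    fix A B assume A: "A \<in> carrier (R Quot I)" "B \<in> carrier (R Quot I)" "A \<otimes>\<^bsub>R Quot I\<^esub> B \<in> ?J"
    then obtain a b where ab: "a \<in> carrier R" "b \<in> carrier R" "A = I +> a" "B = I +> b"
      using surj by metis
    then have "I +> (a \<otimes> b) \<in> ?J" using A(3) ring_hom_mult[OF I.rcos_ring_hom ab(1,2)] by simp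
    then have "a \<otimes> b \<in> J" using iff[of "a \<otimes> b"] ab by simp
    then show "A \<in> ?J \<or> B \<in> ?J" using J.I_prime ab by blast
  qed
qed

lemma (in cring) quotient_prime_chain_iff:
  assumes I: "ideal I R"
  shows "(\<exists>C. (\<forall>i\<le>d. primeideal (C i) (R Quot I)) \<and> (\<forall>i<d. C i \<subset> C (Suc i))) \<longleftrightarrow>
    (\<exists>C. prime_chain R I d C)"
proof
  assume "\<exists>C. (\<forall>i\<le>d. primeideal (C i) (R Quot I)) \<and> (\<forall>i<d. C i \<subset> C (Suc i))"
  then obtain C where C: "\<And>i. i \<le> d \<Longrightarrow> primeideal (C i) (R Quot I)" "\<And>i. i < d \<Longrightarrow> C i \<subset> C (Suc i)"
    by blast
  have "{r \<in> carrier R. I +> r \<in> C i} \<subset> {r \<in> carrier R. I +> r \<in> C (Suc i)}" if i: "i < d" for i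
  proof -
    obtain A where A: "A \<in> C (Suc i)" "A \<notin> C i" using C(2)[OF i] by blast
    interpret C: primeideal "C (Suc i)" "R Quot I" using C(1)[of "Suc i"] i by simp
    obtain r where "r \<in> carrier R" "A = I +> r"
      using A(1) C.a_subset by (auto simp: FactRing_def A_RCOSETS_def')
    then show ?thesis using A C(2)[OF i] by auto
  qed
  then show "\<exists>C. prime_chain R I d C"
    unfolding prime_chain_def using quotient_prime_vimage[OF I C(1)]
    by (intro exI[of _ "\<lambda>i. {r \<in> carrier R. I +> r \<in> C i}"]) auto
next
  assume "\<exists>C. prime_chain R I d C"
  then obtain C where C: "\<And>i. i \<le> d \<Longrightarrow> primeideal (C i) R" "\<And>i. i \<le> d \<Longrightarrow> I \<subseteq> C i"
    "\<And>i. i < d \<Longrightarrow> C i \<subset> C (Suc i)" unfolding prime_chain_def by blast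
  have "(+>) I ` C i \<subset> (+>) I ` C (Suc i)" if i: "i < d" for i
  proof -
    obtain x where x: "x \<in> C (Suc i)" "x \<notin> C i" using C(3)[OF i] by blast
    interpret C: primeideal "C (Suc i)" R using C(1)[of "Suc i"] i by simp
    have "x \<in> carrier R" using x C.a_subset by blast
    then have "I +> x \<notin> (+>) I ` C i" using quotient_prime_image(2)[OF I C(1,2), of i x] i x by simp
    then show ?thesis using x C(3)[OF i] by blast
  qed
  then show "\<exists>C. (\<forall>i\<le>d. primeideal (C i) (R Quot I)) \<and> (\<forall>i<d. C i \<subset> C (Suc i))"
    using quotient_prime_image(1)[OF I C(1,2)] by (intro exI[of _ "\<lambda>i. (+>) I ` C i"]) auto
qed

lemma (in cring) krull_dim_quotient:
  assumes "ideal I R"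
  shows "krull_dim (R Quot I) = Sup {enat d | d. \<exists>C. prime_chain R I d C}"
  unfolding krull_dim_def quotient_prime_chain_iff[OF assms] ..

text \<open>A set of naturals with a finite supremum attains it unless the set is empty; the empty
  set has supremum 0, which \<open>d > 0\<close> excludes.\<close>

lemma Sup_enat_attained:
  assumes "Sup {enat d | d. P d} = enat d" "d > 0"
  shows "P d"
proof (rule ccontr)
  assume "\<not> P d"
  have "Sup {enat d | d. P d} \<le> enat (d - 1)"
  proof (rule Sup_least)
    fix x assume "x \<in> {enat d | d. P d}"
    then obtain e where e: "x = enat e" "P e" by blast
    then have "x \<le> enat d" using assms(1) by (metis (mono_tags, lifting) Sup_upper mem_Collect_eq)
    moreover have "e \<noteq> d" using \<open>\<not> P d\<close> e by blast
    ultimately show "x \<le> enat (d - 1)" using e by simp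
  qed
  then show False using assms by simp
qed

section \<open>Descent of largeness\<close>

context cring
begin

text \<open>The set is the kernel of evaluation at a + \<epsilon> v over the dual numbers. Being an
  ideal, it allows tangency to be tested on generators.\<close>

lemma tangent_poly_ideal:
  fixes a v :: "nat \<Rightarrow> 'a"
  assumes a: "a \<in> {..<n} \<rightarrow> carrier R" and v: "v \<in> {..<n} \<rightarrow> carrier R"
  shows "poly_ideal {..<n} (carrier R) {p \<in> indexed_pset {..<n} (carrier R). mpoly_eval R a p = \<zero> \<and>
    (\<Oplus>j\<in>{..<n}. mpoly_eval R a (formal_deriv R j p) \<otimes> v j) = \<zero>}"
proof -
  let ?P = "indexed_pset {..<n} (carrier R)"
  define lin where "lin p = (\<Oplus>j\<in>{..<n}. mpoly_eval R a (formal_deriv R j p) \<otimes> v j)" for p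
  note ker = poly_idealD[OF eval_kernel_poly_ideal[OF carrier_is_subring a]]
  have vj: "v j \<in> carrier R" and aj: "a j \<in> carrier R" if "j < n" for j using that v a by auto
  have cl: "mpoly_eval R a (formal_deriv R j p) \<in> carrier R" if "p \<in> ?P" for j p
    using mpoly_eval_closed[OF formal_deriv_indexed_pset[OF that] subset_refl a] .
  have coeff: "p m \<in> carrier R" if "p \<in> ?P" for p m using indexed_pset_coeff that by blast
  have lin_add: "lin (indexed_padd p q) = lin p \<oplus> lin q" if pq: "p \<in> ?P" "q \<in> ?P" for p q
  proof -
    have "mpoly_eval R a (formal_deriv R j (indexed_padd p q)) =
        mpoly_eval R a (formal_deriv R j p) \<oplus> mpoly_eval R a (formal_deriv R j q)" for j
      using formal_deriv_padd[of p q j] coeff pq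
        mpoly_eval_padd[OF formal_deriv_indexed_pset[OF pq(1)] formal_deriv_indexed_pset[OF pq(2)] subset_refl a]
      by simp
    then have "lin (indexed_padd p q) = (\<Oplus>j\<in>{..<n}. mpoly_eval R a (formal_deriv R j p) \<otimes> v j \<oplus>
        mpoly_eval R a (formal_deriv R j q) \<otimes> v j)"
      unfolding lin_def by (intro add.finprod_cong') (use cl pq vj in \<open>auto simp: l_distr\<close>)
    also have "\<dots> = lin p \<oplus> lin q"
      unfolding lin_def by (rule add.finprod_multf) (use cl pq vj in auto)
    finally show ?thesis .
  qed
  have lin_scale: "lin (\<lambda>m. c \<otimes> p m) = c \<otimes> lin p" if c: "c \<in> carrier R" "p \<in> ?P" for c p
  proof -
    have "formal_deriv R j (\<lambda>m. c \<otimes> p m) = (\<lambda>m. c \<otimes> formal_deriv R j p m)" for j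
      unfolding formal_deriv_def using add_pow_rdistr c coeff[OF c(2)] by (metis)
    then have "mpoly_eval R a (formal_deriv R j (\<lambda>m. c \<otimes> p m)) =
        c \<otimes> mpoly_eval R a (formal_deriv R j p)" for j
      using mpoly_eval_smult(2)[OF carrier_is_subring a c(1) formal_deriv_indexed_pset[OF c(2)]] by simp
    then have "lin (\<lambda>m. c \<otimes> p m) = (\<Oplus>j\<in>{..<n}. c \<otimes> (mpoly_eval R a (formal_deriv R j p) \<otimes> v j))"
      unfolding lin_def by (intro add.finprod_cong') (use cl c vj in \<open>auto simp: m_assoc\<close>)
    also have "\<dots> = c \<otimes> lin p"
      unfolding lin_def by (rule finsum_rdistr[symmetric]) (use cl c vj in auto)
    finally show ?thesis .
  qed
  have lin_pmult: "lin (indexed_pmult p i) = a i \<otimes> lin p"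
    if p: "p \<in> ?P" "mpoly_eval R a p = \<zero>" "i < n" for p i
  proof -
    let ?z = "indexed_const \<zero> :: nat multiset \<Rightarrow> 'a"
    have z: "?z \<in> ?P" by (simp add: indexed_pset.indexed_const)
    have "mpoly_eval R a (formal_deriv R j (indexed_pmult p i)) =
        a i \<otimes> mpoly_eval R a (formal_deriv R j p)" for j
    proof -
      let ?r = "if i = j then p else ?z"
      \<comment> \<open>The extra term of the product rule is \<open>p\<close> itself, which
        vanishes at \<open>a\<close>.\<close>
      have r: "?r \<in> ?P" "mpoly_eval R a ?r = \<zero>" using p z by auto
      have d: "formal_deriv R j p \<in> ?P" by (rule formal_deriv_indexed_pset[OF p(1)])
      have i: "i \<in> {..<n}" using p by simp
      have "mpoly_eval R a (formal_deriv R j (indexed_pmult p i)) =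
          mpoly_eval R a (indexed_pmult (formal_deriv R j p) i) \<oplus> mpoly_eval R a ?r"
        unfolding formal_deriv_pmult[of p, OF coeff[OF p(1)]]
        by (rule mpoly_eval_padd[OF indexed_pset.indexed_pmult[OF d i] r(1) subset_refl a])
      then show ?thesis
        using r(2) mpoly_eval_pmult[OF d subset_refl a i] cl[OF p(1), of j] aj[OF p(3)] by (simp add: m_comm)
    qed
    then have "lin (indexed_pmult p i) = (\<Oplus>j\<in>{..<n}. a i \<otimes> (mpoly_eval R a (formal_deriv R j p) \<otimes> v j))"
      unfolding lin_def by (intro add.finprod_cong') (use cl p vj aj in \<open>auto simp: m_assoc\<close>)
    also have "\<dots> = a i \<otimes> lin p"
      unfolding lin_def by (rule finsum_rdistr[symmetric]) (use cl p vj aj in auto)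
    finally show ?thesis .
  qed
  have lin0: "lin (indexed_const \<zero>) = \<zero>"
  proof -
    have "lin (indexed_const \<zero>) = (\<Oplus>j\<in>{..<n}. \<zero>)"
      unfolding lin_def formal_deriv_const by (intro add.finprod_cong') (use vj in auto)
    then show ?thesis by simp
  qed
  show ?thesis
    unfolding poly_ideal_def lin_def[symmetric]
    using ker(2-5) lin0 lin_add lin_scale lin_pmult aj by auto
qed

end

context ec_embedding
begin

lemma map_tangent:
  fixes a v :: "nat \<Rightarrow> 'a"
  assumes p: "p \<in> polyR {..<n}" and a: "a \<in> {..<n} \<rightarrow> carrier R" and v: "v \<in> {..<n} \<rightarrow> carrier R"
    and a': "\<And>j. j < n \<Longrightarrow> a' j = h (a j)" and v': "\<And>j. j < n \<Longrightarrow> v' j = h (v j)"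
  shows "(\<Oplus>\<^bsub>S\<^esub>j\<in>{..<n}. mpoly_eval S a' (formal_deriv S j (h \<circ> p)) \<otimes>\<^bsub>S\<^esub> v' j) =
    h (\<Oplus>\<^bsub>R\<^esub>j\<in>{..<n}. mpoly_eval R a (formal_deriv R j p) \<otimes>\<^bsub>R\<^esub> v j)"
proof -
  have cl: "mpoly_eval R a (formal_deriv R j p) \<in> carrier R" for j
    using R.mpoly_eval_closed[OF R.formal_deriv_indexed_pset[OF p] subset_refl a] .
  have coeff: "p m \<in> carrier R" for m using R.indexed_pset_coeff p by blast
  have ev: "mpoly_eval S a' (formal_deriv S j (h \<circ> p)) = h (mpoly_eval R a (formal_deriv R j p))" for j
    unfolding map_formal_deriv[OF coeff, symmetric]
    by (rule mpoly_eval_map[OF R.formal_deriv_indexed_pset[OF p] subset_refl a]) (use a' in auto)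
  have "h (\<Oplus>\<^bsub>R\<^esub>j\<in>{..<n}. mpoly_eval R a (formal_deriv R j p) \<otimes>\<^bsub>R\<^esub> v j) =
      (\<Oplus>\<^bsub>S\<^esub>j\<in>{..<n}. h (mpoly_eval R a (formal_deriv R j p) \<otimes>\<^bsub>R\<^esub> v j))"
    using cl v by (subst hom_finsum) (auto simp: comp_def)
  also have "\<dots> = (\<Oplus>\<^bsub>S\<^esub>j\<in>{..<n}. mpoly_eval S a' (formal_deriv S j (h \<circ> p)) \<otimes>\<^bsub>S\<^esub> v' j)"
    by (rule S.add.finprod_cong') (use cl v v' ev in \<open>auto simp: Pi_iff\<close>)
  finally show ?thesis ..
qed

text \<open>Chains of primes contract to \<open>R\<close> by means of the witnesses for their strictness, and extend to
  \<open>S\<close> because extending scalars preserves primes. This is how the dimension descends.\<close>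

theorem large_descent:
  fixes P :: "(nat multiset \<Rightarrow> 'c) set"
  assumes large: "large_field R" and P: "primeideal P (mpoly_ring S {..<n})"
    and G: "G \<subseteq> P" "\<And>J. S.poly_ideal {..<n} (carrier S) J \<Longrightarrow> G \<subseteq> J \<Longrightarrow> P \<subseteq> J"
      "\<And>q. q \<in> G \<Longrightarrow> \<exists>p\<in>polyR {..<n}. q = h \<circ> p"
    and a: "a \<in> rational_points S n P" "\<And>j. j < n \<Longrightarrow> a j \<in> h ` carrier R"
    and b: "b \<in> {..<d} \<rightarrow> tangent_space S n P a"
      "\<And>v. v \<in> tangent_space S n P a \<Longrightarrow> \<exists>!c. c \<in> {..<d} \<rightarrow>\<^sub>E carrier S \<and>
        (\<forall>j<n. v j = (\<Oplus>\<^bsub>S\<^esub>k\<in>{..<d}. c k \<otimes>\<^bsub>S\<^esub> b k j))"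
      "\<And>k j. k < d \<Longrightarrow> j < n \<Longrightarrow> b k j \<in> h ` carrier R"
    and dim: "variety_dim S n P = enat d"
    and C: "d > 0 \<Longrightarrow> prime_chain (mpoly_ring S {..<n}) P d C"
      "\<And>i. i < d \<Longrightarrow> \<exists>p\<in>polyR {..<n}. h \<circ> p \<in> C (Suc i) \<and> h \<circ> p \<notin> C i"
    and g: "g \<in> polyR {..<n}" "h \<circ> g \<notin> P"
  shows "\<exists>x\<in>rational_points S n P. mpoly_eval S x (h \<circ> g) \<noteq> \<zero>\<^bsub>S\<^esub>"
proof -
  let ?MR = "mpoly_ring R {..<n}" and ?MS = "mpoly_ring S {..<n}"
  interpret MR: cring ?MR by (rule R.mpoly_ring_cring)
  interpret MS: cring ?MS by (rule S.mpoly_ring_cring)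
  have hom: "ring_hom_ring ?MR ?MS ((\<circ>) h)"
    by (rule ring_hom_ringI2[OF MR.ring_axioms MS.ring_axioms map_mpoly_ring_hom])
  define con where "con D = {p \<in> carrier ?MR. h \<circ> p \<in> D}" for D
  have con: "primeideal (con D) ?MR" if "primeideal D ?MS" for D
    unfolding con_def by (rule ring_hom_ring.primeideal_vimage[OF hom MR.is_cring that])
  define Q where "Q = con P"
  have Q: "primeideal Q ?MR" unfolding Q_def by (rule con[OF P])
  have Q_iff: "p \<in> Q \<longleftrightarrow> h \<circ> p \<in> P" if "p \<in> polyR {..<n}" for p
    using that by (simp add: Q_def con_def R.mpoly_ring_simps)
  have QR: "Q \<subseteq> polyR {..<n}" by (auto simp: Q_def con_def R.mpoly_ring_simps)
  have Qi: "ideal Q ?MR" and Pi: "ideal P ?MS" using Q P primeideal.axioms(1) by auto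
  have PS: "P \<subseteq> polyS {..<n}" using S.poly_idealD(1)[OF S.ideal_imp_poly_ideal[OF Pi]] .
  have G_obtain: "\<exists>p\<in>Q. q = h \<circ> p" if "q \<in> G" for q using G(1) G(3)[OF that] Q_iff that by blast
  define i where "i = inv_into (carrier R) h"
  have i: "i x \<in> carrier R" "h (i x) = x" if "x \<in> h ` carrier R" for x
    using that unfolding i_def by (auto intro: inv_into_into f_inv_into_f)
  have hinj: "x = y" if "h x = h y" "x \<in> carrier R" "y \<in> carrier R" for x y
    using that inj by (meson inj_onD)
  define a0 where "a0 = restrict (i \<circ> a) {..<n}"
  have a0: "a0 \<in> {..<n} \<rightarrow>\<^sub>E carrier R" and ha0: "\<And>j. j < n \<Longrightarrow> a j = h (a0 j)"
    using i a(2) by (auto simp: a0_def)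
  have a0': "a0 \<in> {..<n} \<rightarrow> carrier R" using a0 by (auto simp: PiE_iff)
  have aS: "a \<in> {..<n} \<rightarrow> carrier S" using a(1) by (auto simp: rational_points_def PiE_iff)
  have eva: "mpoly_eval S a (h \<circ> p) = h (mpoly_eval R a0 p)" if "p \<in> polyR {..<n}" for p
    by (rule mpoly_eval_map[OF that subset_refl a0']) (use ha0 in auto)
  have a0Q: "a0 \<in> rational_points R n Q"
    unfolding rational_points_def
  proof (intro CollectI conjI ballI a0)
    fix p assume p: "p \<in> Q"
    then have "h (mpoly_eval R a0 p) = \<zero>\<^bsub>S\<^esub>"
      using eva a(1) QR Q_iff by (fastforce simp: rational_points_def)
    then show "mpoly_eval R a0 p = \<zero>\<^bsub>R\<^esub>"
      using R.mpoly_eval_closed[OF _ subset_refl a0'] p QR by (intro hinj) auto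
  qed
  have tangent: "v \<in> tangent_space R n Q a0 \<longleftrightarrow> v' \<in> tangent_space S n P a"
    if v: "v \<in> {..<n} \<rightarrow>\<^sub>E carrier R" "v' \<in> {..<n} \<rightarrow>\<^sub>E carrier S" and hv: "\<And>j. j < n \<Longrightarrow> v' j = h (v j)"
    for v v'
  proof -
    have v0: "v \<in> {..<n} \<rightarrow> carrier R" "v' \<in> {..<n} \<rightarrow> carrier S" using v by (auto simp: PiE_iff)
    have lin: "(\<Oplus>\<^bsub>S\<^esub>j\<in>{..<n}. mpoly_eval S a (formal_deriv S j (h \<circ> p)) \<otimes>\<^bsub>S\<^esub> v' j) =
        h (\<Oplus>\<^bsub>R\<^esub>j\<in>{..<n}. mpoly_eval R a0 (formal_deriv R j p) \<otimes>\<^bsub>R\<^esub> v j)"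
      if "p \<in> polyR {..<n}" for p
      by (rule map_tangent[OF that a0' v0(1) ha0 hv])
    have lin_cl: "(\<Oplus>\<^bsub>R\<^esub>j\<in>{..<n}. mpoly_eval R a0 (formal_deriv R j p) \<otimes>\<^bsub>R\<^esub> v j) \<in> carrier R"
      if "p \<in> polyR {..<n}" for p
      using R.mpoly_eval_closed[OF R.formal_deriv_indexed_pset[OF that] subset_refl a0'] v0
      by (intro R.finsum_closed) auto
    show ?thesis
    proof
      assume T: "v \<in> tangent_space R n Q a0"
      \<comment> \<open>An ideal by \<open>tangent_poly_ideal\<close>. It contains the generators
        \<open>G\<close>, which are images of elements of \<open>Q\<close>, and therefore all of
        \<open>P\<close>.\<close>
      let ?J = "{q \<in> polyS {..<n}. mpoly_eval S a q = \<zero>\<^bsub>S\<^esub> \<and>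
        (\<Oplus>\<^bsub>S\<^esub>j\<in>{..<n}. mpoly_eval S a (formal_deriv S j q) \<otimes>\<^bsub>S\<^esub> v' j) = \<zero>\<^bsub>S\<^esub>}"
      have "G \<subseteq> ?J"
      proof
        fix q assume q: "q \<in> G"
        then obtain p where p: "p \<in> Q" "q = h \<circ> p" using G_obtain by blast
        have pR: "p \<in> polyR {..<n}" using p QR by blast
        have "mpoly_eval S a q = \<zero>\<^bsub>S\<^esub>" using q G(1) a(1) by (auto simp: rational_points_def)
        moreover have "(\<Oplus>\<^bsub>S\<^esub>j\<in>{..<n}. mpoly_eval S a (formal_deriv S j q) \<otimes>\<^bsub>S\<^esub> v' j) = \<zero>\<^bsub>S\<^esub>"
          unfolding p(2) lin[OF pR] using T p(1) by (simp add: tangent_space_def)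
        ultimately show "q \<in> ?J" using q G(1) PS by blast
      qed
      then have "P \<subseteq> ?J" by (rule G(2)[OF S.tangent_poly_ideal[OF aS v0(2)]])
      then show "v' \<in> tangent_space S n P a" using v(2) by (auto simp: tangent_space_def)
    next
      assume T: "v' \<in> tangent_space S n P a"
      show "v \<in> tangent_space R n Q a0"
        unfolding tangent_space_def
      proof (intro CollectI conjI ballI v(1))
        fix p assume p: "p \<in> Q"
        then have pR: "p \<in> polyR {..<n}" and hp: "h \<circ> p \<in> P" using QR Q_iff by blast+
        have "h (\<Oplus>\<^bsub>R\<^esub>j\<in>{..<n}. mpoly_eval R a0 (formal_deriv R j p) \<otimes>\<^bsub>R\<^esub> v j) = \<zero>\<^bsub>S\<^esub>"
          using lin[OF pR] T hp by (simp add: tangent_space_def)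
        then show "(\<Oplus>\<^bsub>R\<^esub>j\<in>{..<n}. mpoly_eval R a0 (formal_deriv R j p) \<otimes>\<^bsub>R\<^esub> v j) = \<zero>\<^bsub>R\<^esub>"
          using lin_cl[OF pR] by (intro hinj) auto
      qed
    qed
  qed
  define b0 where "b0 k = restrict (i \<circ> b k) {..<n}" for k
  have b0: "b0 k \<in> {..<n} \<rightarrow>\<^sub>E carrier R" "\<And>j. j < n \<Longrightarrow> b k j = h (b0 k j)" if "k < d" for k
    using i b(3)[OF that] by (auto simp: b0_def)
  have bT: "b k \<in> tangent_space S n P a" if "k < d" for k using b(1) that by auto
  have b0T: "b0 k \<in> tangent_space R n Q a0" if "k < d" for k
    using tangent[OF b0(1)[OF that] _ b0(2)[OF that]] bT[OF that] by (auto simp: tangent_space_def)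
  have b0R: "b0 k j \<in> carrier R" if "k < d" "j < n" for k j
    using b0(1)[OF that(1)] that(2) by (auto simp: PiE_iff)
  have hsum: "h (\<Oplus>\<^bsub>R\<^esub>k\<in>{..<d}. c k \<otimes>\<^bsub>R\<^esub> b0 k j) = (\<Oplus>\<^bsub>S\<^esub>k\<in>{..<d}. c' k \<otimes>\<^bsub>S\<^esub> b k j)"
    if c: "\<And>k. k < d \<Longrightarrow> c k \<in> carrier R" "\<And>k. k < d \<Longrightarrow> c' k = h (c k)" and j: "j < n" for c c' j
  proof -
    have "h (\<Oplus>\<^bsub>R\<^esub>k\<in>{..<d}. c k \<otimes>\<^bsub>R\<^esub> b0 k j) = (\<Oplus>\<^bsub>S\<^esub>k\<in>{..<d}. h (c k \<otimes>\<^bsub>R\<^esub> b0 k j))"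
      using c(1) b0R j by (subst hom_finsum) (auto simp: comp_def)
    also have "\<dots> = (\<Oplus>\<^bsub>S\<^esub>k\<in>{..<d}. c' k \<otimes>\<^bsub>S\<^esub> b k j)"
      by (rule S.add.finprod_cong') (use c b0R b0(2) j in auto)
    finally show ?thesis .
  qed
  have dimR: "has_vector_dim R n (tangent_space R n Q a0) d"
    unfolding has_vector_dim_def
  proof (intro bexI[of _ b0] ballI)
    show "b0 \<in> {..<d} \<rightarrow> tangent_space R n Q a0" using b0T by auto
    fix v assume vT: "v \<in> tangent_space R n Q a0"
    then have v: "v \<in> {..<n} \<rightarrow>\<^sub>E carrier R" by (simp add: tangent_space_def)
    have vR: "v j \<in> carrier R" if "j < n" for j using v that by (auto simp: PiE_iff)
    define v' where "v' = restrict (h \<circ> v) {..<n}"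
    have v': "v' \<in> {..<n} \<rightarrow>\<^sub>E carrier S" "\<And>j. j < n \<Longrightarrow> v' j = h (v j)" using vR by (auto simp: v'_def)
    have v'T: "v' \<in> tangent_space S n P a" using tangent[OF v v'] vT by blast
    from ex1_implies_ex[OF b(2)[OF v'T]]
    obtain c where c: "c \<in> {..<d} \<rightarrow>\<^sub>E carrier S" "\<forall>j<n. v' j = (\<Oplus>\<^bsub>S\<^esub>k\<in>{..<d}. c k \<otimes>\<^bsub>S\<^esub> b k j)" by blast
    have uniq: "c' = c" if "c' \<in> {..<d} \<rightarrow>\<^sub>E carrier S" "\<forall>j<n. v' j = (\<Oplus>\<^bsub>S\<^esub>k\<in>{..<d}. c' k \<otimes>\<^bsub>S\<^esub> b k j)" for c'
      using b(2)[OF v'T] c that by blast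
    have cS: "c k \<in> carrier S" if "k < d" for k using c(1) that by (auto simp: PiE_iff)
    obtain A \<rho> where A: "subring A S" "h ` carrier R \<subseteq> A" "c ` {..<d} \<subseteq> A" "S.retraction A (h ` carrier R) \<rho>"
      using retraction_exists[of "c ` {..<d}"] cS by auto
    have \<rho>c: "\<rho> (c k) \<in> h ` carrier R" if "k < d" for k using A that by (auto simp: S.retraction_def)
    \<comment> \<open>The linear system for \<open>c\<close> is defined over the image of
      \<open>R\<close>, so a retraction maps its solution to a solution. Uniqueness over
      \<open>S\<close> makes \<open>c\<close> fixed by the retraction, hence defined over
      \<open>R\<close>.\<close>
    have "restrict (\<rho> \<circ> c) {..<d} = c"
    proof (rule uniq)
      show "restrict (\<rho> \<circ> c) {..<d} \<in> {..<d} \<rightarrow>\<^sub>E carrier S" using \<rho>c image_subset by auto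
      show "\<forall>j<n. v' j = (\<Oplus>\<^bsub>S\<^esub>k\<in>{..<d}. restrict (\<rho> \<circ> c) {..<d} k \<otimes>\<^bsub>S\<^esub> b k j)"
      proof (intro allI impI)
        fix j assume j: "j < n"
        have ck: "c k \<in> A" "b k j \<in> A" "\<rho> (b k j) = b k j" if "k < d" for k
          using A b(3)[OF that j] that by (auto simp: S.retraction_def)
        have "v' j = \<rho> (v' j)" using v'(2)[OF j] vR[OF j] A(4) by (auto simp: S.retraction_def)
        also have "\<dots> = \<rho> (\<Oplus>\<^bsub>S\<^esub>k\<in>{..<d}. c k \<otimes>\<^bsub>S\<^esub> b k j)" using c(2) j by simp
        also have "\<dots> = (\<Oplus>\<^bsub>S\<^esub>k\<in>{..<d}. \<rho> (c k \<otimes>\<^bsub>S\<^esub> b k j))"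
          using S.retraction_finsum[OF A(4,1) image_subring, of "{..<d}" "\<lambda>k. c k \<otimes>\<^bsub>S\<^esub> b k j"]
            ck subringE(6)[OF A(1)] by auto
        also have "\<dots> = (\<Oplus>\<^bsub>S\<^esub>k\<in>{..<d}. restrict (\<rho> \<circ> c) {..<d} k \<otimes>\<^bsub>S\<^esub> b k j)"
          using A(4) ck \<rho>c image_subset b(3)[OF _ j]
          by (intro S.add.finprod_cong') (auto simp: S.retraction_def subset_iff)
        finally show "v' j = (\<Oplus>\<^bsub>S\<^esub>k\<in>{..<d}. restrict (\<rho> \<circ> c) {..<d} k \<otimes>\<^bsub>S\<^esub> b k j)" .
      qed
    qed
    then have ch: "c k \<in> h ` carrier R" if "k < d" for k
      using \<rho>c[OF that] that by (metis comp_apply lessThan_iff restrict_apply')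
    define c0 where "c0 = restrict (i \<circ> c) {..<d}"
    have c0: "c0 \<in> {..<d} \<rightarrow>\<^sub>E carrier R" using i ch by (auto simp: c0_def)
    have c0k: "c0 k \<in> carrier R" "c k = h (c0 k)" if "k < d" for k
      using i[OF ch[OF that]] that by (auto simp: c0_def)
    show "\<exists>!c. c \<in> {..<d} \<rightarrow>\<^sub>E carrier R \<and> (\<forall>j<n. v j = (\<Oplus>\<^bsub>R\<^esub>k\<in>{..<d}. c k \<otimes>\<^bsub>R\<^esub> b0 k j))"
    proof (rule ex1I[of _ c0], intro conjI c0 allI impI)
      fix j assume j: "j < n"
      show "v j = (\<Oplus>\<^bsub>R\<^esub>k\<in>{..<d}. c0 k \<otimes>\<^bsub>R\<^esub> b0 k j)"
        using hsum[of c0 c j] c0k j c(2) v'(2) vR b0R by (intro hinj R.finsum_closed) auto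
    next
      fix c1 assume c1: "c1 \<in> {..<d} \<rightarrow>\<^sub>E carrier R \<and> (\<forall>j<n. v j = (\<Oplus>\<^bsub>R\<^esub>k\<in>{..<d}. c1 k \<otimes>\<^bsub>R\<^esub> b0 k j))"
      have c1k: "c1 k \<in> carrier R" if "k < d" for k using c1 that by (auto simp: PiE_iff)
      have "restrict (h \<circ> c1) {..<d} = c"
      proof (rule uniq)
        show "restrict (h \<circ> c1) {..<d} \<in> {..<d} \<rightarrow>\<^sub>E carrier S" using c1k by auto
        show "\<forall>j<n. v' j = (\<Oplus>\<^bsub>S\<^esub>k\<in>{..<d}. restrict (h \<circ> c1) {..<d} k \<otimes>\<^bsub>S\<^esub> b k j)"
          using hsum[of c1 "restrict (h \<circ> c1) {..<d}"] c1k c1 v'(2) by auto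
      qed
      then have "c1 k = c0 k" if "k < d" for k
        using c1k c0k that by (metis comp_apply hinj lessThan_iff restrict_apply')
      then show "c1 = c0" using c1 c0 by (intro PiE_ext[of c1 "{..<d}" "\<lambda>_. carrier R" c0]) auto
    qed
  qed
  have up: "\<exists>D. prime_chain ?MS P e D" if "prime_chain ?MR Q e D" for e D
  proof -
    have D: "primeideal (D k) ?MR" "Q \<subseteq> D k" if "k \<le> e" for k
      using \<open>prime_chain ?MR Q e D\<close> that by (auto simp: prime_chain_def)
    have Dp: "R.poly_ideal {..<n} (carrier R) (D k)" if "k \<le> e" for k
      using D(1)[OF that] by (intro R.ideal_imp_poly_ideal primeideal.axioms(1))
    \<comment> \<open>The generators of \<open>P\<close> are images of elements of \<open>Q\<close>,
      and \<open>Q\<close> is contained in every prime of the chain.\<close>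
    have "P \<subseteq> extension (D k)" if k: "k \<le> e" for k
    proof (rule G(2)[OF extension_poly_ideal[OF Dp[OF k]]])
      show "G \<subseteq> extension (D k)"
        using G_obtain D(2)[OF k] map_in_extension R.poly_idealD(1)[OF Dp[OF k]] by blast
    qed
    moreover have "extension (D k) \<subset> extension (D (Suc k))" if k: "k < e" for k
    proof -
      have sub: "D k \<subset> D (Suc k)" using \<open>prime_chain ?MR Q e D\<close> k by (simp add: prime_chain_def)
      have "q \<in> extension (D (Suc k))" if "q \<in> extension (D k)" for q
        using that
      proof induction
        case (step q c l)
        then show ?case using sub by (intro extension.step) auto
      qed (rule extension.zero)
      \<comment> \<open>Strictness survives because an extended ideal contracts to the ideal it came
        from.\<close>
      moreover obtain p where p: "p \<in> D (Suc k)" "p \<notin> D k" using sub by blast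
      have DS: "D (Suc k) \<subseteq> polyR {..<n}" using R.poly_idealD(1)[OF Dp[of "Suc k"]] k by simp
      have "h \<circ> p \<in> extension (D (Suc k))" by (rule map_in_extension[OF p(1) DS])
      moreover have "h \<circ> p \<notin> extension (D k)"
        using extension_contract[OF Dp[of k], of p] k p DS by auto
      ultimately show ?thesis by blast
    qed
    ultimately show ?thesis
      unfolding prime_chain_def using extension_prime[OF D(1)]
      by (intro exI[of _ "\<lambda>k. extension (D k)"]) auto
  qed
  have down: "prime_chain ?MR Q d (\<lambda>k. con (C k))" if d: "d > 0"
  proof -
    note C' = C(1)[OF d, unfolded prime_chain_def]
    have "con (C k) \<subset> con (C (Suc k))" if k: "k < d" for k
    proof -
      obtain p where "p \<in> polyR {..<n}" "h \<circ> p \<in> C (Suc k)" "h \<circ> p \<notin> C k" using C(2)[OF k] by blast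
      then have "p \<in> con (C (Suc k))" "p \<notin> con (C k)" by (auto simp: con_def R.mpoly_ring_simps)
      moreover have "con (C k) \<subseteq> con (C (Suc k))" using C' k by (auto simp: con_def)
      ultimately show ?thesis by blast
    qed
    moreover have "Q \<subseteq> con (C k)" if "k \<le> d" for k using C' that by (auto simp: Q_def con_def)
    ultimately show ?thesis unfolding prime_chain_def using C' con by auto
  qed
  have supS: "Sup {enat e | e. \<exists>D. prime_chain ?MS P e D} = enat d"
    using dim MS.krull_dim_quotient[OF Pi] by (simp add: variety_dim_def)
  have "Sup {enat e | e. \<exists>D. prime_chain ?MR Q e D} = enat d"
  proof (rule antisym)
    have "{enat e | e. \<exists>D. prime_chain ?MR Q e D} \<subseteq> {enat e | e. \<exists>D. prime_chain ?MS P e D}"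
      using up by blast
    then show "Sup {enat e | e. \<exists>D. prime_chain ?MR Q e D} \<le> enat d"
      unfolding supS[symmetric] by (rule Sup_subset_mono)
    show "enat d \<le> Sup {enat e | e. \<exists>D. prime_chain ?MR Q e D}"
    \<comment> \<open>For \<open>d = 0\<close> the bound is trivial; a chain over \<open>S\<close>
      is given for positive \<open>d\<close>.\<close>
    proof (cases "d = 0")
      case False
      then show ?thesis using down by (intro Sup_upper) blast
    qed (simp add: zero_enat_def[symmetric])
  qed
  then have "variety_dim R n Q = enat d"
    using MR.krull_dim_quotient[OF Qi] by (simp add: variety_dim_def)
  then have "smooth_rational_point R n Q a0"
    unfolding smooth_rational_point_def using a0Q dimR by blast
  then have "rational_points_dense R n Q"
    using large Q unfolding large_field_def irreducible_affine_variety_def by blast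
  moreover have "g \<in> carrier ?MR - Q" using g Q_iff by (simp add: R.mpoly_ring_simps)
  ultimately obtain x where x: "x \<in> rational_points R n Q" "mpoly_eval R x g \<noteq> \<zero>\<^bsub>R\<^esub>"
    unfolding rational_points_dense_def by blast
  have xR: "x \<in> {..<n} \<rightarrow> carrier R" using x(1) by (auto simp: rational_points_def PiE_iff)
  define x' where "x' = restrict (h \<circ> x) {..<n}"
  have x': "x' \<in> {..<n} \<rightarrow>\<^sub>E carrier S" using xR by (auto simp: x'_def Pi_iff)
  then have x'S: "x' \<in> {..<n} \<rightarrow> carrier S" by (auto simp: PiE_iff)
  have evx: "mpoly_eval S x' (h \<circ> p) = h (mpoly_eval R x p)" if "p \<in> polyR {..<n}" for p
    by (rule mpoly_eval_map[OF that subset_refl xR]) (simp add: x'_def)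
  \<comment> \<open>The image of \<open>x\<close> is a zero of the generators of \<open>P\<close>,
    hence a point of the whole variety over \<open>S\<close>.\<close>
  have "P \<subseteq> {q \<in> polyS {..<n}. mpoly_eval S x' q = \<zero>\<^bsub>S\<^esub>}"
  proof (rule G(2)[OF S.eval_kernel_poly_ideal[OF S.carrier_is_subring x'S]])
    show "G \<subseteq> {q \<in> polyS {..<n}. mpoly_eval S x' q = \<zero>\<^bsub>S\<^esub>}"
    proof
      fix q assume q: "q \<in> G"
      then obtain p where p: "p \<in> Q" "q = h \<circ> p" using G_obtain by blast
      then have "mpoly_eval S x' q = \<zero>\<^bsub>S\<^esub>"
        using evx QR x(1) by (auto simp: rational_points_def)
      then show "q \<in> {q \<in> polyS {..<n}. mpoly_eval S x' q = \<zero>\<^bsub>S\<^esub>}" using q G(1) PS by blast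
    qed
  qed
  then have "x' \<in> rational_points S n P" using x' by (auto simp: rational_points_def)
  moreover have "mpoly_eval S x' (h \<circ> g) \<noteq> \<zero>\<^bsub>S\<^esub>"
  proof
    assume "mpoly_eval S x' (h \<circ> g) = \<zero>\<^bsub>S\<^esub>"
    then have "h (mpoly_eval R x g) = h \<zero>\<^bsub>R\<^esub>" using evx[OF g(1)] by simp
    then have "mpoly_eval R x g = \<zero>\<^bsub>R\<^esub>"
      using R.mpoly_eval_closed[OF g(1) subset_refl xR] by (intro hinj) auto
    with x(2) show False by simp
  qed
  ultimately show ?thesis by blast
qed

end

section \<open>Direct limits\<close>

lemma (in ring) indexed_pset_finite_coeffs:
  assumes "p \<in> indexed_pset V F"
  shows "\<exists>Y\<subseteq>F. finite Y \<and> p \<in> indexed_pset V Y"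
  using assms
proof induction
  case (indexed_const k)
  then show ?case by (intro exI[of _ "{k}"]) (auto intro: indexed_pset.indexed_const)
next
  case (indexed_padd p q)
  then obtain Y Z where "Y \<subseteq> F" "finite Y" "p \<in> indexed_pset V Y" "Z \<subseteq> F" "finite Z" "q \<in> indexed_pset V Z"
    by blast
  then show ?case
    using indexed_pset_mono[of Y "Y \<union> Z" V V] indexed_pset_mono[of Z "Y \<union> Z" V V]
    by (intro exI[of _ "Y \<union> Z"]) (auto intro: indexed_pset.indexed_padd)
next
  case (indexed_pmult p i)
  then show ?case by (auto intro: indexed_pset.indexed_pmult)
qed

lemma (in ring) finite_polys_finite_coeffs:
  assumes "finite S" "S \<subseteq> indexed_pset V F"
  shows "\<exists>Y\<subseteq>F. finite Y \<and> S \<subseteq> indexed_pset V Y"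
  using assms
proof (induction S)
  case (insert p S)
  then obtain Y where Y: "Y \<subseteq> F" "finite Y" "S \<subseteq> indexed_pset V Y" by auto
  obtain Z where Z: "Z \<subseteq> F" "finite Z" "p \<in> indexed_pset V Z"
    using indexed_pset_finite_coeffs insert.prems by blast
  show ?case
    using Y Z indexed_pset_mono[of Y "Y \<union> Z" V V] indexed_pset_mono[of Z "Y \<union> Z" V V]
    by (intro exI[of _ "Y \<union> Z"]) auto
qed auto

text \<open>A solution in \<open>M\<close> is replaced by one in the image of \<open>L\<close>,
  pulled back to \<open>L\<close>, and there replaced by one in \<open>F\<close>.\<close>

lemma ec_as_field_trans:
  assumes L: "field L" and M: "field M" and h: "h \<in> ring_hom L M" "inj_on h (carrier L)"
    and F: "ec_as_field F L" and ec: "ec_as_field (h ` carrier L) M"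
  shows "ec_as_field (h ` F) M"
proof -
  interpret L: field L by fact
  interpret M: field M by fact
  interpret ring_hom_cring L M h by unfold_locales (rule h(1))
  have FL: "subfield F L" "F \<subseteq> carrier L" using F subfieldE(3) by (auto simp: ec_as_field_def)
  have sub: "subfield (h ` F) M"
    by (rule ring_hom_ring.img_is_subfield(2)[OF _ FL(1) M.one_not_zero])
      (rule ring_hom_ringI2[OF L.ring_axioms M.ring_axioms h(1)])
  show ?thesis
    unfolding ec_as_field_def
  proof (intro conjI sub allI impI; elim conjE)
    fix n and S :: "(nat multiset \<Rightarrow> _) set"
    assume S: "finite S" "S \<subseteq> M.indexed_pset {..<n} (h ` F)"
      and ex: "\<exists>a\<in>{..<n} \<rightarrow> carrier M. \<forall>p\<in>S. mpoly_eval M a p = \<zero>\<^bsub>M\<^esub>"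
    have "h ` F \<subseteq> h ` carrier L" using FL by blast
    then have "S \<subseteq> M.indexed_pset {..<n} (h ` carrier L)"
      using S(2) M.indexed_pset_mono[of "h ` F" "h ` carrier L" "{..<n}" "{..<n}"] by blast
    then obtain b where b: "b \<in> {..<n} \<rightarrow> h ` carrier L" "\<forall>p\<in>S. mpoly_eval M b p = \<zero>\<^bsub>M\<^esub>"
      using ec S(1) ex unfolding ec_as_field_def by blast
    define c where "c = inv_into (carrier L) h \<circ> b"
    have "b j \<in> h ` carrier L" if "j < n" for j using b(1) that by auto
    then have c: "c j \<in> carrier L" "b j = h (c j)" if "j < n" for j
      unfolding c_def using that by (auto intro: inv_into_into simp: f_inv_into_f)
    have cL: "c \<in> {..<n} \<rightarrow> carrier L" using c by auto
    \<comment> \<open>All preimages of the system over \<open>F\<close>; a finite part covering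
      \<open>S\<close> is selected below, since existential closedness applies to finite
      systems.\<close>
    define T where "T = {p \<in> L.indexed_pset {..<n} F. h \<circ> p \<in> S}"
    have T: "\<exists>p\<in>T. q = h \<circ> p" if "q \<in> S" for q
      using indexed_pset_image_obtain[of q "{..<n}" F] S(2) that FL(2) unfolding T_def by blast
    have ev: "mpoly_eval M x' (h \<circ> p) = h (mpoly_eval L x p)"
      if "p \<in> L.indexed_pset {..<n} F" "x \<in> {..<n} \<rightarrow> carrier L" "\<And>j. j < n \<Longrightarrow> x' j = h (x j)" for p x x'
      by (rule mpoly_eval_map[OF that(1) FL(2) that(2)]) (use that(3) in auto)
    have "mpoly_eval L c p = \<zero>\<^bsub>L\<^esub>" if p: "p \<in> T" for p
    proof -
      have "h (mpoly_eval L c p) = h \<zero>\<^bsub>L\<^esub>"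
        using ev[of p c b] p b(2) c cL by (auto simp: T_def)
      then show ?thesis
        using L.mpoly_eval_closed[of p "{..<n}" F c] p FL(2) cL h(2) by (auto simp: T_def inj_on_def)
    qed
    moreover obtain T' where T': "finite T'" "T' \<subseteq> T" "S \<subseteq> (\<circ>) h ` T'"
    proof -
      have "S \<subseteq> (\<circ>) h ` T" using T by blast
      from finite_subset_image[OF S(1) this] show thesis using that by blast
    qed
    ultimately obtain x where x: "x \<in> {..<n} \<rightarrow> F" "\<forall>p\<in>T'. mpoly_eval L x p = \<zero>\<^bsub>L\<^esub>"
    proof -
      assume *: "\<And>p. p \<in> T \<Longrightarrow> mpoly_eval L c p = \<zero>\<^bsub>L\<^esub>"
      assume **: "\<And>x. x \<in> {..<n} \<rightarrow> F \<Longrightarrow> \<forall>p\<in>T'. mpoly_eval L x p = \<zero>\<^bsub>L\<^esub> \<Longrightarrow> thesis"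
      have "finite T' \<and> T' \<subseteq> L.indexed_pset {..<n} F \<and>
          (\<exists>a\<in>{..<n} \<rightarrow> carrier L. \<forall>p\<in>T'. mpoly_eval L a p = \<zero>\<^bsub>L\<^esub>)"
        using T' * cL by (auto simp: T_def)
      then have "\<exists>x\<in>{..<n} \<rightarrow> F. \<forall>p\<in>T'. mpoly_eval L x p = \<zero>\<^bsub>L\<^esub>"
        using F unfolding ec_as_field_def by blast
      then show thesis using ** by blast
    qed
    show "\<exists>a\<in>{..<n} \<rightarrow> h ` F. \<forall>p\<in>S. mpoly_eval M a p = \<zero>\<^bsub>M\<^esub>"
    proof (intro bexI[of _ "h \<circ> x"] ballI)
      show "h \<circ> x \<in> {..<n} \<rightarrow> h ` F" using x(1) by auto
      fix q assume "q \<in> S"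
      then obtain p where p: "p \<in> T'" "q = h \<circ> p" using T'(3) by blast
      have "x \<in> {..<n} \<rightarrow> carrier L" using x(1) FL(2) by auto
      then show "mpoly_eval M (h \<circ> x) q = \<zero>\<^bsub>M\<^esub>"
        using ev[of p x "h \<circ> x"] p T'(2) x(2) by (auto simp: T_def)
    qed
  qed
qed

section \<open>The direct limit as a differential field\<close>

context differential_directed_system
begin

definition cls :: "'i \<Rightarrow> 'a \<Rightarrow> ('i \<times> 'a) set"
  where "cls i x = limit_rel I (\<preceq>) K f `` {(i, x)}"

abbreviation Lim :: "(('i \<times> 'a) set, 'm) diff_ring"
  where "Lim \<equiv> direct_limit I (\<preceq>) K f"

lemma f_hom:
  assumes "i \<in> I" "j \<in> I" "i \<preceq> j"
  shows "f i j \<in> ring_hom (K i) (K j)" "inj_on (f i j) (carrier (K i))"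
    "\<And>d x. x \<in> carrier (K i) \<Longrightarrow> f i j (der (K i) d x) = der (K j) d (f i j x)"
    "\<And>x. x \<in> carrier (K i) \<Longrightarrow> f i j x \<in> carrier (K j)"
  using differential_embeddingD[OF embedding[OF assms]] by blast+

lemma mem_cls:
  "(j, y) \<in> cls i x \<longleftrightarrow> i \<in> I \<and> x \<in> carrier (K i) \<and> j \<in> I \<and> y \<in> carrier (K j) \<and>
    (\<exists>k\<in>I. i \<preceq> k \<and> j \<preceq> k \<and> f i k x = f j k y)"
  by (auto simp: cls_def limit_rel_def)

lemma limit_rel_equiv: "equiv (SIGMA i:I. carrier (K i)) (limit_rel I (\<preceq>) K f)"
proof (rule equivI)
  show "limit_rel I (\<preceq>) K f \<subseteq> (SIGMA i:I. carrier (K i)) \<times> (SIGMA i:I. carrier (K i))"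
    by (auto simp: limit_rel_def)
  show "refl_on (SIGMA i:I. carrier (K i)) (limit_rel I (\<preceq>) K f)"
    unfolding refl_on_def using le_refl by (fastforce simp: limit_rel_def)
  show "sym (limit_rel I (\<preceq>) K f)"
    unfolding sym_def limit_rel_def by force
  show "trans (limit_rel I (\<preceq>) K f)"
  proof (rule transI)
    fix u v w assume "(u, v) \<in> limit_rel I (\<preceq>) K f" "(v, w) \<in> limit_rel I (\<preceq>) K f"
    then obtain i x j y l z k k' where *: "u = (i, x)" "v = (j, y)" "w = (l, z)" "i \<in> I" "j \<in> I" "l \<in> I"
      "x \<in> carrier (K i)" "y \<in> carrier (K j)" "z \<in> carrier (K l)" "k \<in> I" "i \<preceq> k" "j \<preceq> k"
      "f i k x = f j k y" "k' \<in> I" "j \<preceq> k'" "l \<preceq> k'" "f j k' y = f l k' z"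
      by (auto simp: limit_rel_def)
    obtain m where m: "m \<in> I" "k \<preceq> m" "k' \<preceq> m" using directed * by blast
    have "f i m x = f j m y" using map_comp[of i k m x] map_comp[of j k m y] * m by simp
    also have "\<dots> = f l m z" using map_comp[of j k' m y] map_comp[of l k' m z] * m by simp
    finally have "f i m x = f l m z" .
    moreover have "i \<preceq> m" "l \<preceq> m" using le_trans * m by blast+
    ultimately show "(u, w) \<in> limit_rel I (\<preceq>) K f" using * m by (auto simp: limit_rel_def)
  qed
qed

lemma cls_eq_iff:
  assumes "i \<in> I" "x \<in> carrier (K i)" "j \<in> I" "y \<in> carrier (K j)"
  shows "cls i x = cls j y \<longleftrightarrow> (j, y) \<in> cls i x"
  unfolding cls_def using eq_equiv_class_iff[OF limit_rel_equiv, of "(i, x)" "(j, y)"] assms by simp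

lemma cls_self: "i \<in> I \<Longrightarrow> x \<in> carrier (K i) \<Longrightarrow> (i, x) \<in> cls i x"
  using le_refl by (auto simp: mem_cls)

lemma cls_up:
  assumes "i \<in> I" "j \<in> I" "i \<preceq> j" "x \<in> carrier (K i)"
  shows "cls j (f i j x) = cls i x"
proof -
  have "(j, f i j x) \<in> cls i x"
    using assms le_refl map_id f_hom(4)[OF assms(1-3)] by (auto simp: mem_cls intro!: bexI[of _ j])
  then show ?thesis
    using cls_eq_iff[OF assms(1,4,2) f_hom(4)[OF assms(1-3) assms(4)]] by simp
qed

lemma cls_inj:
  assumes "i \<in> I" "x \<in> carrier (K i)" "y \<in> carrier (K i)" "cls i x = cls i y"
  shows "x = y"
proof -
  obtain k where "k \<in> I" "i \<preceq> k" "f i k x = f i k y"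
    using assms cls_eq_iff[of i x i y] by (auto simp: mem_cls)
  then show ?thesis using f_hom(2)[of i k] assms by (auto simp: inj_on_def)
qed

text \<open>The two identifications may take place at different indices; directedness moves both to
  one index, as a binary operation requires.\<close>

lemma cls_common:
  assumes "(j, y) \<in> cls i x" "(j, z) \<in> cls i w"
  obtains k where "k \<in> I" "i \<preceq> k" "j \<preceq> k" "f i k x = f j k y" "f i k w = f j k z"
    "x \<in> carrier (K i)" "y \<in> carrier (K j)" "w \<in> carrier (K i)" "z \<in> carrier (K j)" "i \<in> I" "j \<in> I"
proof -
  obtain k k' where *: "i \<in> I" "j \<in> I" "x \<in> carrier (K i)" "y \<in> carrier (K j)" "w \<in> carrier (K i)"
    "z \<in> carrier (K j)" "k \<in> I" "i \<preceq> k" "j \<preceq> k" "f i k x = f j k y" "k' \<in> I" "i \<preceq> k'" "j \<preceq> k'"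
    "f i k' w = f j k' z"
    using assms by (auto simp: mem_cls)
  obtain m where m: "m \<in> I" "k \<preceq> m" "k' \<preceq> m" using directed * by blast
  have "f i m x = f j m y" using map_comp[of i k m x] map_comp[of j k m y] * m by simp
  moreover have "f i m w = f j m z" using map_comp[of i k' m w] map_comp[of j k' m z] * m by simp
  moreover have "i \<preceq> m" "j \<preceq> m" using le_trans * m by blast+
  ultimately show thesis using that[of m] * m by simp
qed

lemma Lim_carrier: "carrier Lim = (\<Union>i\<in>I. cls i ` carrier (K i))"
  by (auto simp: direct_limit_def Let_def quotient_def cls_def)

lemma Lim_closed: "i \<in> I \<Longrightarrow> x \<in> carrier (K i) \<Longrightarrow> cls i x \<in> carrier Lim"
  by (auto simp: Lim_carrier)

lemma Union_const_eq: "A \<in> \<A> \<Longrightarrow> (\<And>B. B \<in> \<A> \<Longrightarrow> B = A) \<Longrightarrow> \<Union>\<A> = A"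
  by blast

text \<open>Representatives at different indices agree further up, and the transition maps respect
  the operation; so every class in the union is the same. Addition and multiplication are
  instances.\<close>

lemma Lim_binary:
  assumes op: "\<And>j x y. \<lbrakk>j \<in> I; x \<in> carrier (K j); y \<in> carrier (K j)\<rbrakk> \<Longrightarrow> op j x y \<in> carrier (K j)"
    "\<And>j k x y. \<lbrakk>j \<in> I; k \<in> I; j \<preceq> k; x \<in> carrier (K j); y \<in> carrier (K j)\<rbrakk> \<Longrightarrow>
      f j k (op j x y) = op k (f j k x) (f j k y)"
    and i: "i \<in> I" "x \<in> carrier (K i)" "y \<in> carrier (K i)"
  shows "\<Union>{cls k (op k x' y') | k x' y'. (k, x') \<in> cls i x \<and> (k, y') \<in> cls i y} = cls i (op i x y)"
proof (rule Union_const_eq)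
  show "cls i (op i x y) \<in> {cls k (op k x' y') | k x' y'. (k, x') \<in> cls i x \<and> (k, y') \<in> cls i y}"
    using cls_self i by blast
  fix B assume "B \<in> {cls k (op k x' y') | k x' y'. (k, x') \<in> cls i x \<and> (k, y') \<in> cls i y}"
  then obtain j x' y' where B: "B = cls j (op j x' y')" "(j, x') \<in> cls i x" "(j, y') \<in> cls i y" by blast
  from cls_common[OF B(2,3)] obtain k where k: "k \<in> I" "i \<preceq> k" "j \<preceq> k" "f i k x = f j k x'"
    "f i k y = f j k y'" "x' \<in> carrier (K j)" "y' \<in> carrier (K j)" "j \<in> I" by metis
  have "B = cls k (f j k (op j x' y'))" unfolding B(1) using cls_up k op(1) by simp
  also have "\<dots> = cls k (f i k (op i x y))" using op(2) k i by simp
  also have "\<dots> = cls i (op i x y)" using cls_up k i op(1) by simp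
  finally show "B = cls i (op i x y)" .
qed

lemma K_field: "i \<in> I \<Longrightarrow> field (K i)"
  using differential_field.axioms(1)[OF diff_field] .

lemmas K_ring = field.is_ring[OF K_field]

lemma Lim_mult:
  assumes "i \<in> I" "x \<in> carrier (K i)" "y \<in> carrier (K i)"
  shows "cls i x \<otimes>\<^bsub>Lim\<^esub> cls i y = cls i (x \<otimes>\<^bsub>K i\<^esub> y)"
proof -
  have "cls i x \<otimes>\<^bsub>Lim\<^esub> cls i y =
      \<Union>{cls k (x' \<otimes>\<^bsub>K k\<^esub> y') | k x' y'. (k, x') \<in> cls i x \<and> (k, y') \<in> cls i y}"
    by (simp add: direct_limit_def Let_def cls_def)
  also have "\<dots> = cls i (x \<otimes>\<^bsub>K i\<^esub> y)"
    by (rule Lim_binary[of "\<lambda>k. monoid.mult (K k)"])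
      (use assms f_hom(1) K_ring in \<open>auto intro: ring.ring_simprules(5) ring_hom_mult\<close>)
  finally show ?thesis .
qed

lemma Lim_add:
  assumes "i \<in> I" "x \<in> carrier (K i)" "y \<in> carrier (K i)"
  shows "cls i x \<oplus>\<^bsub>Lim\<^esub> cls i y = cls i (x \<oplus>\<^bsub>K i\<^esub> y)"
proof -
  have "cls i x \<oplus>\<^bsub>Lim\<^esub> cls i y =
      \<Union>{cls k (x' \<oplus>\<^bsub>K k\<^esub> y') | k x' y'. (k, x') \<in> cls i x \<and> (k, y') \<in> cls i y}"
    by (simp add: direct_limit_def Let_def cls_def)
  also have "\<dots> = cls i (x \<oplus>\<^bsub>K i\<^esub> y)"
    by (rule Lim_binary[of "\<lambda>k. ring.add (K k)"])
      (use assms f_hom(1) K_ring in \<open>auto intro: ring.ring_simprules(1) ring_hom_add\<close>)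
  finally show ?thesis .
qed

lemma Lim_der:
  assumes "i \<in> I" "x \<in> carrier (K i)"
  shows "der Lim d (cls i x) = cls i (der (K i) d x)"
proof -
  have "der Lim d (cls i x) = \<Union>{cls k (der (K k) d x') | k x'. (k, x') \<in> cls i x}"
    by (simp add: direct_limit_def Let_def cls_def)
  also have "\<dots> = cls i (der (K i) d x)"
  proof (rule Union_const_eq)
    show "cls i (der (K i) d x) \<in> {cls k (der (K k) d x') | k x'. (k, x') \<in> cls i x}"
      using cls_self assms by blast
    fix B assume "B \<in> {cls k (der (K k) d x') | k x'. (k, x') \<in> cls i x}"
    then obtain j x' where B: "B = cls j (der (K j) d x')" "(j, x') \<in> cls i x" by blast
    then obtain k where k: "k \<in> I" "i \<preceq> k" "j \<preceq> k" "f i k x = f j k x'" "x' \<in> carrier (K j)" "j \<in> I"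
      by (auto simp: mem_cls)
    interpret Ki: differential_field "K i" using diff_field assms by blast
    interpret Kj: differential_field "K j" using diff_field k by blast
    have "B = cls k (f j k (der (K j) d x'))" unfolding B(1) using cls_up k Kj.der_closed by simp
    also have "\<dots> = cls k (f i k (der (K i) d x))"
      using f_hom(3)[of j k] f_hom(3)[of i k] k assms by simp
    also have "\<dots> = cls i (der (K i) d x)" using cls_up k assms Ki.der_closed by simp
    finally show "B = cls i (der (K i) d x)" .
  qed
  finally show ?thesis .
qed

lemma Lim_const:
  assumes c: "\<And>i. i \<in> I \<Longrightarrow> c i \<in> carrier (K i)" "\<And>i j. i \<in> I \<Longrightarrow> j \<in> I \<Longrightarrow> i \<preceq> j \<Longrightarrow> f i j (c i) = c j"
    and i: "i \<in> I"
  shows "(\<Union>k\<in>I. cls k (c k)) = cls i (c i)"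
proof (rule Union_const_eq)
  show "cls i (c i) \<in> (\<lambda>k. cls k (c k)) ` I" using i by blast
  fix B assume "B \<in> (\<lambda>k. cls k (c k)) ` I"
  then obtain j where j: "j \<in> I" "B = cls j (c j)" by blast
  obtain k where k: "k \<in> I" "i \<preceq> k" "j \<preceq> k" using directed i j by blast
  have "B = cls k (f j k (c j))" using cls_up[of j k "c j"] j k c(1) by simp
  also have "\<dots> = cls i (c i)" using cls_up[of i k "c i"] c i j k by simp
  finally show "B = cls i (c i)" .
qed

lemma Lim_one:
  assumes "i \<in> I"
  shows "\<one>\<^bsub>Lim\<^esub> = cls i \<one>\<^bsub>K i\<^esub>"
proof -
  have "\<one>\<^bsub>Lim\<^esub> = (\<Union>k\<in>I. cls k \<one>\<^bsub>K k\<^esub>)" by (simp add: direct_limit_def Let_def cls_def)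
  also have "\<dots> = cls i \<one>\<^bsub>K i\<^esub>"
  proof (rule Lim_const[OF _ _ assms])
    show "\<one>\<^bsub>K i\<^esub> \<in> carrier (K i)" if "i \<in> I" for i
      using K_ring[OF that] by (simp add: ring.ring_simprules)
    show "f i j \<one>\<^bsub>K i\<^esub> = \<one>\<^bsub>K j\<^esub>" if "i \<in> I" "j \<in> I" "i \<preceq> j" for i j
      by (rule ring_hom_one[OF f_hom(1)[OF that]])
  qed
  finally show ?thesis .
qed

lemma Lim_zero:
  assumes "i \<in> I"
  shows "\<zero>\<^bsub>Lim\<^esub> = cls i \<zero>\<^bsub>K i\<^esub>"
proof -
  have "\<zero>\<^bsub>Lim\<^esub> = (\<Union>k\<in>I. cls k \<zero>\<^bsub>K k\<^esub>)" by (simp add: direct_limit_def Let_def cls_def)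
  also have "\<dots> = cls i \<zero>\<^bsub>K i\<^esub>"
  proof (rule Lim_const[OF _ _ assms])
    show "\<zero>\<^bsub>K i\<^esub> \<in> carrier (K i)" if "i \<in> I" for i
      using K_ring[OF that] by (simp add: ring.ring_simprules)
    show "f i j \<zero>\<^bsub>K i\<^esub> = \<zero>\<^bsub>K j\<^esub>" if "i \<in> I" "j \<in> I" "i \<preceq> j" for i j
      using ring_hom_zero[OF f_hom(1)[OF that]] K_ring that by blast
  qed
  finally show ?thesis .
qed

text \<open>By directedness finitely many elements of the limit come from a single member. This is
  what turns finite data over the limit into data over some \<open>K k\<close>.\<close>

lemma Lim_common:
  assumes "finite Y" "Y \<subseteq> carrier Lim"
  obtains k where "k \<in> I" "Y \<subseteq> cls k ` carrier (K k)"
proof -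
  have "\<exists>k\<in>I. Y \<subseteq> cls k ` carrier (K k)"
    using assms
  proof (induction Y)
    case empty
    then show ?case using index_nonempty by blast
  next
    case (insert A Y)
    then obtain k where k: "k \<in> I" "Y \<subseteq> cls k ` carrier (K k)" by auto
    obtain i x where i: "i \<in> I" "x \<in> carrier (K i)" "A = cls i x" using insert.prems by (auto simp: Lim_carrier)
    obtain m where m: "m \<in> I" "k \<preceq> m" "i \<preceq> m" using directed k i by blast
    have "cls j y \<in> cls m ` carrier (K m)" if "j \<in> I" "j \<preceq> m" "y \<in> carrier (K j)" for j y
      using cls_up[of j m y] f_hom(4)[of j m y] that m(1) by (metis imageI)
    then show ?case using k i m by (intro bexI[of _ m]) auto
  qed
  with that show thesis by blast
qed

lemma Lim_obtain2:
  assumes "A \<in> carrier Lim" "B \<in> carrier Lim"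
  obtains k x y where "k \<in> I" "x \<in> carrier (K k)" "y \<in> carrier (K k)" "A = cls k x" "B = cls k y"
proof -
  have "finite {A, B}" "{A, B} \<subseteq> carrier Lim" using assms by auto
  from Lim_common[OF this] obtain k where "k \<in> I" "{A, B} \<subseteq> cls k ` carrier (K k)" .
  then show thesis using that[of k] by auto
qed

lemma Lim_obtain3:
  assumes "A \<in> carrier Lim" "B \<in> carrier Lim" "C \<in> carrier Lim"
  obtains k x y z where "k \<in> I" "x \<in> carrier (K k)" "y \<in> carrier (K k)" "z \<in> carrier (K k)"
    "A = cls k x" "B = cls k y" "C = cls k z"
proof -
  have "finite {A, B, C}" "{A, B, C} \<subseteq> carrier Lim" using assms by auto
  from Lim_common[OF this] obtain k where "k \<in> I" "{A, B, C} \<subseteq> cls k ` carrier (K k)" .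
  then show thesis using that[of k] by auto
qed

text \<open>Each axiom involves at most three elements, which have representatives at a common index
  where the axiom holds.\<close>

lemma Lim_cring: "cring Lim"
proof (rule cringI)
  note cl = Lim_closed
  show "abelian_group Lim"
  proof (rule abelian_groupI)
    fix A B C
    assume A: "A \<in> carrier Lim"
    obtain k x where k: "k \<in> I" "x \<in> carrier (K k)" "A = cls k x" using A by (auto simp: Lim_carrier)
    interpret k: field "K k" by (rule K_field[OF k(1)])
    show "\<zero>\<^bsub>Lim\<^esub> \<oplus>\<^bsub>Lim\<^esub> A = A" using k by (simp add: Lim_zero[OF k(1)] Lim_add)
    have "cls k (\<ominus>\<^bsub>K k\<^esub> x) \<oplus>\<^bsub>Lim\<^esub> A = \<zero>\<^bsub>Lim\<^esub>"
      using k by (simp add: Lim_zero[OF k(1)] Lim_add k.l_neg)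
    then show "\<exists>B\<in>carrier Lim. B \<oplus>\<^bsub>Lim\<^esub> A = \<zero>\<^bsub>Lim\<^esub>" using k cl by (metis k.a_inv_closed)
    assume B: "B \<in> carrier Lim"
    show "A \<oplus>\<^bsub>Lim\<^esub> B \<in> carrier Lim" "A \<oplus>\<^bsub>Lim\<^esub> B = B \<oplus>\<^bsub>Lim\<^esub> A"
    proof -
      from Lim_obtain2[OF A B] obtain i x y where i: "i \<in> I" "x \<in> carrier (K i)" "y \<in> carrier (K i)"
        "A = cls i x" "B = cls i y" .
      interpret i: field "K i" by (rule K_field[OF i(1)])
      show "A \<oplus>\<^bsub>Lim\<^esub> B \<in> carrier Lim" "A \<oplus>\<^bsub>Lim\<^esub> B = B \<oplus>\<^bsub>Lim\<^esub> A"
        using i cl by (simp_all add: Lim_add i.a_comm)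
    qed
    assume C: "C \<in> carrier Lim"
    from Lim_obtain3[OF A B C] obtain i x y z where i: "i \<in> I" "x \<in> carrier (K i)" "y \<in> carrier (K i)"
      "z \<in> carrier (K i)" "A = cls i x" "B = cls i y" "C = cls i z" .
    interpret i: field "K i" by (rule K_field[OF i(1)])
    show "A \<oplus>\<^bsub>Lim\<^esub> B \<oplus>\<^bsub>Lim\<^esub> C = A \<oplus>\<^bsub>Lim\<^esub> (B \<oplus>\<^bsub>Lim\<^esub> C)"
      using i by (simp add: Lim_add i.a_assoc)
  next
    obtain k where "k \<in> I" using index_nonempty by blast
    then show "\<zero>\<^bsub>Lim\<^esub> \<in> carrier Lim"
      using Lim_zero cl ring.ring_simprules(2)[OF K_ring] by simp
  qed
  show "comm_monoid Lim"
  proof (rule comm_monoidI)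
    fix A B C
    assume A: "A \<in> carrier Lim"
    obtain k x where k: "k \<in> I" "x \<in> carrier (K k)" "A = cls k x" using A by (auto simp: Lim_carrier)
    interpret k: field "K k" by (rule K_field[OF k(1)])
    show "\<one>\<^bsub>Lim\<^esub> \<otimes>\<^bsub>Lim\<^esub> A = A" using k by (simp add: Lim_one[OF k(1)] Lim_mult)
    assume B: "B \<in> carrier Lim"
    show "A \<otimes>\<^bsub>Lim\<^esub> B \<in> carrier Lim" "A \<otimes>\<^bsub>Lim\<^esub> B = B \<otimes>\<^bsub>Lim\<^esub> A"
    proof -
      from Lim_obtain2[OF A B] obtain i x y where i: "i \<in> I" "x \<in> carrier (K i)" "y \<in> carrier (K i)"
        "A = cls i x" "B = cls i y" .
      interpret i: field "K i" by (rule K_field[OF i(1)])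
      show "A \<otimes>\<^bsub>Lim\<^esub> B \<in> carrier Lim" "A \<otimes>\<^bsub>Lim\<^esub> B = B \<otimes>\<^bsub>Lim\<^esub> A"
        using i cl by (simp_all add: Lim_mult i.m_comm)
    qed
    assume C: "C \<in> carrier Lim"
    from Lim_obtain3[OF A B C] obtain i x y z where i: "i \<in> I" "x \<in> carrier (K i)" "y \<in> carrier (K i)"
      "z \<in> carrier (K i)" "A = cls i x" "B = cls i y" "C = cls i z" .
    interpret i: field "K i" by (rule K_field[OF i(1)])
    show "A \<otimes>\<^bsub>Lim\<^esub> B \<otimes>\<^bsub>Lim\<^esub> C = A \<otimes>\<^bsub>Lim\<^esub> (B \<otimes>\<^bsub>Lim\<^esub> C)"
      using i by (simp add: Lim_mult i.m_assoc)
  next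
    obtain k where "k \<in> I" using index_nonempty by blast
    then show "\<one>\<^bsub>Lim\<^esub> \<in> carrier Lim"
      using Lim_one cl ring.ring_simprules(6)[OF K_ring] by simp
  qed
  fix A B C
  assume "A \<in> carrier Lim" "B \<in> carrier Lim" "C \<in> carrier Lim"
  from Lim_obtain3[OF this] obtain i x y z where i: "i \<in> I" "x \<in> carrier (K i)" "y \<in> carrier (K i)"
    "z \<in> carrier (K i)" "A = cls i x" "B = cls i y" "C = cls i z" .
  interpret i: field "K i" by (rule K_field[OF i(1)])
  show "(A \<oplus>\<^bsub>Lim\<^esub> B) \<otimes>\<^bsub>Lim\<^esub> C = A \<otimes>\<^bsub>Lim\<^esub> C \<oplus>\<^bsub>Lim\<^esub> B \<otimes>\<^bsub>Lim\<^esub> C"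
    using i by (simp add: Lim_mult Lim_add i.l_distr)
qed

lemma Lim_field: "field Lim"
proof (rule cring.cring_fieldI[OF Lim_cring])
  interpret cring Lim by (rule Lim_cring)
  show "Units Lim = carrier Lim - {\<zero>\<^bsub>Lim\<^esub>}"
  proof
    obtain k where k: "k \<in> I" using index_nonempty by blast
    interpret k: field "K k" by (rule K_field[OF k])
    have "\<one>\<^bsub>Lim\<^esub> \<noteq> \<zero>\<^bsub>Lim\<^esub>"
      using cls_inj[of k "\<one>\<^bsub>K k\<^esub>" "\<zero>\<^bsub>K k\<^esub>"] k Lim_one[OF k] Lim_zero[OF k] by auto
    then show "Units Lim \<subseteq> carrier Lim - {\<zero>\<^bsub>Lim\<^esub>}"
      unfolding Units_def by auto
    show "carrier Lim - {\<zero>\<^bsub>Lim\<^esub>} \<subseteq> Units Lim"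
    proof
      fix A assume A: "A \<in> carrier Lim - {\<zero>\<^bsub>Lim\<^esub>}"
      then obtain i x where i: "i \<in> I" "x \<in> carrier (K i)" "A = cls i x" by (auto simp: Lim_carrier)
      interpret i: field "K i" by (rule K_field[OF i(1)])
      have "x \<noteq> \<zero>\<^bsub>K i\<^esub>" using A i Lim_zero[OF i(1)] by auto
      then have u: "x \<in> Units (K i)" using i.field_Units i by blast
      then have 1: "cls i (inv\<^bsub>K i\<^esub> x) \<otimes>\<^bsub>Lim\<^esub> A = \<one>\<^bsub>Lim\<^esub>"
        using i by (simp add: Lim_mult Lim_one[OF i(1)] i.Units_l_inv)
      have 2: "cls i (inv\<^bsub>K i\<^esub> x) \<in> carrier Lim" using Lim_closed[OF i(1)] u by simp
      have "A \<otimes>\<^bsub>Lim\<^esub> cls i (inv\<^bsub>K i\<^esub> x) = \<one>\<^bsub>Lim\<^esub>" using 1 2 A m_comm by simp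
      with 1 2 A show "A \<in> Units Lim" unfolding Units_def by blast
    qed
  qed
qed

lemma cls_hom: "i \<in> I \<Longrightarrow> cls i \<in> ring_hom (K i) Lim"
  by (rule ring_hom_memI) (simp_all add: Lim_closed Lim_mult Lim_add Lim_one)

lemma cls_ring_hom_cring: "i \<in> I \<Longrightarrow> ring_hom_cring (K i) Lim (cls i)"
  by (intro ring_hom_cring.intro ring_hom_cring_axioms.intro fieldE(1)[OF K_field] Lim_cring cls_hom)

lemma Lim_differential_field: "differential_field Lim"
proof (rule differential_field.intro[OF Lim_field], unfold_locales)
  fix n :: nat assume n: "n > 0"
  obtain k where k: "k \<in> I" using index_nonempty by blast
  interpret k: differential_field "K k" by (rule diff_field[OF k])
  interpret h: ring_hom_cring "K k" Lim "cls k" by (rule cls_ring_hom_cring[OF k])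
  have "add_pow Lim n \<one>\<^bsub>Lim\<^esub> = cls k (add_pow (K k) n \<one>\<^bsub>K k\<^esub>)"
    using h.hom_add_pow_nat[of "\<one>\<^bsub>K k\<^esub>" n] by simp
  moreover have "cls k (add_pow (K k) n \<one>\<^bsub>K k\<^esub>) \<noteq> cls k \<zero>\<^bsub>K k\<^esub>"
  proof
    assume "cls k (add_pow (K k) n \<one>\<^bsub>K k\<^esub>) = cls k \<zero>\<^bsub>K k\<^esub>"
    then have "add_pow (K k) n \<one>\<^bsub>K k\<^esub> = \<zero>\<^bsub>K k\<^esub>"
      by (intro cls_inj[OF k]) simp_all
    then show False using k.char_zero[OF n] by simp
  qed
  ultimately show "add_pow Lim n \<one>\<^bsub>Lim\<^esub> \<noteq> \<zero>\<^bsub>Lim\<^esub>"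
    unfolding Lim_zero[OF k] by simp
next
  fix d A assume "A \<in> carrier Lim"
  then obtain i x where i: "i \<in> I" "x \<in> carrier (K i)" "A = cls i x" by (auto simp: Lim_carrier)
  interpret i: differential_field "K i" by (rule diff_field[OF i(1)])
  show "der Lim d A \<in> carrier Lim" using i by (simp add: Lim_der Lim_closed i.der_closed)
next
  fix d A B assume "A \<in> carrier Lim" "B \<in> carrier Lim"
  from Lim_obtain2[OF this] obtain i x y where i: "i \<in> I" "x \<in> carrier (K i)" "y \<in> carrier (K i)"
    "A = cls i x" "B = cls i y" .
  interpret i: differential_field "K i" by (rule diff_field[OF i(1)])
  show "der Lim d (A \<oplus>\<^bsub>Lim\<^esub> B) = der Lim d A \<oplus>\<^bsub>Lim\<^esub> der Lim d B"
    "der Lim d (A \<otimes>\<^bsub>Lim\<^esub> B) = der Lim d A \<otimes>\<^bsub>Lim\<^esub> B \<oplus>\<^bsub>Lim\<^esub> A \<otimes>\<^bsub>Lim\<^esub> der Lim d B"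
    using i by (simp_all add: Lim_der Lim_add Lim_mult i.der_closed i.der_add i.der_mult)
next
  fix d e A assume "A \<in> carrier Lim"
  then obtain i x where i: "i \<in> I" "x \<in> carrier (K i)" "A = cls i x" by (auto simp: Lim_carrier)
  interpret i: differential_field "K i" by (rule diff_field[OF i(1)])
  show "der Lim d (der Lim e A) = der Lim e (der Lim d A)"
    using i by (simp add: Lim_der i.der_closed i.der_commute)
qed

lemma cls_embedding: "i \<in> I \<Longrightarrow> differential_embedding (cls i) (K i) Lim"
  unfolding differential_embedding_def differential_hom_def
  using cls_hom Lim_der cls_inj by (auto intro!: inj_onI)

text \<open>A solution in the limit has finitely many coordinates, so it already exists in some
  \<open>K k\<close> above \<open>i\<close>, where the hypothesis on the transition map
  applies.\<close>

lemma cls_ec: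
  assumes b: "\<And>j. \<lbrakk>j \<in> I; i \<preceq> j\<rbrakk> \<Longrightarrow> ec_as_field (f i j ` carrier (K i)) (K j)" and i: "i \<in> I"
  shows "ec_as_field (cls i ` carrier (K i)) Lim"
proof -
  interpret L: field Lim by (rule Lim_field)
  interpret i: field "K i" by (rule K_field[OF i])
  interpret hi: ring_hom_cring "K i" Lim "cls i" by (rule cls_ring_hom_cring[OF i])
  have sub: "subfield (cls i ` carrier (K i)) Lim"
    by (rule ring_hom_ring.img_is_subfield(2)[OF _ i.carrier_is_subfield L.one_not_zero])
      (rule ring_hom_ringI2[OF i.ring_axioms L.ring_axioms cls_hom[OF i]])
  show ?thesis
    unfolding ec_as_field_def
  proof (intro conjI sub allI impI; elim conjE bexE)
    fix n and S :: "(nat multiset \<Rightarrow> ('i \<times> 'a) set) set" and a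
    assume S: "finite S" "S \<subseteq> L.indexed_pset {..<n} (cls i ` carrier (K i))"
      and a: "a \<in> {..<n} \<rightarrow> carrier Lim" "\<forall>p\<in>S. mpoly_eval Lim a p = \<zero>\<^bsub>Lim\<^esub>"
    obtain k0 where k0: "k0 \<in> I" "a ` {..<n} \<subseteq> cls k0 ` carrier (K k0)"
    proof -
      have "finite (a ` {..<n})" "a ` {..<n} \<subseteq> carrier Lim" using a(1) by auto
      from Lim_common[OF this] show thesis using that by blast
    qed
    obtain k where k: "k \<in> I" "i \<preceq> k" "k0 \<preceq> k" using directed i k0 by blast
    interpret k: field "K k" by (rule K_field[OF k(1)])
    interpret hk: ring_hom_cring "K k" Lim "cls k" by (rule cls_ring_hom_cring[OF k(1)])
    interpret fk: ring_hom_cring "K i" "K k" "f i k"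
      by unfold_locales (rule f_hom(1)[OF i k(1,2)])
    have up: "cls k0 y \<in> cls k ` carrier (K k)" if "y \<in> carrier (K k0)" for y
      using cls_up[of k0 k y] f_hom(4)[of k0 k y] that k k0(1) by (metis imageI)
    have ak: "a j \<in> cls k ` carrier (K k)" if "j < n" for j
    proof -
      have "a j \<in> cls k0 ` carrier (K k0)" using k0(2) that by (meson image_subset_iff lessThan_iff)
      then obtain y where "a j = cls k0 y" "y \<in> carrier (K k0)" by (rule imageE)
      then show ?thesis using up by simp
    qed
    define a0 where "a0 = inv_into (carrier (K k)) (cls k) \<circ> a"
    have a0: "a0 j \<in> carrier (K k)" "a j = cls k (a0 j)" if "j < n" for j
      using ak[OF that] unfolding a0_def by (auto intro: inv_into_into simp: f_inv_into_f)
    have a0K: "a0 \<in> {..<n} \<rightarrow> carrier (K k)" using a0 by auto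
    have comp: "cls i \<circ> p = cls k \<circ> (f i k \<circ> p)" if "p \<in> i.indexed_pset {..<n} (carrier (K i))"
      for p :: "nat multiset \<Rightarrow> 'a"
      using cls_up[OF i k(1,2)] i.indexed_pset_coeff[OF that subset_refl] by auto
    have Fk: "f i k ` carrier (K i) \<subseteq> carrier (K k)" by auto
    have "S \<subseteq> (\<lambda>p. cls i \<circ> p) ` i.indexed_pset {..<n} (carrier (K i))"
    proof
      fix q assume "q \<in> S"
      then obtain p where "p \<in> i.indexed_pset {..<n} (carrier (K i))" "q = cls i \<circ> p"
        using hi.indexed_pset_image_obtain[of q "{..<n}" "carrier (K i)"] S(2) by blast
      then show "q \<in> (\<lambda>p. cls i \<circ> p) ` i.indexed_pset {..<n} (carrier (K i))" by blast
    qed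
    from finite_subset_image[OF S(1) this]
    obtain T where T: "T \<subseteq> i.indexed_pset {..<n} (carrier (K i))" "finite T" "S = (\<lambda>p. cls i \<circ> p) ` T"
      by blast
    have fp: "f i k \<circ> p \<in> k.indexed_pset {..<n} (f i k ` carrier (K i))" if "p \<in> T" for p
      using fk.map_indexed_pset[of p "{..<n}" "carrier (K i)"] T(1) that by blast
    have ev: "mpoly_eval Lim x' (cls i \<circ> p) = cls k (mpoly_eval (K k) x (f i k \<circ> p))"
      if "p \<in> T" "x \<in> {..<n} \<rightarrow> carrier (K k)" "\<And>j. j < n \<Longrightarrow> x' j = cls k (x j)" for p x x'
    proof -
      have "mpoly_eval Lim x' (cls k \<circ> (f i k \<circ> p)) = cls k (mpoly_eval (K k) x (f i k \<circ> p))"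
        by (rule hk.mpoly_eval_map[OF fp[OF that(1)] Fk that(2)]) (use that(3) in auto)
      then show ?thesis using comp T(1) that(1) by auto
    qed
    have "mpoly_eval (K k) a0 (f i k \<circ> p) = \<zero>\<^bsub>K k\<^esub>" if "p \<in> T" for p
    proof (rule cls_inj[OF k(1)])
      show "mpoly_eval (K k) a0 (f i k \<circ> p) \<in> carrier (K k)"
        by (rule k.mpoly_eval_closed[OF fp[OF that] Fk a0K])
      have "cls k (mpoly_eval (K k) a0 (f i k \<circ> p)) = mpoly_eval Lim a (cls i \<circ> p)"
        using ev[OF that a0K a0(2)] by simp
      also have "\<dots> = cls k \<zero>\<^bsub>K k\<^esub>"
        unfolding Lim_zero[OF k(1), symmetric] by (rule bspec[OF a(2)]) (simp only: T(3) imageI that)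
      finally show "cls k (mpoly_eval (K k) a0 (f i k \<circ> p)) = cls k \<zero>\<^bsub>K k\<^esub>" .
    qed simp
    then have "finite ((\<lambda>p. f i k \<circ> p) ` T) \<and>
        (\<lambda>p. f i k \<circ> p) ` T \<subseteq> k.indexed_pset {..<n} (f i k ` carrier (K i)) \<and>
        (\<exists>a\<in>{..<n} \<rightarrow> carrier (K k). \<forall>p\<in>(\<lambda>p. f i k \<circ> p) ` T. mpoly_eval (K k) a p = \<zero>\<^bsub>K k\<^esub>)"
      using T(2) fp a0K by blast
    from conjunct2[OF b[OF k(1,2), unfolded ec_as_field_def], rule_format, OF this]
    obtain x where x: "x \<in> {..<n} \<rightarrow> f i k ` carrier (K i)"
      "\<forall>p\<in>(\<lambda>p. f i k \<circ> p) ` T. mpoly_eval (K k) x p = \<zero>\<^bsub>K k\<^esub>" ..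
    have xK: "x \<in> {..<n} \<rightarrow> carrier (K k)" using x(1) Fk by blast
    show "\<exists>a\<in>{..<n} \<rightarrow> cls i ` carrier (K i). \<forall>p\<in>S. mpoly_eval Lim a p = \<zero>\<^bsub>Lim\<^esub>"
    proof (intro bexI[of _ "cls k \<circ> x"] ballI)
      show "cls k \<circ> x \<in> {..<n} \<rightarrow> cls i ` carrier (K i)"
      proof
        fix j assume "j \<in> {..<n}"
        then obtain y where "y \<in> carrier (K i)" "x j = f i k y" using x(1) by blast
        then show "(cls k \<circ> x) j \<in> cls i ` carrier (K i)" using cls_up[OF i k(1,2)] by simp
      qed
      fix q assume "q \<in> S"
      then obtain p where p: "p \<in> T" "q = cls i \<circ> p" using T(3) by blast
      have "mpoly_eval (K k) x (f i k \<circ> p) = \<zero>\<^bsub>K k\<^esub>"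
        by (rule bspec[OF x(2)]) (rule imageI[OF p(1)])
      then show "mpoly_eval Lim (cls k \<circ> x) q = \<zero>\<^bsub>Lim\<^esub>"
        unfolding p(2) Lim_zero[OF k(1)] using ev[OF p(1) xK, of "cls k \<circ> x"] by simp
    qed
  qed
qed

end

section \<open>Largeness and differential largeness of the limit\<close>

context differential_directed_system
begin

text \<open>A smooth point on a variety, its tangent space and the dimension are captured by
  finitely many elements of the limit, so the variety can be treated over one large member by
  \<open>large_descent\<close>.\<close>

theorem Lim_large:
  assumes a: "\<And>i. i \<in> I \<Longrightarrow> large_field (K i)"
    and b: "\<And>i j. \<lbrakk>i \<in> I; j \<in> I; i \<preceq> j\<rbrakk> \<Longrightarrow> ec_as_field (f i j ` carrier (K i)) (K j)"
  shows "large_field Lim"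
  unfolding large_field_def
proof (intro conjI Lim_field allI impI; elim conjE exE)
  fix n P x
  assume P: "irreducible_affine_variety Lim n P" and x: "smooth_rational_point Lim n P x"
  interpret L: field Lim by (rule Lim_field)
  let ?M = "mpoly_ring Lim {..<n}" and ?pol = "L.indexed_pset {..<n} (carrier Lim)"
  have Pp: "primeideal P ?M" using P by (simp add: irreducible_affine_variety_def)
  have Pi: "ideal P ?M" by (rule primeideal.axioms(1)[OF Pp])
  note PI = L.ideal_imp_poly_ideal[OF Pi]
  note Ppol = L.poly_idealD(1)[OF PI]
  obtain G where G: "finite G" "G \<subseteq> P"
    "\<And>J. L.poly_ideal {..<n} (carrier Lim) J \<Longrightarrow> G \<subseteq> J \<Longrightarrow> P \<subseteq> J"
    by (rule L.hilbert_basis[OF L.carrier_is_subfield finite_lessThan PI]) (rule that, assumption+)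
  have xr: "x \<in> rational_points Lim n P" using x by (simp add: smooth_rational_point_def)
  have xL: "x j \<in> carrier Lim" if "j < n" for j
    using xr that by (simp add: rational_points_def PiE_iff)
  let ?T = "tangent_space Lim n P x"
  obtain d where d: "has_vector_dim Lim n ?T d" "variety_dim Lim n P = enat d"
    using x unfolding smooth_rational_point_def by (elim conjE exE)
  obtain b where bT: "b \<in> {..<d} \<rightarrow> ?T" and bu: "\<forall>v\<in>?T. \<exists>!c. c \<in> {..<d} \<rightarrow>\<^sub>E carrier Lim \<and>
      (\<forall>j<n. v j = (\<Oplus>\<^bsub>Lim\<^esub>k\<in>{..<d}. c k \<otimes>\<^bsub>Lim\<^esub> b k j))"
    using d(1) unfolding has_vector_dim_def by (elim bexE)
  have bL: "b k j \<in> carrier Lim" if "k < d" "j < n" for k j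
  proof -
    have "b k \<in> ?T" using bT that(1) by (simp add: Pi_iff)
    then show ?thesis using that(2) by (simp add: tangent_space_def PiE_iff)
  qed
  \<comment> \<open>A chain that attains the dimension. It is asked for only when \<open>d\<close>
    is positive, as a supremum 0 does not by itself exhibit a chain.\<close>
  have "\<exists>C. d > 0 \<longrightarrow> prime_chain ?M P d C"
  proof (cases "d > 0")
    case True
    have "Sup {enat e | e. \<exists>C. prime_chain ?M P e C} = enat d"
      using d(2) cring.krull_dim_quotient[OF L.mpoly_ring_cring Pi] by (simp only: variety_dim_def)
    from Sup_enat_attained[OF this True] show ?thesis by (elim exE) (intro exI impI)
  qed simp
  then obtain C where C: "d > 0 \<Longrightarrow> prime_chain ?M P d C" by (elim exE) (rule that, simp)
  \<comment> \<open>One polynomial for each strict inclusion turns the strictness of the chain into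
    finite data.\<close>
  have "\<exists>w. w \<in> C (Suc i) \<and> w \<notin> C i" if "i < d" for i
  proof -
    have "C i \<subset> C (Suc i)" using C that by (simp add: prime_chain_def)
    then show ?thesis by (rule psubset_imp_ex_mem[THEN exE]) (intro exI, simp only: Diff_iff)
  qed
  then obtain w where w: "w i \<in> C (Suc i)" "w i \<notin> C i" if "i < d" for i by metis
  have wpol: "w i \<in> ?pol" if i: "i < d" for i
  proof -
    have "primeideal (C (Suc i)) ?M" using C i by (simp add: prime_chain_def)
    from L.poly_idealD(1)[OF L.ideal_imp_poly_ideal[OF primeideal.axioms(1)[OF this]]]
    show ?thesis using w(1)[OF i] by (rule subsetD)
  qed
  show "rational_points_dense Lim n P"
    unfolding rational_points_dense_def
  proof
    fix g assume g: "g \<in> carrier ?M - P"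
    then have gpol: "g \<in> ?pol" and gP: "g \<notin> P" by (simp_all add: L.mpoly_ring_simps)
    let ?S = "insert g (G \<union> w ` {..<d})"
    have "finite ?S" "?S \<subseteq> ?pol" using G(1,2) Ppol gpol wpol by (simp, blast)
    from L.finite_polys_finite_coeffs[OF this]
    obtain Y where Y: "Y \<subseteq> carrier Lim" "finite Y" "?S \<subseteq> L.indexed_pset {..<n} Y" by blast
    \<comment> \<open>All that has to be defined over one member: the coefficients of
      \<open>g\<close>, of the generators and of the witnesses, together with the coordinates of the
      point and of the tangent basis.\<close>
    let ?Z = "Y \<union> x ` {..<n} \<union> {b k j | k j. k < d \<and> j < n}"
    have "{b k j | k j. k < d \<and> j < n} = (\<lambda>(k, j). b k j) ` ({..<d} \<times> {..<n})" by auto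
    then have "finite ?Z" using Y(2) by simp
    moreover have "?Z \<subseteq> carrier Lim" using Y(1) xL bL by auto
    ultimately obtain i where i: "i \<in> I" "?Z \<subseteq> cls i ` carrier (K i)" by (rule Lim_common)
    interpret i: field "K i" by (rule K_field[OF i(1)])
    interpret hi: ring_hom_cring "K i" Lim "cls i" by (rule cls_ring_hom_cring[OF i(1)])
    interpret e: ec_embedding "K i" Lim "cls i"
      by unfold_locales (rule cls_ec[OF assms(2) i(1)], rule i(1), assumption+)
    have "Y \<subseteq> cls i ` carrier (K i)" using i(2) by (rule order_trans[rotated]) blast
    then have "L.indexed_pset {..<n} Y \<subseteq> L.indexed_pset {..<n} (cls i ` carrier (K i))"
      by (rule L.indexed_pset_mono) (rule subset_refl)
    then have SK: "?S \<subseteq> L.indexed_pset {..<n} (cls i ` carrier (K i))" using Y(3) by (rule order_trans[rotated])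
    have lift: "\<exists>p\<in>i.indexed_pset {..<n} (carrier (K i)). q = cls i \<circ> p" if "q \<in> ?S" for q
      by (rule hi.indexed_pset_image_obtain[OF subsetD[OF SK that] subset_refl]) (rule bexI)
    obtain g0 where g0: "g0 \<in> i.indexed_pset {..<n} (carrier (K i))" "g = cls i \<circ> g0"
      using lift[OF insertI1] by (elim bexE)
    have "\<exists>y\<in>rational_points Lim n P. mpoly_eval Lim y (cls i \<circ> g0) \<noteq> \<zero>\<^bsub>Lim\<^esub>"
    proof (rule e.large_descent[OF a[OF i(1)] Pp G(2,3) _ xr _ bT _ _ d(2) C _ g0(1)])
      show "\<exists>p\<in>i.indexed_pset {..<n} (carrier (K i)). q = cls i \<circ> p" if "q \<in> G" for q
        using lift[of q] that by simp
      show "x j \<in> cls i ` carrier (K i)" if "j < n" for j by (rule subsetD[OF i(2)]) (use that in simp)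
      show "\<exists>!c. c \<in> {..<d} \<rightarrow>\<^sub>E carrier Lim \<and> (\<forall>j<n. v j = (\<Oplus>\<^bsub>Lim\<^esub>k\<in>{..<d}. c k \<otimes>\<^bsub>Lim\<^esub> b k j))"
        if "v \<in> ?T" for v by (rule bspec[OF bu that])
      show "b k j \<in> cls i ` carrier (K i)" if "k < d" "j < n" for k j
        by (rule subsetD[OF i(2)]) (use that in blast)
      show "\<exists>p\<in>i.indexed_pset {..<n} (carrier (K i)). cls i \<circ> p \<in> C (Suc k) \<and> cls i \<circ> p \<notin> C k"
        if "k < d" for k
      proof -
        have "w k \<in> ?S" using that by simp
        from lift[OF this] obtain p where "p \<in> i.indexed_pset {..<n} (carrier (K i))" "w k = cls i \<circ> p"
          by (elim bexE)
        with w[OF that] show ?thesis by (intro bexI[of _ p]) simp_all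
      qed
      show "cls i \<circ> g0 \<notin> P" using gP g0(2) by simp
    qed
    then show "\<exists>a\<in>rational_points Lim n P. mpoly_eval Lim a g \<noteq> \<zero>\<^bsub>Lim\<^esub>" unfolding g0(2) .
  qed
qed

text \<open>The coefficients of a system come from one \<open>K i\<close>, which by transitivity is
  existentially closed in the extension of the limit. Assumption \<open>c\<close> then leads to a
  solution in some \<open>K j\<close>, and thus in the limit.\<close>

theorem Lim_differentially_large:
  assumes a: "\<And>i. i \<in> I \<Longrightarrow> large_field (K i)"
    and b: "\<And>i j. \<lbrakk>i \<in> I; j \<in> I; i \<preceq> j\<rbrakk> \<Longrightarrow> ec_as_field (f i j ` carrier (K i)) (K j)"
    and c: "\<And>i. i \<in> I \<Longrightarrow> \<exists>j\<in>I. i \<preceq> j \<and>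
      (\<exists>\<phi>. differential_hom \<phi> (power_series_ring (K i)) (K j) \<and>
           (\<forall>x\<in>carrier (K i). \<phi> (ring.indexed_const (K i) x) = f i j x))"
  shows "differentially_large TYPE('b) Lim"
  unfolding differentially_large_def
proof (intro conjI Lim_differential_field Lim_large[OF a b] allI impI; (elim conjE)?; assumption?)
  fix M :: "('b, 'm) diff_ring" and h
  assume M: "differential_field M" and h: "differential_embedding h Lim M"
    and ec: "ec_as_field (h ` carrier Lim) M"
  interpret M: differential_field M by fact
  interpret L: differential_field Lim by (rule Lim_differential_field)
  note hD = differential_embeddingD[OF h]
  interpret h: ring_hom_cring Lim M h by unfold_locales (rule hD(1))
  have comp: "differential_embedding (h \<circ> cls i) (K i) M" if i: "i \<in> I" for i
  proof -
    note eD = differential_embeddingD[OF cls_embedding[OF i]]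
    have "h \<circ> cls i \<in> ring_hom (K i) M" by (rule ring_hom_trans[OF eD(1) hD(1)])
    moreover have "inj_on (h \<circ> cls i) (carrier (K i))"
      by (rule comp_inj_on[OF eD(2)]) (rule inj_on_subset[OF hD(2)], use eD(4) in blast)
    ultimately show ?thesis
      unfolding differential_embedding_def differential_hom_def using eD(3,4) hD(3) by simp
  qed
  show "ec_as_differential_field (h ` carrier Lim) M"
    unfolding ec_as_differential_field_def
  proof (intro conjI allI ballI impI; (elim conjE bexE)?)
    show "subfield (h ` carrier Lim) M" using ec by (simp add: ec_as_field_def)
    show "der M d y \<in> h ` carrier Lim" if "y \<in> h ` carrier Lim" for d y
    proof -
      from that obtain x where x: "y = h x" "x \<in> carrier Lim" by (rule imageE)
      have "der M d y = h (der Lim d x)" unfolding x(1) by (rule hD(3)[OF x(2), symmetric])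
      then show ?thesis using L.der_closed[OF x(2)] by simp
    qed
    fix n and S :: "((nat \<times> 'm multiset) multiset \<Rightarrow> 'b) set" and y
    assume S: "finite S" "S \<subseteq> M.indexed_pset ({..<n} \<times> UNIV) (h ` carrier Lim)"
      and y: "y \<in> {..<n} \<rightarrow> carrier M" "\<forall>p\<in>S. diff_poly_eval M y p = \<zero>\<^bsub>M\<^esub>"
    obtain Y where Y: "Y \<subseteq> h ` carrier Lim" "finite Y" "S \<subseteq> M.indexed_pset ({..<n} \<times> UNIV) Y"
      using M.finite_polys_finite_coeffs[OF S] by blast
    obtain Z where Z: "Z \<subseteq> carrier Lim" "finite Z" "Y = h ` Z"
      using finite_subset_image[OF Y(2,1)] by (elim exE conjE) (rule that)
    obtain i where i: "i \<in> I" "Z \<subseteq> cls i ` carrier (K i)" using Lim_common[OF Z(2,1)] .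
    have "Y \<subseteq> (h \<circ> cls i) ` carrier (K i)" unfolding Z(3) image_comp[symmetric] by (rule image_mono[OF i(2)])
    then have SK: "S \<subseteq> M.indexed_pset ({..<n} \<times> UNIV) ((h \<circ> cls i) ` carrier (K i))"
      using Y(3) M.indexed_pset_mono[OF _ subset_refl] by (meson order_trans)
    obtain j \<phi> where j: "j \<in> I" "i \<preceq> j" and \<phi>: "differential_hom \<phi> (power_series_ring (K i)) (K j)"
      "\<forall>x\<in>carrier (K i). \<phi> (ring.indexed_const (K i) x) = f i j x" using c[OF i(1)] by blast
    have "ec_as_field (cls i ` carrier (K i)) Lim"
      by (rule cls_ec[OF b i(1)]) (rule i(1), assumption+)
    from ec_as_field_trans[OF Lim_field M.field_axioms hD(1,2) this ec]
    have eci: "ec_as_field ((h \<circ> cls i) ` carrier (K i)) M" by (simp only: image_comp)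
    have "\<exists>z\<in>{..<n} \<rightarrow> (h \<circ> cls j) ` carrier (K j). \<forall>p\<in>S. diff_poly_eval M z p = \<zero>\<^bsub>M\<^esub>"
    proof (rule differential_solution_transfer[OF M diff_field[OF i(1)] diff_field[OF j(1)] comp[OF i(1)]
          eci \<phi>(1) comp[OF j(1)] _ SK y(1) bspec[OF y(2)]])
      show "(h \<circ> cls j) (\<phi> (ring.indexed_const (K i) x)) = (h \<circ> cls i) x" if "x \<in> carrier (K i)" for x
        using cls_up[OF i(1) j that] \<phi>(2) that by simp
    qed
    then obtain z where z: "z \<in> {..<n} \<rightarrow> (h \<circ> cls j) ` carrier (K j)"
      "\<forall>p\<in>S. diff_poly_eval M z p = \<zero>\<^bsub>M\<^esub>" by (rule bexE)
    have "(h \<circ> cls j) ` carrier (K j) \<subseteq> h ` carrier Lim"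
      unfolding image_comp[symmetric] by (rule image_mono) (use Lim_closed[OF j(1)] in blast)
    then have "z \<in> {..<n} \<rightarrow> h ` carrier Lim" using z(1) by (meson Pi_mono subsetD)
    with z(2) show "\<exists>a\<in>{..<n} \<rightarrow> h ` carrier Lim. \<forall>p\<in>S. diff_poly_eval M a p = \<zero>\<^bsub>M\<^esub>" by (rule bexI)
  qed
qed

end

theorem proposition5p1:
  fixes I :: "'i set"
    and prec :: "'i \<Rightarrow> 'i \<Rightarrow> bool"
    and K :: "'i \<Rightarrow> ('a, 'm::finite) diff_ring"
    and f :: "'i \<Rightarrow> 'i \<Rightarrow> 'a \<Rightarrow> 'a"
  assumes "differential_directed_system I prec K f"
    and a: "\<And>i. i \<in> I \<Longrightarrow> large_field (K i)"
    and b: "\<And>i j. \<lbrakk>i \<in> I; j \<in> I; prec i j\<rbrakk> \<Longrightarrow> ec_as_field (f i j ` carrier (K i)) (K j)"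
    and c: "\<And>i. i \<in> I \<Longrightarrow> \<exists>j\<in>I. prec i j \<and>
      (\<exists>\<phi>. differential_hom \<phi> (power_series_ring (K i)) (K j) \<and>
           (\<forall>x\<in>carrier (K i). \<phi> (ring.indexed_const (K i) x) = f i j x))"
  shows "differentially_large TYPE('b) (direct_limit I prec K f)"
  using differential_directed_system.Lim_differentially_large[OF assms(1) a b c] .

end
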